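(* Let $h$ and $h_n$ ($n\in\mathbb{N}$) be elements of the universal Teichmüller space $\text{Möb}(S^1)\backslash QS(S^1)$, and let $s=s_h$ and $s_n=s_{h_n}$ be their shear maps on the Farey tesselation $\mathcal{F}$. Then $h_n\to h$ as $n\to\infty$ in the Teichmüller topology if and only if $M_{s,s_n}=\sup_p M_{s,s_n}(p)\to 1$ as $n\to\infty$, where the supremum is over all tips $p$ of fans of $\mathcal{F}$.
   Context: The hyperbolic plane is the upper half-plane $\mathbb{H}$ with metric $|dz|/y$; its boundary at infinity is $\hat{\mathbb{R}}=\mathbb{R}\cup\{\infty\}$, identified with the unit circle $S^1$ by a Möbius map. Farey tesselation: Let $\Delta_0$ be the ideal triangle with vertices $0,1,\infty$ and $\Gamma$ the group generated by the hyperbolic reflections in the three sides of $\Delta_0$. The Farey tesselation $\mathcal{F}$ is the set of geodesics (edges) in the $\Gamma$-orbit of the sides of $\Delta_0$; the set of endpoints of edges is $\hat{\mathbb{Q}}=\mathbb{Q}\cup\{\infty\}$, and the complementary triangles are the triangles $\gamma(\Delta_0)$, $\gamma\in\Gamma$. Fans: A fan with tip $p\in\hat{\mathbb{Q}}$ consists of all edges of $\mathcal{F}$ having $p$ as an endpoint. Its natural order: let $C$ be a horocycle centered at $p$, oriented so that the corresponding horoball lies to the left of $C$; for edges $e,e'$ of the fan, $e<e'$ if $e\cap C$ comes before $e'\cap C$ on $C$. This identifies the fan with $\mathbb{Z}$ in an order-preserving way, uniquely up to translation, and one such enumeration $(e_n)_{n\in\mathbb{Z}}$ is fixed for each fan.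 Shear: For two ideal triangles $\Delta_1,\Delta_2$ with disjoint interiors and a common side $e$, let $A\in PSL_2(\mathbb{R})$ be the Möbius map sending $\Delta_1$ to the triangle with vertices $-1,0,\infty$ and $e$ to the geodesic with endpoints $0,\infty$; then $A(\Delta_2)$ has vertices $0,e^r,\infty$, and the shear of $(\Delta_1,\Delta_2)$ is $r$ (it is symmetric in $\Delta_1,\Delta_2$). Shear map: An orientation preserving homeomorphism $h$ of $\hat{\mathbb{R}}$ acts on geodesics and ideal triangles through their ideal endpoints. Its shear map $s_h:\mathcal{F}\to\mathbb{R}$ assigns to $e\in\mathcal{F}$ the shear of $(h(\Delta_1),h(\Delta_2))$, where $\Delta_1,\Delta_2$ are the two complementary triangles of $\mathcal{F}$ with side $e$. It is unchanged if $h$ is post-composed with an element of $PSL_2(\mathbb{R})$. For a map $s:\mathcal{F}\to\mathbb{R}$, a fan $(e_n)_{n\in\mathbb{Z}}$ with tip $p$, $m\in\mathbb{Z}$ and an integer $k\ge0$, put, with $s_n=s(e_n)$, $$s(p;m,k)=\frac{e^{\frac{s_m}{2}}+e^{\frac{s_m}{2}+s_{m+1}}+\cdots+e^{\frac{s_m}{2}+s_{m+1}+\cdots+s_{m+k}}}{e^{-\frac{s_m}{2}}+e^{-\frac{s_m}{2}-s_{m-1}}+\cdots+e^{-\frac{s_m}{2}-s_{m-1}-\cdots-s_{m-k}}}.$$ For two such maps $s_1,s_2:\mathcal{F}\to\mathbb{R}$ put $$M_{s_1,s_2}(p)=\sup_{m\in\mathbb{Z},\,k\ge 0}\max\Big\{\frac{s_1(p;m,k)}{s_2(p;m,k)},\frac{s_2(p;m,k)}{s_1(p;m,k)}\Big\}.$$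 Universal Teichmüller space: An orientation preserving homeomorphism $h$ of $\hat{\mathbb{R}}$ fixing $\infty$ is $M$-quasisymmetric if $\frac1M\le\frac{h(x+t)-h(x)}{h(x)-h(x-t)}\le M$ for all $x\in\mathbb{R}$, $t>0$, and quasisymmetric if it is $M$-quasisymmetric for some $M\ge1$. Each element of $\text{Möb}(S^1)\backslash QS(S^1)$ (quasisymmetric maps modulo post-composition by Möbius maps preserving the circle) is represented by the unique quasisymmetric map of $\hat{\mathbb{R}}$ in its class fixing $0,1,\infty$. For such normalized maps: $h_n\to \mathrm{id}$ in the Teichmüller topology if $h_n$ is $M_n$-quasisymmetric with $M_n\to1$; and $h_n\to h$ in the Teichmüller topology if $h_n\circ h^{-1}\to\mathrm{id}$ in this sense. *)

theory Defs
  imports "HOL-Analysis.Analysis"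
begin

text \<open>
  The extended real line is the one-point compactification of the reals: \<open>None\<close> is the point at
  infinity, \<open>Some x\<close> the real point \<open>x\<close>.
\<close>

type_synonym rhat = "real option"

abbreviation rhat_top :: "rhat topology" where
  "rhat_top \<equiv> Alexandroff_compactification euclideanreal"

definition rhat_less :: "rhat \<Rightarrow> rhat \<Rightarrow> bool" where
  "rhat_less p q \<longleftrightarrow>
     (case p of None \<Rightarrow> False | Some x \<Rightarrow> (case q of None \<Rightarrow> True | Some y \<Rightarrow> x < y))"

text \<open>
  The cyclic order of the circle, in the direction of increasing reals; cutting the circle open
  just after infinity gives the linear order \<open>rhat_less\<close>.
\<close>

definition rhat_cyc :: "rhat \<Rightarrow> rhat \<Rightarrow> rhat \<Rightarrow> bool" where
  "rhat_cyc p q r \<longleftrightarrow>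
     (rhat_less p q \<and> rhat_less q r) \<or> (rhat_less q r \<and> rhat_less r p) \<or>
     (rhat_less r p \<and> rhat_less p q)"

definition orient_homeo :: "(rhat \<Rightarrow> rhat) \<Rightarrow> bool" where
  "orient_homeo h \<longleftrightarrow> homeomorphic_map rhat_top rhat_top h \<and>
     (\<forall>p q r. rhat_cyc p q r \<longrightarrow> rhat_cyc (h p) (h q) (h r))"

fun mob :: "real \<Rightarrow> real \<Rightarrow> real \<Rightarrow> real \<Rightarrow> rhat \<Rightarrow> rhat" where
  "mob a b c d None = (if c = 0 then None else Some (a / c))"
| "mob a b c d (Some x) = (if c * x + d = 0 then None else Some (moebius a b c d x))"

definition PSL2R :: "(rhat \<Rightarrow> rhat) set" where
  "PSL2R = {mob a b c d | a b c d. a * d - b * c = 1}"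

text \<open>
  The boundary actions of the hyperbolic reflections in the geodesic from \<open>a\<close> to infinity, and in
  the half-circle with centre \<open>c\<close> and radius \<open>r\<close> (an inversion in a circle).
\<close>

fun refl_line :: "real \<Rightarrow> rhat \<Rightarrow> rhat" where
  "refl_line a None = None"
| "refl_line a (Some x) = Some (2 * a - x)"

fun refl_circle :: "real \<Rightarrow> real \<Rightarrow> rhat \<Rightarrow> rhat" where
  "refl_circle c r None = Some c"
| "refl_circle c r (Some x) = (if x = c then None else Some (c + r\<^sup>2 / (x - c)))"

text \<open>The reflections are involutions, so closure under composition already yields a group.\<close>

inductive_set farey_group :: "(rhat \<Rightarrow> rhat) set" where
  farey_group_id: "id \<in> farey_group"
| farey_group_line0: "g \<in> farey_group \<Longrightarrow> refl_line 0 \<circ> g \<in> farey_group"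
| farey_group_line1: "g \<in> farey_group \<Longrightarrow> refl_line 1 \<circ> g \<in> farey_group"
| farey_group_circle: "g \<in> farey_group \<Longrightarrow> refl_circle (1/2) (1/2) \<circ> g \<in> farey_group"

text \<open>
  Geodesics and ideal triangles are given by their sets of ideal endpoints (two, respectively
  three, points of the extended real line), through which the group and all homeomorphisms act.
\<close>

definition farey_edges :: "rhat set set" where
  "farey_edges = {g ` e | g e. g \<in> farey_group \<and>
     e \<in> {{Some 0, Some 1}, {Some 1, None}, {Some 0, None}}}"

definition farey_triangles :: "rhat set set" where
  "farey_triangles = {g ` {Some 0, Some 1, None} | g. g \<in> farey_group}"

definition qhat :: "rhat set" where
  "qhat = insert None (Some ` \<rat>)"

definition fan :: "rhat \<Rightarrow> rhat set set" where
  "fan p = {e \<in> farey_edges. p \<in> e}"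

text \<open>The actual geodesic (vertical half-line or half-circle) in the upper half-plane with ideal endpoints \<open>e\<close>.\<close>

definition geodesic_points :: "rhat set \<Rightarrow> complex set" where
  "geodesic_points e = {z. Im z > 0 \<and>
     ((\<exists>a. e = {Some a, None} \<and> Re z = a) \<or>
      (\<exists>a b. a < b \<and> e = {Some a, Some b} \<and> cmod (z - of_real ((a + b) / 2)) = (b - a) / 2))}"

text \<open>
  Parametrised horocycles: the horizontal line at height \<open>t\<close>, traversed to the right (so that the
  horoball above it is on the left), and for a real centre \<open>x\<close> its image under the conformal
  automorphism \<open>w \<mapsto> x - 1 / w\<close>, which maps infinity to \<open>x\<close>.
\<close>

fun horocycle :: "rhat \<Rightarrow> real \<Rightarrow> real \<Rightarrow> complex" where
  "horocycle None t u = Complex u t"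
| "horocycle (Some x) t u = of_real x - 1 / Complex u t"

definition fan_less :: "rhat \<Rightarrow> rhat set \<Rightarrow> rhat set \<Rightarrow> bool" where
  "fan_less p e e' \<longleftrightarrow> (\<exists>t u u'. t > 0 \<and> u < u' \<and>
     horocycle p t u \<in> geodesic_points e \<and> horocycle p t u' \<in> geodesic_points e')"

definition fan_enumeration :: "rhat \<Rightarrow> (int \<Rightarrow> rhat set) \<Rightarrow> bool" where
  "fan_enumeration p E \<longleftrightarrow> bij_betw E UNIV (fan p) \<and> (\<forall>m n. m < n \<longrightarrow> fan_less p (E m) (E n))"

definition shear :: "rhat set \<Rightarrow> rhat set \<Rightarrow> rhat set \<Rightarrow> real" where
  "shear e T1 T2 = (THE r. \<exists>A \<in> PSL2R. A ` T1 = {Some (-1), Some 0, None} \<and>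
     A ` e = {Some 0, None} \<and> A ` T2 = {Some 0, Some (exp r), None})"

definition shear_map :: "(rhat \<Rightarrow> rhat) \<Rightarrow> rhat set \<Rightarrow> real" where
  "shear_map h e = (THE r. \<exists>T1 T2. T1 \<in> farey_triangles \<and> T2 \<in> farey_triangles \<and> T1 \<noteq> T2 \<and>
     e \<subseteq> T1 \<and> e \<subseteq> T2 \<and> r = shear (h ` e) (h ` T1) (h ` T2))"

definition fan_ratio :: "(rhat set \<Rightarrow> real) \<Rightarrow> (int \<Rightarrow> rhat set) \<Rightarrow> int \<Rightarrow> nat \<Rightarrow> real" where
  "fan_ratio s E m k =
     (\<Sum>j=0..k. exp (s (E m) / 2 + (\<Sum>i=1..j. s (E (m + int i))))) /
     (\<Sum>j=0..k. exp (- s (E m) / 2 - (\<Sum>i=1..j. s (E (m - int i)))))"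

text \<open>Suprema are taken in the extended reals, since they may be infinite.\<close>

definition fan_distortion ::
    "(int \<Rightarrow> rhat set) \<Rightarrow> (rhat set \<Rightarrow> real) \<Rightarrow> (rhat set \<Rightarrow> real) \<Rightarrow> ereal" where
  "fan_distortion E s1 s2 = (SUP m. SUP k. ereal
     (max (fan_ratio s1 E m k / fan_ratio s2 E m k) (fan_ratio s2 E m k / fan_ratio s1 E m k)))"

definition shear_distortion ::
    "(rhat \<Rightarrow> int \<Rightarrow> rhat set) \<Rightarrow> (rhat set \<Rightarrow> real) \<Rightarrow> (rhat set \<Rightarrow> real) \<Rightarrow> ereal" where
  "shear_distortion E s1 s2 = (SUP p \<in> qhat. fan_distortion (E p) s1 s2)"

abbreviation finite_part :: "(rhat \<Rightarrow> rhat) \<Rightarrow> real \<Rightarrow> real" where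
  "finite_part h x \<equiv> the (h (Some x))"

definition M_quasisymmetric :: "real \<Rightarrow> (rhat \<Rightarrow> rhat) \<Rightarrow> bool" where
  "M_quasisymmetric M h \<longleftrightarrow> orient_homeo h \<and> h None = None \<and>
     (\<forall>x. \<forall>t>0.
        1 / M \<le> (finite_part h (x + t) - finite_part h x) /
                 (finite_part h x - finite_part h (x - t)) \<and>
        (finite_part h (x + t) - finite_part h x) /
        (finite_part h x - finite_part h (x - t)) \<le> M)"

definition quasisymmetric :: "(rhat \<Rightarrow> rhat) \<Rightarrow> bool" where
  "quasisymmetric h \<longleftrightarrow> (\<exists>M\<ge>1. M_quasisymmetric M h)"

text \<open>
  Quasisymmetric maps of the circle need not fix infinity; this is reduced to the previous notion
  by post-composition with a Moebius map.
\<close>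

definition QS_circle :: "(rhat \<Rightarrow> rhat) set" where
  "QS_circle = {h. orient_homeo h \<and> (\<exists>A \<in> PSL2R. quasisymmetric (A \<circ> h))}"

definition mob_equiv :: "((rhat \<Rightarrow> rhat) \<times> (rhat \<Rightarrow> rhat)) set" where
  "mob_equiv = {(f, g). f \<in> QS_circle \<and> g \<in> QS_circle \<and> (\<exists>A \<in> PSL2R. g = A \<circ> f)}"

definition universal_teichmueller :: "(rhat \<Rightarrow> rhat) set set" where
  "universal_teichmueller = QS_circle // mob_equiv"

definition normalized_rep :: "(rhat \<Rightarrow> rhat) set \<Rightarrow> rhat \<Rightarrow> rhat" where
  "normalized_rep c =
     (THE h. h \<in> c \<and> h (Some 0) = Some 0 \<and> h (Some 1) = Some 1 \<and> h None = None)"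

definition tendsto_id :: "(nat \<Rightarrow> rhat \<Rightarrow> rhat) \<Rightarrow> bool" where
  "tendsto_id f \<longleftrightarrow> (\<exists>M. (\<forall>n. M_quasisymmetric (M n) (f n)) \<and> M \<longlonglongrightarrow> 1)"

definition teichmueller_tendsto ::
    "(nat \<Rightarrow> (rhat \<Rightarrow> rhat) set) \<Rightarrow> (rhat \<Rightarrow> rhat) set \<Rightarrow> bool" where
  "teichmueller_tendsto c d \<longleftrightarrow>
     tendsto_id (\<lambda>n. normalized_rep (c n) \<circ> inv (normalized_rep d))"

end

theory Submission
  imports Defs
begin

text \<open>
  The proof rests on translating shears into cross-ratios. Let \<open>g\<close> be an element of PSL(2,Z). In coordinates with
  \<open>g infinity\<close> and its image under a homeomorphism \<open>h\<close> at infinity, \<open>h\<close> becomes an increasing function \<open>K\<close> on the real line,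
  the edges of the fan with tip \<open>g infinity\<close> end in the integers, and the shear of the edge ending in \<open>m\<close> is the logarithm of
  the quotient of \<open>K (m + 1) - K m\<close> by \<open>K m - K (m - 1)\<close>. The sums in the fan ratio telescope, and with \<open>t = k + 1\<close>
  the fan ratio is the quotient of \<open>K (m + t) - K m\<close> by \<open>K m - K (m - t)\<close>, which is the cross-ratio of the images under \<open>h\<close> of
  \<open>g (m + t, m, m - t, infinity)\<close>. Hence the distance of two shear maps is at most \<open>\<kappa>\<close> exactly if the two homeomorphisms distort
  all these quadruples by a factor at most \<open>\<kappa>\<close> relative to each other (\<open>shear_distortion_le_iff\<close>, \<open>fan_close\<close>).

  Let \<open>H\<close> and \<open>L n\<close> be the normalised maps of the line and \<open>F n\<close> the composition of \<open>L n\<close> with the inverse of \<open>H\<close>. Both directions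
  compare two increasing maps on quadruples of points which are separated in the visual metric seen from
  a point \<open>z\<close> of the upper half-plane. By \<open>coherent_from_grid\<close> it is enough to compare the increments of the two maps on
  the cells of a grid which is fine on the scale \<open>Im z\<close>, provided that one of the maps is quasisymmetric: only
  this map needs a modulus of continuity, the other one is merely monotone. Since separation is Moebius
  invariant (\<open>sep_mob\<close>) and quasisymmetry is stable under Moebius changes of coordinates
  (\<open>line_qs_quasi_moebius\<close>), \<open>z\<close> can be moved to a convenient place.

  If \<open>F n\<close> is \<open>M n\<close>-quasisymmetric with \<open>M n\<close> tending to 1, then the images of the fan quadruples under \<open>H\<close> are separated, and
  comparing the identity with \<open>F n\<close> on equidistant grids shows that \<open>F n\<close> distorts them by a factor tending to 1
  (\<open>near_identity_distorts_little\<close>).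

  Conversely, suppose that the fan quadruples are distorted little. A symmetric triple of the line, pulled back by \<open>H\<close>, gives
  with infinity a quadruple that is separated from a point \<open>z\<close>, and PSL(2,Z) moves \<open>z\<close> to height at least 1/5
  (\<open>modular_reduction\<close>). If \<open>z\<close> is then very high, the integers give a fine grid on its scale, and the
  comparison on this grid is the hypothesis for one fan. If the height is bounded, finitely many mediant subdivisions of the
  integers are fine enough; their cells are compared by flips through adjacent Farey triangles, at the cost of an
  exponent that depends on the number of subdivisions only (\<open>fan_close_mediant\<close>, \<open>fan_close_sb_grid\<close>). Either
  way \<open>F n\<close> distorts all symmetric triples by a factor tending to 1 (\<open>fan_close_distorts_little\<close>).
\<close>

section \<open>Determinants, cross-ratios and Moebius maps of the extended line\<close>

text \<open>
  The determinant of two points in homogeneous coordinates, with \<open>Some x\<close> represented by \<open>(x, 1)\<close> and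
  infinity by \<open>(1, 0)\<close>. A Moebius map multiplies it by a factor for each of the two points (\<open>sdet_mob\<close>), so
  that cross-ratios and the cyclic order, being expressible through it, need no case distinction for infinity.
\<close>

fun sdet :: "rhat \<Rightarrow> rhat \<Rightarrow> real" where
  "sdet (Some x) (Some y) = x - y"
| "sdet (Some x) None = -1"
| "sdet None (Some y) = 1"
| "sdet None None = 0"

text \<open>
  The absolute cross-ratio of four points, with \<open>a, c\<close> opposite and \<open>b, d\<close> opposite. For \<open>d\<close> at infinity it
  is the quotient of the distance from \<open>a\<close> to \<open>b\<close> by the distance from \<open>b\<close> to \<open>c\<close> (\<open>cr_finite\<close>), the
  quantity that quasisymmetry controls.
\<close>

definition cr :: "rhat \<Rightarrow> rhat \<Rightarrow> rhat \<Rightarrow> rhat \<Rightarrow> real" where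
  "cr a b c d = \<bar>sdet a b * sdet c d / (sdet b c * sdet d a)\<bar>"

lemma sdet_eq_0_iff [simp]: "sdet p q = 0 \<longleftrightarrow> p = q"
  by (cases p; cases q) auto

lemma sdet_swap: "sdet q p = - sdet p q"
  by (cases p; cases q) auto

lemma rhat_cyc_iff_sdet: "rhat_cyc p q r \<longleftrightarrow> sdet p q * sdet q r * sdet r p > 0"
  by (cases p; cases q; cases r)
     (auto simp: rhat_cyc_def rhat_less_def zero_less_mult_iff mult_less_0_iff)

lemma rhat_cyc_rotate: "rhat_cyc p q r \<Longrightarrow> rhat_cyc q r p"
  by (auto simp: rhat_cyc_def)

lemma rhat_cyc_distinct: "rhat_cyc p q r \<Longrightarrow> p \<noteq> q \<and> q \<noteq> r \<and> r \<noteq> p"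
  by (auto simp: rhat_cyc_iff_sdet simp del: sdet_eq_0_iff)
     (metis less_irrefl mult_zero_left mult_zero_right sdet_eq_0_iff)+

lemma cr_pos: "a \<noteq> b \<Longrightarrow> c \<noteq> d \<Longrightarrow> b \<noteq> c \<Longrightarrow> d \<noteq> a \<Longrightarrow> cr a b c d > 0"
  by (simp add: cr_def)

lemma cr_symmetric_quadruple:
  "t \<noteq> 0 \<Longrightarrow> cr (Some (x + t)) (Some x) (Some (x - t)) None = 1"
  by (simp add: cr_def)

lemma cr_finite: "cr (Some a) (Some b) (Some c) None = \<bar>a - b\<bar> / \<bar>b - c\<bar>"
  by (simp add: cr_def abs_minus_commute)

text \<open>
  The point of the extended line with homogeneous coordinates \<open>(u, v)\<close>.
\<close>

definition hpt :: "real \<Rightarrow> real \<Rightarrow> rhat" where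
  "hpt u v = (if v = 0 then None else Some (u / v))"

lemma mob_hpt:
  assumes "a * d - b * c \<noteq> 0" "u \<noteq> 0 \<or> v \<noteq> 0"
  shows "mob a b c d (hpt u v) = hpt (a * u + b * v) (c * u + d * v)"
proof (cases "v = 0")
  case True
  then show ?thesis using assms by (auto simp: hpt_def)
next
  case False
  have *: "c * (u / v) + d = (c * u + d * v) / v" "a * (u / v) + b = (a * u + b * v) / v"
    using False by (simp_all add: field_simps)
  show ?thesis using False
    unfolding hpt_def mob.simps moebius_def if_not_P[OF False] * by simp
qed

lemma hpt_surj: "p = hpt (case p of None \<Rightarrow> 1 | Some x \<Rightarrow> x) (case p of None \<Rightarrow> 0 | Some x \<Rightarrow> 1)"
  by (cases p) (auto simp: hpt_def)

lemma hpt_cases: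
  obtains u v where "p = hpt u v" "u \<noteq> 0 \<or> v \<noteq> 0"
  using hpt_surj[of p] by (cases p) (auto intro: that)

lemma mob_comp:
  assumes "a * d - b * c \<noteq> 0" "a' * d' - b' * c' \<noteq> 0"
  shows "mob a b c d \<circ> mob a' b' c' d' =
    mob (a * a' + b * c') (a * b' + b * d') (c * a' + d * c') (c * b' + d * d')"
proof
  fix p :: rhat
  obtain u v where p: "p = hpt u v" and uv: "u \<noteq> 0 \<or> v \<noteq> 0" by (rule hpt_cases)
  have nz: "a' * u + b' * v \<noteq> 0 \<or> c' * u + d' * v \<noteq> 0"
  proof (rule ccontr)
    assume "\<not> ?thesis"
    then have e: "a' * u + b' * v = 0" "c' * u + d' * v = 0" by auto
    have "(a' * d' - b' * c') * u = d' * (a' * u + b' * v) - b' * (c' * u + d' * v)"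
         "(a' * d' - b' * c') * v = a' * (c' * u + d' * v) - c' * (a' * u + b' * v)"
      by (simp_all add: algebra_simps)
    then show False using e uv assms(2) by simp
  qed
  have "(a * a' + b * c') * (c * b' + d * d') - (a * b' + b * d') * (c * a' + d * c')
      = (a * d - b * c) * (a' * d' - b' * c')"
    by (simp add: algebra_simps)
  then have nz2: "(a * a' + b * c') * (c * b' + d * d') - (a * b' + b * d') * (c * a' + d * c') \<noteq> 0"
    using assms by simp
  show "(mob a b c d \<circ> mob a' b' c' d') p =
    mob (a * a' + b * c') (a * b' + b * d') (c * a' + d * c') (c * b' + d * d') p"
    unfolding p o_def mob_hpt[OF assms(2) uv] mob_hpt[OF assms(1) nz] mob_hpt[OF nz2 uv]
    by (simp add: algebra_simps)
qed

lemma mob_one: "mob 1 0 0 1 = id"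
proof
  show "mob 1 0 0 1 p = id p" for p by (cases p) (simp_all add: moebius_def)
qed

text \<open>
  The factor that a Moebius map of determinant 1 contributes at a point, in the normalisation of homogeneous
  coordinates used for \<open>sdet\<close>.
\<close>

fun mobfac :: "real \<Rightarrow> real \<Rightarrow> real \<Rightarrow> real \<Rightarrow> rhat \<Rightarrow> real" where
  "mobfac a b c d None = (if c = 0 then 1 / a else 1 / c)"
| "mobfac a b c d (Some x) = (if c * x + d = 0 then 1 / (a * x + b) else 1 / (c * x + d))"

lemma mobfac_nonzero:
  assumes "a * d - b * c = 1"
  shows "mobfac a b c d p \<noteq> 0"
proof (cases p)
  case None
  then show ?thesis using assms by auto
next
  case (Some x)
  have "a * x + b \<noteq> 0" if "c * x + d = 0"
  proof
    assume "a * x + b = 0"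
    moreover have "a * (c * x + d) - c * (a * x + b) = 1" using assms by (simp add: algebra_simps)
    ultimately show False using that by simp
  qed
  then show ?thesis using Some by auto
qed

lemma sdet_mob_Some_Some:
  assumes det: "a * d - b * c = 1"
  shows "sdet (mob a b c d (Some x)) (mob a b c d (Some y))
    = mobfac a b c d (Some x) * mobfac a b c d (Some y) * (x - y)"
proof -
  have key: "(a * x + b) * (c * y + d) - (a * y + b) * (c * x + d) = x - y"
    using det by algebra
  consider "c * x + d = 0" "c * y + d = 0" | "c * x + d \<noteq> 0" "c * y + d = 0"
    | "c * x + d = 0" "c * y + d \<noteq> 0" | "c * x + d \<noteq> 0" "c * y + d \<noteq> 0" by blast
  then show ?thesis
  proof cases
    case 1
    then show ?thesis using key by simp
  next
    case 2
    then have e: "- ((a * y + b) * (c * x + d)) = x - y" using key by simp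
    show ?thesis
    proof (cases "x = y")
      case False
      with e have "a * y + b \<noteq> 0" by auto
      then show ?thesis using 2 by (simp add: e[symmetric])
    qed (use 2 in simp)
  next
    case 3
    then have e: "(a * x + b) * (c * y + d) = x - y" using key by simp
    show ?thesis
    proof (cases "x = y")
      case False
      with e have "a * x + b \<noteq> 0" by auto
      then show ?thesis using 3 by (simp add: e[symmetric])
    qed (use 3 in simp)
  next
    case 4
    then show ?thesis using key by (simp add: moebius_def field_simps)
  qed
qed

lemma sdet_mob_Some_None:
  assumes det: "a * d - b * c = 1"
  shows "sdet (mob a b c d (Some x)) (mob a b c d None)
    = - mobfac a b c d (Some x) * mobfac a b c d None"
proof (cases "c = 0")
  case True
  then have "a * d = 1" using det by simp
  then have "a \<noteq> 0" "d \<noteq> 0" by auto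
  moreover from this have "d = 1 / a" using \<open>a * d = 1\<close> by (simp add: field_simps)
  ultimately have "a \<noteq> 0" "d \<noteq> 0" "d = 1 / a" by auto
  then show ?thesis using True by simp
next
  case False
  show ?thesis
  proof (cases "c * x + d = 0")
    case True
    then have "c * (a * x + b) = -1" using det by algebra
    then have "a * x + b = - 1 / c" using False by (simp add: field_simps)
    then show ?thesis using True False by simp
  next
    case nz: False
    have "(a * x + b) / (c * x + d) - a / c = (c * (a * x + b) - a * (c * x + d)) / (c * (c * x + d))"
      using nz False by (simp add: field_simps)
    also have "c * (a * x + b) - a * (c * x + d) = -1" using det by algebra
    finally show ?thesis using nz False by (simp add: moebius_def)
  qed
qed

lemma sdet_mob:
  assumes det: "a * d - b * c = 1"
  shows "sdet (mob a b c d p) (mob a b c d q) = mobfac a b c d p * mobfac a b c d q * sdet p q"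
proof (cases p)
  case None
  show ?thesis
  proof (cases q)
    case (Some y)
    then show ?thesis using sdet_mob_Some_None[OF det, of y]
      sdet_swap[of "mob a b c d None" "mob a b c d (Some y)"] None by (simp del: mob.simps mobfac.simps)
  qed (use None in simp)
next
  case (Some x)
  then show ?thesis
    using sdet_mob_Some_Some[OF det] sdet_mob_Some_None[OF det]
    by (cases q) (simp_all del: mob.simps mobfac.simps)
qed

lemma PSL2R_cases:
  assumes "A \<in> PSL2R"
  obtains a b c d where "A = mob a b c d" "a * d - b * c = 1"
  using assms unfolding PSL2R_def by blast

lemma mob_in_PSL2R: "a * d - b * c = 1 \<Longrightarrow> mob a b c d \<in> PSL2R"
  unfolding PSL2R_def by blast

lemma PSL2R_id: "id \<in> PSL2R"
  using mob_in_PSL2R[of 1 1 0 0] by (simp add: mob_one)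

lemma PSL2R_comp:
  assumes "A \<in> PSL2R" "B \<in> PSL2R"
  shows "A \<circ> B \<in> PSL2R"
proof -
  obtain a b c d where A: "A = mob a b c d" "a * d - b * c = 1" using assms(1) by (rule PSL2R_cases)
  obtain a' b' c' d' where B: "B = mob a' b' c' d'" "a' * d' - b' * c' = 1"
    using assms(2) by (rule PSL2R_cases)
  have "(a * a' + b * c') * (c * b' + d * d') - (a * b' + b * d') * (c * a' + d * c')
      = (a * d - b * c) * (a' * d' - b' * c')"
    by (simp add: algebra_simps)
  also have "\<dots> = 1" using A B by simp
  finally show ?thesis
    using mob_comp[of a d b c a' d' b' c'] A B mob_in_PSL2R by simp
qed

lemma mob_inverse:
  assumes "a * d - b * c = 1"
  shows "mob d (-b) (-c) a \<circ> mob a b c d = id" "mob a b c d \<circ> mob d (-b) (-c) a = id"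
proof -
  have "d * a - (-b) * (-c) = 1" using assms by (simp add: algebra_simps)
  then have "mob d (-b) (-c) a \<circ> mob a b c d = mob 1 0 0 1"
    "mob a b c d \<circ> mob d (-b) (-c) a = mob 1 0 0 1"
    using assms mob_comp[of d a "-b" "-c" a d b c] mob_comp[of a d b c d a "-b" "-c"]
    by (simp_all add: algebra_simps)
  then show "mob d (-b) (-c) a \<circ> mob a b c d = id" "mob a b c d \<circ> mob d (-b) (-c) a = id"
    by (simp_all add: mob_one)
qed

lemma PSL2R_inverse:
  assumes "A \<in> PSL2R"
  obtains B where "B \<in> PSL2R" "A \<circ> B = id" "B \<circ> A = id"
proof -
  obtain a b c d where A: "A = mob a b c d" "a * d - b * c = 1" using assms by (rule PSL2R_cases)
  have "mob d (-b) (-c) a \<in> PSL2R" using A by (intro mob_in_PSL2R) (simp add: algebra_simps)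
  then show ?thesis using that mob_inverse[OF A(2)] A(1) by metis
qed

lemma PSL2R_bij: "A \<in> PSL2R \<Longrightarrow> bij A"
  by (metis PSL2R_inverse o_bij)

lemma PSL2R_cyc:
  assumes "A \<in> PSL2R"
  shows "rhat_cyc (A p) (A q) (A r) \<longleftrightarrow> rhat_cyc p q r"
proof -
  obtain a b c d where A: "A = mob a b c d" "a * d - b * c = 1" using assms by (rule PSL2R_cases)
  let ?m = "mobfac a b c d"
  have pos: "(?m p * ?m q * ?m r)\<^sup>2 > 0" using mobfac_nonzero[OF A(2)] by simp
  have "sdet (A p) (A q) * sdet (A q) (A r) * sdet (A r) (A p)
     = (?m p * ?m q * ?m r)\<^sup>2 * (sdet p q * sdet q r * sdet r p)"
    unfolding A(1) sdet_mob[OF A(2)] by (simp add: power2_eq_square)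
  then show ?thesis unfolding rhat_cyc_iff_sdet using pos by (simp add: zero_less_mult_iff)
qed

lemma cr_PSL2R:
  assumes "A \<in> PSL2R"
  shows "cr (A p) (A q) (A r) (A s) = cr p q r s"
proof -
  obtain a b c d where A: "A = mob a b c d" "a * d - b * c = 1" using assms by (rule PSL2R_cases)
  show ?thesis
    unfolding cr_def A(1) sdet_mob[OF A(2)] using mobfac_nonzero[OF A(2)]
    by (simp add: abs_mult divide_simps)
qed

lemma PSL2R_send_to_infinity:
  obtains A where "A \<in> PSL2R" "A p = None"
proof (cases p)
  case None
  then show ?thesis using that PSL2R_id by auto
next
  case (Some x)
  have "mob 0 (-1) 1 (-x) \<in> PSL2R" by (rule mob_in_PSL2R) simp
  then show ?thesis using that Some by force
qed

lemma PSL2R_affine: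
  assumes "\<alpha> > 0"
  obtains A where "A \<in> PSL2R" "A None = None" "\<And>x. A (Some x) = Some (\<alpha> * x + \<beta>)"
proof
  let ?r = "sqrt \<alpha>"
  have r: "?r > 0" "?r * ?r = \<alpha>" using assms by auto
  show "mob ?r (\<beta> / ?r) 0 (1 / ?r) \<in> PSL2R" by (rule mob_in_PSL2R) (use r in simp)
  show "mob ?r (\<beta> / ?r) 0 (1 / ?r) None = None" by simp
  fix x
  have "(?r * x + \<beta> / ?r) / (1 / ?r) = \<alpha> * x + \<beta>" using r
    by (simp add: field_simps)
  then show "mob ?r (\<beta> / ?r) 0 (1 / ?r) (Some x) = Some (\<alpha> * x + \<beta>)"
    using r by (simp add: moebius_def)
qed

lemma PSL2R_fixing_three_points:
  assumes "A \<in> PSL2R" "A (Some 0) = Some 0" "A (Some 1) = Some 1" "A None = None"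
  shows "A = id"
proof
  fix p
  obtain a b c d where A: "A = mob a b c d" "a * d - b * c = 1" using assms(1) by (rule PSL2R_cases)
  have c: "c = 0" using assms(4) A by (auto split: if_splits)
  then have d: "d \<noteq> 0" "a \<noteq> 0" using A by auto
  have b: "b = 0" using assms(2) A c d by (auto simp: moebius_def)
  have "a = d" using assms(3) A c d b by (auto simp: moebius_def)
  then show "A p = id p" using A b c d by (cases p) (auto simp: moebius_def)
qed

text \<open>
  Bijections of the circle that preserve the cyclic order. This is all that is used of an orientation
  preserving homeomorphism; continuity follows from it.
\<close>

definition cyc_bij :: "(rhat \<Rightarrow> rhat) \<Rightarrow> bool" where
  "cyc_bij k \<longleftrightarrow> bij k \<and> (\<forall>p q r. rhat_cyc p q r \<longrightarrow> rhat_cyc (k p) (k q) (k r))"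

lemma cyc_bij_PSL2R: "A \<in> PSL2R \<Longrightarrow> cyc_bij A"
  by (simp add: cyc_bij_def PSL2R_bij PSL2R_cyc)

lemma cyc_bij_comp: "cyc_bij k \<Longrightarrow> cyc_bij l \<Longrightarrow> cyc_bij (k \<circ> l)"
  by (auto simp: cyc_bij_def bij_comp)

lemma cyc_bij_inj: "cyc_bij k \<Longrightarrow> k p = k q \<longleftrightarrow> p = q"
  by (auto simp: cyc_bij_def bij_def dest: injD)

text \<open>
  The extension of a map of the real line that fixes infinity.
\<close>

definition lift :: "(real \<Rightarrow> real) \<Rightarrow> rhat \<Rightarrow> rhat" where
  "lift H = map_option H"

lemma lift_simps [simp]: "lift H None = None" "lift H (Some x) = Some (H x)"
  by (simp_all add: lift_def)

lemma cyc_bij_fixing_infinity: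
  assumes "cyc_bij k" "k None = None"
  obtains H where "k = lift H" "strict_mono H" "surj H"
proof -
  have ne: "k (Some x) \<noteq> None" for x using cyc_bij_inj[OF assms(1), of "Some x" None] assms(2) by simp
  define H where "H x = the (k (Some x))" for x
  have kH: "k (Some x) = Some (H x)" for x using ne[of x] by (simp add: H_def)
  have k: "k = lift H"
  proof
    show "k p = lift H p" for p by (cases p) (simp_all add: assms kH)
  qed
  have "H x < H y" if "x < y" for x y
  proof -
    have "rhat_cyc (Some x) (Some y) None" using that by (simp add: rhat_cyc_def rhat_less_def)
    then have "rhat_cyc (Some (H x)) (Some (H y)) None"
      using assms kH unfolding cyc_bij_def by metis
    then show ?thesis by (simp add: rhat_cyc_def rhat_less_def)
  qed
  moreover have "surj H"
    unfolding surj_def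
  proof
    fix y
    obtain p where p: "k p = Some y" using assms(1) unfolding cyc_bij_def by (metis bij_pointE)
    then obtain x where "p = Some x" using assms(2) by (cases p) auto
    then show "\<exists>x. y = H x" using p kH by auto
  qed
  ultimately show ?thesis using that k by (auto simp: strict_mono_def)
qed

lemma cyc_bij_lift:
  assumes "strict_mono H" "surj H"
  shows "cyc_bij (lift H)"
proof -
  have inj: "inj H" using assms by (simp add: strict_mono_imp_inj_on)
  have "bij (lift H)"
  proof (rule bijI)
    show "inj (lift H)" unfolding lift_def by (rule option.inj_map[OF inj])
    show "surj (lift H)"
      unfolding surj_def
    proof
      fix p show "\<exists>q. p = lift H q"
      proof (cases p)
        case None then show ?thesis by (metis lift_simps(1))
      next
        case (Some y)
        then obtain x where "H x = y" using assms(2) by (metis surjD)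
        then show ?thesis using Some by (metis lift_simps(2))
      qed
    qed
  qed
  moreover have "rhat_less (lift H p) (lift H q)" if "rhat_less p q" for p q
    using that assms(1) by (cases p; cases q) (auto simp: rhat_less_def strict_mono_def)
  ultimately show ?thesis unfolding cyc_bij_def rhat_cyc_def by metis
qed

section \<open>Quasisymmetric maps and visual separation\<close>

text \<open>
  \<open>M\<close>-quasisymmetric maps of the real line. Both inequalities of the definition are covered because \<open>t\<close>
  may be negative.
\<close>

definition line_qs :: "real \<Rightarrow> (real \<Rightarrow> real) \<Rightarrow> bool" where
  "line_qs M H \<longleftrightarrow> M \<ge> 1 \<and> strict_mono H \<and>
     (\<forall>x t. \<bar>H (x + t) - H x\<bar> \<le> M * \<bar>H (x - t) - H x\<bar>)"

lemma line_qsI: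
  assumes M: "M \<ge> 1" and mono: "strict_mono H"
    and b: "\<And>x t. t > 0 \<Longrightarrow> H (x + t) - H x \<le> M * (H x - H (x - t)) \<and> H x - H (x - t) \<le> M * (H (x + t) - H x)"
  shows "line_qs M H"
proof -
  have "\<bar>H (x + t) - H x\<bar> \<le> M * \<bar>H (x - t) - H x\<bar>" for x t
  proof -
    consider "t > 0" | "t = 0" | "t < 0" by linarith
    then show ?thesis
    proof cases
      case 1
      then have "H x < H (x + t)" "H (x - t) < H x" using mono by (auto simp: strict_mono_less)
      then show ?thesis using b[OF 1, of x] by simp
    next
      case 3
      then have "H (x + t) < H x" "H x < H (x - t)" using mono by (auto simp: strict_mono_less)
      then show ?thesis using b[of "- t" x] 3 by simp
    qed simp
  qed
  then show ?thesis using M mono by (simp add: line_qs_def)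
qed

lemma line_qsD:
  assumes "line_qs M H" "t > 0"
  shows "H (x + t) - H x \<le> M * (H x - H (x - t))" "H x - H (x - t) \<le> M * (H (x + t) - H x)"
    "H x < H (x + t)" "H (x - t) < H x"
proof -
  show inc: "H x < H (x + t)" "H (x - t) < H x" using assms by (auto simp: line_qs_def strict_mono_less)
  have "\<bar>H (x + t) - H x\<bar> \<le> M * \<bar>H (x - t) - H x\<bar>" "\<bar>H (x + - t) - H x\<bar> \<le> M * \<bar>H (x - - t) - H x\<bar>"
    using assms(1) unfolding line_qs_def by blast+
  then show "H (x + t) - H x \<le> M * (H x - H (x - t))" "H x - H (x - t) \<le> M * (H (x + t) - H x)"
    using inc by auto
qed

lemma line_qs_id: "line_qs 1 (\<lambda>x. x)"
  by (simp add: line_qs_def strict_mono_def)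

lemma strict_mono_abs_le:
  fixes H :: "real \<Rightarrow> real"
  assumes "strict_mono H" "\<bar>u\<bar> \<le> \<bar>v\<bar>" "u * v \<ge> 0"
  shows "\<bar>H (x + u) - H x\<bar> \<le> \<bar>H (x + v) - H x\<bar>"
proof -
  have mono: "H a \<le> H b" if "a \<le> b" for a b using assms(1) that by (simp add: strict_mono_less_eq)
  consider "0 \<le> u" "u \<le> v" | "v \<le> u" "u \<le> 0" using assms(2,3) 
    by (cases "u \<ge> 0"; cases "v \<ge> 0") (auto simp: zero_le_mult_iff)
  then show ?thesis
  proof cases
    case 1
    then show ?thesis using mono[of x "x + u"] mono[of "x + u" "x + v"] by simp
  next
    case 2
    then show ?thesis using mono[of "x + u" x] mono[of "x + v" "x + u"] by simp
  qed
qed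

lemma strict_mono_abs_split:
  fixes H :: "real \<Rightarrow> real"
  assumes "strict_mono H"
  shows "\<bar>H (x + v) - H x\<bar> = \<bar>H (x + v) - H (x + v / 2)\<bar> + \<bar>H (x + v / 2) - H x\<bar>"
proof -
  have mono: "H a \<le> H b" if "a \<le> b" for a b using assms(1) that by (simp add: strict_mono_less_eq)
  show ?thesis
  proof (cases "v \<ge> 0")
    case True
    then show ?thesis using mono[of x "x + v / 2"] mono[of "x + v / 2" "x + v"] by simp
  next
    case False
    then show ?thesis using mono[of "x + v / 2" x] mono[of "x + v" "x + v / 2"] by simp
  qed
qed

lemma line_qs_halving:
  assumes "line_qs M H"
  shows "\<bar>H (x + v / 2) - H x\<bar> \<le> M / (M + 1) * \<bar>H (x + v) - H x\<bar>"
    and "\<bar>H (x + v) - H x\<bar> \<le> (M + 1) * \<bar>H (x + v / 2) - H x\<bar>"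
proof -
  have M: "M \<ge> 1" and mono: "strict_mono H" using assms by (auto simp: line_qs_def)
  let ?a = "\<bar>H (x + v) - H (x + v / 2)\<bar>" and ?b = "\<bar>H (x + v / 2) - H x\<bar>"
  have "\<bar>H ((x + v / 2) + (- (v / 2))) - H (x + v / 2)\<bar>
      \<le> M * \<bar>H ((x + v / 2) - (- (v / 2))) - H (x + v / 2)\<bar>"
    using assms unfolding line_qs_def by blast
  then have 1: "?b \<le> M * ?a" by (simp add: abs_minus_commute add.assoc)
  have "\<bar>H ((x + v / 2) + v / 2) - H (x + v / 2)\<bar>
      \<le> M * \<bar>H ((x + v / 2) - v / 2) - H (x + v / 2)\<bar>"
    using assms unfolding line_qs_def by blast
  then have 2: "?a \<le> M * ?b" by (simp add: abs_minus_commute add.assoc)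
  have s: "\<bar>H (x + v) - H x\<bar> = ?a + ?b" by (rule strict_mono_abs_split[OF mono])
  have "(M + 1) * ?b \<le> M * (?a + ?b)" using 1 by (simp add: algebra_simps)
  then show "?b \<le> M / (M + 1) * \<bar>H (x + v) - H x\<bar>" unfolding s using M
    by (simp add: field_simps)
  show "\<bar>H (x + v) - H x\<bar> \<le> (M + 1) * ?b" unfolding s using 2 by (simp add: algebra_simps)
qed

text \<open>
  Quasisymmetric maps are uniformly continuous in a scale invariant sense.
\<close>

lemma line_qs_small:
  assumes "M \<ge> 1" "e > 0"
  obtains c where "0 < c" "c \<le> 1"
    "\<And>H x u v. line_qs M H \<Longrightarrow> \<bar>u\<bar> \<le> c * \<bar>v\<bar> \<Longrightarrow> \<bar>H (x + u) - H x\<bar> \<le> e * \<bar>H (x + v) - H x\<bar>"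
proof -
  \<comment> \<open>Halving an interval shrinks its image at least by the factor \<open>\<theta>\<close>.\<close>
  define \<theta> where "\<theta> = M / (M + 1)"
  have \<theta>: "0 \<le> \<theta>" "\<theta> < 1" using assms(1) by (auto simp: \<theta>_def field_simps)
  have "e / M > 0" using assms by simp
  then obtain k where k: "\<theta> ^ k < e / M" using real_arch_pow_inv \<theta>(2) by blast
  then have kM: "M * \<theta> ^ k \<le> e" using assms by (simp add: field_simps)
  show ?thesis
  proof (rule that[of "1 / 2 ^ k"])
    fix H :: "real \<Rightarrow> real" and x u v :: real
    assume H: "line_qs M H" and u: "\<bar>u\<bar> \<le> 1 / 2 ^ k * \<bar>v\<bar>"
    have mono: "strict_mono H" using H by (simp add: line_qs_def)
    have iter: "\<bar>H (x + w / 2 ^ j) - H x\<bar> \<le> \<theta> ^ j * \<bar>H (x + w) - H x\<bar>" for j w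
    proof (induction j)
      case (Suc j)
      have "\<bar>H (x + (w / 2 ^ j) / 2) - H x\<bar> \<le> \<theta> * \<bar>H (x + w / 2 ^ j) - H x\<bar>"
        unfolding \<theta>_def by (rule line_qs_halving(1)[OF H])
      also have "\<dots> \<le> \<theta> * (\<theta> ^ j * \<bar>H (x + w) - H x\<bar>)" using Suc \<theta> by (intro mult_left_mono)
      finally show ?case by (simp add: field_simps)
    qed simp
    have "\<bar>H (x + u) - H x\<bar> \<le> M * \<bar>H (x + v / 2 ^ k) - H x\<bar>"
    proof (cases "u * v \<ge> 0")
      case True
      then have "\<bar>H (x + u) - H x\<bar> \<le> \<bar>H (x + v / 2 ^ k) - H x\<bar>"
        using u by (intro strict_mono_abs_le[OF mono]) (auto simp: field_simps)
      also have "\<dots> \<le> M * \<dots>" using assms(1) by (simp add: mult_left_mono[of 1, simplified] mult_le_cancel_right1)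
      finally show ?thesis .
    next
      case False
      then have "\<bar>H (x + u) - H x\<bar> \<le> \<bar>H (x + - (v / 2 ^ k)) - H x\<bar>"
        using u by (intro strict_mono_abs_le[OF mono]) (auto simp: field_simps)
      also have "\<dots> \<le> M * \<bar>H (x - - (v / 2 ^ k)) - H x\<bar>" using H unfolding line_qs_def by blast
      finally show ?thesis by simp
    qed
    also have "\<dots> \<le> M * (\<theta> ^ k * \<bar>H (x + v) - H x\<bar>)"
      using iter[of v k] assms(1) by (intro mult_left_mono) auto
    also have "\<dots> \<le> e * \<bar>H (x + v) - H x\<bar>"
      using kM mult_right_mono[OF kM, of "\<bar>H (x + v) - H x\<bar>"] by (simp add: mult.assoc)
    finally show "\<bar>H (x + u) - H x\<bar> \<le> e * \<bar>H (x + v) - H x\<bar>" .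
  qed auto
qed

text \<open>
  Conversely, the image of an interval grows by a bounded factor when the interval is
  enlarged by a bounded factor.
\<close>

lemma line_qs_growth:
  assumes "M \<ge> 1"
  obtains C where "C \<ge> 1"
    "\<And>H x u v. line_qs M H \<Longrightarrow> \<bar>u\<bar> \<le> K * \<bar>v\<bar> \<Longrightarrow> \<bar>H (x + u) - H x\<bar> \<le> C * \<bar>H (x + v) - H x\<bar>"
proof -
  obtain k where k: "K < 2 ^ k" using real_arch_pow[of 2 K] by auto
  show ?thesis
  proof (rule that[of "M * (M + 1) ^ k"])
    have "1 \<le> (M + 1) ^ k" using assms by (intro one_le_power) simp
    then show "1 \<le> M * (M + 1) ^ k" using assms mult_mono[of 1 M 1 "(M + 1) ^ k"] by simp
    fix H :: "real \<Rightarrow> real" and x u v :: real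
    assume H: "line_qs M H" and u: "\<bar>u\<bar> \<le> K * \<bar>v\<bar>"
    have mono: "strict_mono H" using H by (simp add: line_qs_def)
    have u': "\<bar>u\<bar> \<le> 2 ^ k * \<bar>v\<bar>" using u k mult_right_mono[of K "2 ^ k" "\<bar>v\<bar>"] by simp
    have iter: "\<bar>H (x + 2 ^ j * w) - H x\<bar> \<le> (M + 1) ^ j * \<bar>H (x + w) - H x\<bar>" for j w
    proof (induction j)
      case (Suc j)
      have "\<bar>H (x + 2 ^ Suc j * w) - H x\<bar> \<le> (M + 1) * \<bar>H (x + (2 ^ Suc j * w) / 2) - H x\<bar>"
        by (rule line_qs_halving(2)[OF H])
      also have "(2 ^ Suc j * w) / 2 = 2 ^ j * w" by simp
      also have "(M + 1) * \<bar>H (x + 2 ^ j * w) - H x\<bar> \<le> (M + 1) * ((M + 1) ^ j * \<bar>H (x + w) - H x\<bar>)"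
        using Suc assms by (intro mult_left_mono) auto
      finally show ?case by (simp add: mult.assoc)
    qed simp
    have "\<bar>H (x + u) - H x\<bar> \<le> M * \<bar>H (x + 2 ^ k * v) - H x\<bar>"
    proof (cases "u * v \<ge> 0")
      case True
      then have "\<bar>H (x + u) - H x\<bar> \<le> \<bar>H (x + 2 ^ k * v) - H x\<bar>"
        using u' by (intro strict_mono_abs_le[OF mono]) (auto simp: abs_mult zero_le_mult_iff)
      also have "\<dots> \<le> M * \<dots>" using assms(1) by (simp add: mult_le_cancel_right1)
      finally show ?thesis .
    next
      case False
      then have "\<bar>H (x + u) - H x\<bar> \<le> \<bar>H (x + - (2 ^ k * v)) - H x\<bar>"
        using u' by (intro strict_mono_abs_le[OF mono]) (auto simp: abs_mult zero_le_mult_iff mult_le_0_iff)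
      also have "\<dots> \<le> M * \<bar>H (x - - (2 ^ k * v)) - H x\<bar>" using H unfolding line_qs_def by blast
      finally show ?thesis by simp
    qed
    also have "\<dots> \<le> M * ((M + 1) ^ k * \<bar>H (x + v) - H x\<bar>)"
      using iter[of k v] assms(1) by (intro mult_left_mono) auto
    finally show "\<bar>H (x + u) - H x\<bar> \<le> M * (M + 1) ^ k * \<bar>H (x + v) - H x\<bar>" by (simp add: mult.assoc)
  qed
qed

text \<open>
  For \<open>z\<close> in the upper half-plane, the square of \<open>hdist z x\<close> divided by \<open>Im z\<close> is the reciprocal of the
  Poisson kernel at \<open>z\<close> and \<open>x\<close>, up to a constant. It makes the separation of boundary points, as
  seen from \<open>z\<close>, a Moebius invariant notion.
\<close>

fun hdist :: "complex \<Rightarrow> rhat \<Rightarrow> real" where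
  "hdist z None = 1"
| "hdist z (Some x) = cmod (of_real x - z)"

text \<open>
  The points \<open>p, q\<close> are at distance at least \<open>\<sigma>\<close> in the visual (chordal) metric of the circle seen from \<open>z\<close>.
\<close>

definition sep :: "real \<Rightarrow> complex \<Rightarrow> rhat \<Rightarrow> rhat \<Rightarrow> bool" where
  "sep \<sigma> z p q \<longleftrightarrow> \<sigma> * (hdist z p * hdist z q) \<le> \<bar>sdet p q\<bar> * Im z"

lemma sep_commute: "sep \<sigma> z p q \<longleftrightarrow> sep \<sigma> z q p"
  using sdet_swap[of p q] by (simp add: sep_def mult.commute)

text \<open>
  Action of a real Moebius map on the upper half-plane.
\<close>

abbreviation hmob :: "real \<Rightarrow> real \<Rightarrow> real \<Rightarrow> real \<Rightarrow> complex \<Rightarrow> complex" where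
  "hmob a b c d \<equiv> moebius (of_real a) (of_real b) (of_real c) (of_real d)"

lemma Im_moebius_complex:
  fixes z :: complex
  assumes det: "a * d - b * c = 1" and z: "Im z > 0"
  shows "Im (hmob a b c d z)
    = Im z / (cmod (of_real c * z + of_real d))\<^sup>2"
    and "of_real c * z + of_real d \<noteq> 0"
proof -
  show nz: "of_real c * z + of_real d \<noteq> 0"
  proof
    assume e: "of_real c * z + of_real d = 0"
    then have "Im (of_real c * z + of_real d) = 0" by simp
    then have "c = 0" using z by simp
    then show False using e det by simp
  qed
  have "Im ((of_real a * z + of_real b) * cnj (of_real c * z + of_real d)) = (a * d - b * c) * Im z"
    by (simp add: algebra_simps)
  then show "Im (hmob a b c d z)
    = Im z / (cmod (of_real c * z + of_real d))\<^sup>2"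
    using det unfolding moebius_def by (simp add: complex_div_cnj[of _ "of_real c * z + of_real d"] Im_divide_of_real
        del: of_real_power flip: of_real_power)
qed

lemma hdist_mob:
  fixes z :: complex
  assumes det: "a * d - b * c = 1" and z: "Im z > 0"
  shows "hdist (hmob a b c d z) (mob a b c d p)
    = hdist z p * \<bar>mobfac a b c d p\<bar> / cmod (of_real c * z + of_real d)"
proof -
  let ?D = "of_real c * z + of_real d" and ?N = "of_real a * z + of_real b"
  have nz: "?D \<noteq> 0" by (rule Im_moebius_complex(2)[OF det z])
  have det': "complex_of_real a * of_real d - of_real b * of_real c = 1"
    using det by (metis of_real_1 of_real_diff of_real_mult)
  show ?thesis
  proof (cases p)
    case None
    show ?thesis
    proof (cases "c = 0")
      case True
      then have "a * d = 1" using det by simp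
      then have "\<bar>a\<bar> * \<bar>d\<bar> = 1" "a \<noteq> 0" "d \<noteq> 0" by (auto simp flip: abs_mult)
      then show ?thesis using None True by simp
    next
      case False
      have "of_real (a / c) - ?N / ?D = (of_real a * ?D - of_real c * ?N) / (of_real c * ?D)"
        using nz False by (simp add: field_simps)
      also have "of_real a * ?D - of_real c * ?N = 1" using det' by (simp add: algebra_simps)
      finally show ?thesis using None False by (simp add: moebius_def norm_divide norm_mult)
    qed
  next
    case (Some x)
    show ?thesis
    proof (cases "c * x + d = 0")
      case True
      have "(a * x + b) * c = -1" using det True by algebra
      then have e: "a * x + b \<noteq> 0" "c \<noteq> 0" by auto
      with \<open>(a * x + b) * c = -1\<close> have e: "a * x + b \<noteq> 0" "c \<noteq> 0" "1 / (a * x + b) = - c"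
        by (auto simp: divide_eq_eq mult.commute)
      have "?D = of_real c * (z - of_real x)"
        using arg_cong[OF True, of complex_of_real] by (simp add: algebra_simps add_eq_0_iff)
      then have D: "cmod ?D = \<bar>c\<bar> * cmod (of_real x - z)" by (simp add: norm_mult norm_minus_commute)
      then have "cmod (of_real x - z) \<noteq> 0" using nz e(2) by auto
      have m: "\<bar>mobfac a b c d (Some x)\<bar> = \<bar>c\<bar>" using True e(3) by simp
      show ?thesis using Some True e(2) \<open>cmod (of_real x - z) \<noteq> 0\<close> unfolding Some m D by simp
    next
      case False
      let ?d = "of_real (c * x + d)" and ?n = "of_real (a * x + b) :: complex"
      have nz': "(?d :: complex) \<noteq> 0" using False by (metis of_real_eq_0_iff)
      have "of_real ((a * x + b) / (c * x + d)) - ?N / ?D = ?n / ?d - ?N / ?D" by simp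
      also have "\<dots> = (?n * ?D - ?N * ?d) / (?d * ?D)"
        by (rule diff_frac_eq[OF nz' nz])
      also have "?n * ?D - ?N * ?d = (complex_of_real a * of_real d - of_real b * of_real c) * (of_real x - z)"
        by (simp add: algebra_simps)
      also have "\<dots> = of_real x - z" using det' by simp
      finally have "cmod (of_real ((a * x + b) / (c * x + d)) - ?N / ?D)
        = cmod (of_real x - z) / (\<bar>c * x + d\<bar> * cmod ?D)"
        by (simp only: norm_divide norm_mult norm_of_real)
      then show ?thesis using Some False by (simp add: moebius_def field_simps)
    qed
  qed
qed

text \<open>
  Separation is preserved when the points and the base point are moved by the same element of PSL(2,R).
\<close>

lemma sep_mob:
  assumes det: "a * d - b * c = 1" and z: "Im z > 0"
  shows "sep \<sigma> (hmob a b c d z) (mob a b c d p) (mob a b c d q)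
    \<longleftrightarrow> sep \<sigma> z p q"
proof -
  let ?D = "cmod (of_real c * z + of_real d)"
  define K where "K = \<bar>mobfac a b c d p\<bar> * \<bar>mobfac a b c d q\<bar> / ?D\<^sup>2"
  have K: "K > 0" using mobfac_nonzero[OF det] Im_moebius_complex(2)[OF det z] by (simp add: K_def)
  have "\<sigma> * (hdist (hmob a b c d z) (mob a b c d p)
    * hdist (hmob a b c d z) (mob a b c d q))
    = K * (\<sigma> * (hdist z p * hdist z q))"
    unfolding hdist_mob[OF det z] K_def by (simp add: power2_eq_square)
  moreover have "\<bar>sdet (mob a b c d p) (mob a b c d q)\<bar> *
     Im (hmob a b c d z) = K * (\<bar>sdet p q\<bar> * Im z)"
    unfolding sdet_mob[OF det] Im_moebius_complex(1)[OF det z] K_def by (simp add: abs_mult)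
  ultimately show ?thesis unfolding sep_def using K by (simp only: mult_le_cancel_left_pos)
qed

text \<open>
  Seen from \<open>z\<close>, only one of several separated points can lie far away from \<open>Re z\<close> on the scale \<open>Im z\<close>.
\<close>

lemma sep_finite:
  assumes "sep \<sigma> z (Some x) (Some y)" "Im z > 0" "\<sigma> > 0"
  shows "\<bar>x - y\<bar> \<ge> \<sigma> * Im z" "\<bar>x - Re z\<bar> \<le> 2 / \<sigma> * Im z \<or> \<bar>y - Re z\<bar> \<le> 2 / \<sigma> * Im z"
proof -
  have I: "cmod (of_real x - z) \<ge> Im z" for x
    using abs_Im_le_cmod[of "of_real x - z"] assms(2) by simp
  have R: "cmod (of_real x - z) \<ge> \<bar>x - Re z\<bar>" for x
    using abs_Re_le_cmod[of "of_real x - z"] by simp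
  have s: "\<sigma> * (cmod (of_real x - z) * cmod (of_real y - z)) \<le> \<bar>x - y\<bar> * Im z"
    using assms(1) by (simp add: sep_def)
  have "\<sigma> * (Im z * Im z) \<le> \<sigma> * (cmod (of_real x - z) * cmod (of_real y - z))"
    using I[of x] I[of y] assms by (intro mult_left_mono mult_mono) auto
  also have "\<dots> \<le> \<bar>x - y\<bar> * Im z" by (rule s)
  finally have "(\<sigma> * Im z) * Im z \<le> \<bar>x - y\<bar> * Im z" by (simp only: mult.assoc)
  then show "\<bar>x - y\<bar> \<ge> \<sigma> * Im z" using assms(2) by (rule mult_right_le_imp_le)
  show "\<bar>x - Re z\<bar> \<le> 2 / \<sigma> * Im z \<or> \<bar>y - Re z\<bar> \<le> 2 / \<sigma> * Im z"
  proof (rule ccontr)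
    let ?a = "\<bar>x - Re z\<bar>" and ?b = "\<bar>y - Re z\<bar>"
    assume "\<not> ?thesis"
    then have ab: "?a * \<sigma> > 2 * Im z" "?b * \<sigma> > 2 * Im z" using assms(3) by (auto simp: field_simps)
    have pos: "?a > 0" "?b > 0" using ab assms by (auto simp: zero_less_mult_iff intro!: ccontr[of "_ < (_::real)"])
    have "\<sigma> * (?a * ?b) \<le> \<sigma> * (cmod (of_real x - z) * cmod (of_real y - z))"
      using R[of x] R[of y] assms by (intro mult_left_mono mult_mono) auto
    also have "\<dots> \<le> \<bar>x - y\<bar> * Im z" by (rule s)
    also have "\<dots> \<le> (?a + ?b) * Im z" using assms(2) by (intro mult_right_mono) auto
    finally have 1: "\<sigma> * (?a * ?b) \<le> (?a + ?b) * Im z" .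
    have "2 * Im z * ?b < ?a * \<sigma> * ?b" "2 * Im z * ?a < ?b * \<sigma> * ?a"
      using ab pos by (auto intro!: mult_strict_right_mono)
    then show False using 1 by (simp add: algebra_simps)
  qed
qed

lemma sep_infinity:
  assumes "sep \<sigma> z (Some x) None" "Im z > 0" "\<sigma> > 0"
  shows "\<bar>x - Re z\<bar> \<le> 2 / \<sigma> * Im z"
proof -
  have "cmod (of_real x - z) \<ge> \<bar>x - Re z\<bar>"
    using abs_Re_le_cmod[of "of_real x - z"] by simp
  then have "\<sigma> * \<bar>x - Re z\<bar> \<le> \<sigma> * cmod (of_real x - z)" using assms(3) by simp
  also have "\<dots> \<le> Im z" using assms(1) by (simp add: sep_def)
  finally have "\<sigma> * \<bar>x - Re z\<bar> \<le> 2 * Im z" using assms(2) by simp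
  then show ?thesis using assms(3) by (simp add: field_simps)
qed

section \<open>Comparing two maps on separated points\<close>

text \<open>
  The quotient \<open>u / v\<close> equals \<open>\<rho>\<close> up to a factor \<open>\<kappa>\<close>; written without division so that it is additive in
  \<open>u\<close> and \<open>v\<close>.
\<close>

definition near_ratio :: "real \<Rightarrow> real \<Rightarrow> real \<Rightarrow> real \<Rightarrow> bool" where
  "near_ratio \<kappa> \<rho> u v \<longleftrightarrow> u \<le> \<kappa> * \<rho> * v \<and> \<rho> * v \<le> \<kappa> * u"

lemma near_ratio_add:
  "near_ratio \<kappa> \<rho> u v \<Longrightarrow> near_ratio \<kappa> \<rho> u' v' \<Longrightarrow> near_ratio \<kappa> \<rho> (u + u') (v + v')"
  by (simp add: near_ratio_def algebra_simps)

lemma near_ratio_mono: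
  assumes "near_ratio \<kappa> \<rho> u v" "\<kappa> \<le> \<kappa>'" "\<rho> \<ge> 0" "u \<ge> 0" "v \<ge> 0"
  shows "near_ratio \<kappa>' \<rho> u v"
proof -
  have "\<kappa> * (\<rho> * v) \<le> \<kappa>' * (\<rho> * v)" "\<kappa> * u \<le> \<kappa>' * u"
    using assms by (auto intro!: mult_right_mono)
  then show ?thesis using assms(1) by (auto simp: near_ratio_def mult.assoc intro: order_trans)
qed

text \<open>
  After multiplication by a weight \<open>\<mu> p\<close> at each point, the distances (\<open>sdet\<close>) of the images of the points
  of \<open>P\<close> under \<open>k\<close> and \<open>l\<close> agree up to the factor \<open>\<kappa>\<close>. The weights cancel in cross-ratios, and they can be
  changed by post-composing \<open>k\<close> or \<open>l\<close> with Moebius maps.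
\<close>

definition coherent :: "real \<Rightarrow> (rhat \<Rightarrow> rhat) \<Rightarrow> (rhat \<Rightarrow> rhat) \<Rightarrow> (rhat \<Rightarrow> real) \<Rightarrow> rhat set \<Rightarrow> bool" where
  "coherent \<kappa> k l \<mu> P \<longleftrightarrow> (\<forall>p. \<mu> p > 0) \<and>
     (\<forall>p\<in>P. \<forall>q\<in>P. p \<noteq> q \<longrightarrow>
        near_ratio \<kappa> (\<mu> p * \<mu> q) \<bar>sdet (k p) (k q)\<bar> \<bar>sdet (l p) (l q)\<bar>)"

text \<open>
  The cross-ratios of the images of \<open>(a, b, c, d)\<close> under \<open>k\<close> and under \<open>l\<close> agree up to the factor \<open>\<kappa>\<close>.
\<close>

definition good :: "real \<Rightarrow> (rhat \<Rightarrow> rhat) \<Rightarrow> (rhat \<Rightarrow> rhat) \<Rightarrow> rhat \<Rightarrow> rhat \<Rightarrow> rhat \<Rightarrow> rhat \<Rightarrow> bool" where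
  "good \<kappa> k l a b c d \<longleftrightarrow>
     cr (k a) (k b) (k c) (k d) \<le> \<kappa> * cr (l a) (l b) (l c) (l d) \<and>
     cr (l a) (l b) (l c) (l d) \<le> \<kappa> * cr (k a) (k b) (k c) (k d)"

lemma good_mono:
  assumes "good \<kappa> k l a b c d" "\<kappa> \<le> \<kappa>'"
  shows "good \<kappa>' k l a b c d"
proof -
  have "0 \<le> cr p q r s" for p q r s by (simp add: cr_def)
  then have "\<kappa> * cr p q r s \<le> \<kappa>' * cr p q r s" for p q r s using assms(2) by (intro mult_right_mono) auto
  then show ?thesis using assms(1) unfolding good_def by (meson order_trans)
qed

lemma four_ratio_bound:
  fixes x1 x2 x3 x4 y1 y2 y3 y4 \<kappa> :: real
  assumes "x1 \<le> \<kappa> * y1" "x2 \<le> \<kappa> * y2" "y3 \<le> \<kappa> * x3" "y4 \<le> \<kappa> * x4"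
    and "x1 > 0" "x2 > 0" "x3 > 0" "x4 > 0" "y1 > 0" "y2 > 0" "y3 > 0" "y4 > 0" "\<kappa> > 0"
  shows "x1 * x2 / (x3 * x4) \<le> \<kappa> ^ 4 * (y1 * y2 / (y3 * y4))"
proof -
  have "x1 * x2 * (y3 * y4) \<le> (\<kappa> * y1) * (\<kappa> * y2) * ((\<kappa> * x3) * (\<kappa> * x4))"
    using assms by (intro mult_mono) auto
  also have "\<dots> = \<kappa> ^ 4 * (y1 * y2) * (x3 * x4)" by (simp add: power4_eq_xxxx mult_ac)
  finally show ?thesis using assms by (simp add: field_simps)
qed

lemma coherent_imp_good:
  assumes g: "coherent \<kappa> k l \<mu> P" and \<kappa>: "\<kappa> > 0" and inj: "inj k" "inj l"
    and P: "a \<in> P" "b \<in> P" "c \<in> P" "d \<in> P"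
    and ne: "a \<noteq> b" "c \<noteq> d" "b \<noteq> c" "d \<noteq> a"
  shows "good (\<kappa> ^ 4) k l a b c d"
proof -
  let ?k = "\<lambda>p q. \<bar>sdet (k p) (k q)\<bar>" and ?l = "\<lambda>p q. \<mu> p * \<mu> q * \<bar>sdet (l p) (l q)\<bar>"
  have \<mu>: "\<mu> p > 0" for p using g by (simp add: coherent_def)
  have n: "?k p q \<le> \<kappa> * ?l p q" "?l p q \<le> \<kappa> * ?k p q" if "p \<in> P" "q \<in> P" "p \<noteq> q" for p q
    using g that unfolding coherent_def near_ratio_def by (auto simp: mult.assoc)
  have pos: "?k p q > 0" "?l p q > 0" if "p \<noteq> q" for p q
  proof -
    have "k p \<noteq> k q" "l p \<noteq> l q" using that inj by (auto dest: injD)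
    then show "?k p q > 0" "?l p q > 0" using \<mu>[of p] \<mu>[of q] by simp_all
  qed
  have \<mu>nz: "\<mu> p \<noteq> 0" for p using \<mu>[of p] by simp
  have K: "cr (k a) (k b) (k c) (k d) = ?k a b * ?k c d / (?k b c * ?k d a)"
    by (simp add: cr_def abs_mult)
  have L: "cr (l a) (l b) (l c) (l d) = ?l a b * ?l c d / (?l b c * ?l d a)"
    using \<mu>nz[of a] \<mu>nz[of b] \<mu>nz[of c] \<mu>nz[of d] by (simp add: cr_def abs_mult)
  show ?thesis unfolding good_def K L
    by (intro conjI four_ratio_bound n pos P ne \<kappa>)
qed

text \<open>
  For separated points it suffices to compare \<open>H\<close> and \<open>L\<close> on pairs of points within the
  distance \<open>R * Im z\<close> of \<open>Re z\<close>, and to compare their distances from one single point that is farther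
  away; that point may be infinity.
\<close>

lemma coherent_of_near_far:
  fixes H L :: "real \<Rightarrow> real"
  assumes sep: "\<And>p q. p \<in> P \<Longrightarrow> q \<in> P \<Longrightarrow> p \<noteq> q \<Longrightarrow> sep \<sigma> z p q"
    and z: "Im z > 0" and \<sigma>: "\<sigma> > 0" and \<kappa>: "\<kappa> \<ge> 1" and \<rho>: "\<rho> > 0" and R: "R \<ge> 2 / \<sigma>"
    and near: "\<And>x y. \<bar>x - Re z\<bar> \<le> R * Im z \<Longrightarrow> \<bar>y - Re z\<bar> \<le> R * Im z \<Longrightarrow> \<sigma> * Im z \<le> y - x \<Longrightarrow>
        near_ratio \<kappa> \<rho> (H y - H x) (L y - L x)"
    and far: "\<And>d. \<bar>d - Re z\<bar> > R * Im z \<Longrightarrow> \<exists>\<mu>>0. \<forall>x. \<bar>x - Re z\<bar> \<le> 2 / \<sigma> * Im z \<longrightarrow>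
        near_ratio \<kappa> \<mu> \<bar>H d - H x\<bar> \<bar>L d - L x\<bar>"
    and mono: "strict_mono H" "strict_mono L"
  shows "\<exists>\<mu>. coherent \<kappa> (lift H) (lift L) \<mu> P"
proof -
  let ?near = "\<lambda>r p. \<exists>x. p = Some x \<and> \<bar>x - Re z\<bar> \<le> r * Im z"
  let ?nr = "\<lambda>m p q. near_ratio \<kappa> m \<bar>sdet (lift H p) (lift H q)\<bar> \<bar>sdet (lift L p) (lift L q)\<bar>"
  have sym: "?nr m p q \<longleftrightarrow> ?nr m q p" for m p q
    using sdet_swap[of "lift H p" "lift H q"] sdet_swap[of "lift L p" "lift L q"] by simp
  have NN: "?nr \<rho> (Some x) (Some y)"
    if "Some x \<in> P" "Some y \<in> P" "x \<noteq> y" "\<bar>x - Re z\<bar> \<le> R * Im z" "\<bar>y - Re z\<bar> \<le> R * Im z" for x y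
  proof -
    have main: "?nr \<rho> (Some x) (Some y)" 
      if "Some x \<in> P" "Some y \<in> P" "x < y" "\<bar>x - Re z\<bar> \<le> R * Im z" "\<bar>y - Re z\<bar> \<le> R * Im z" for x y
    proof -
      have "\<sigma> * Im z \<le> y - x" using sep_finite(1)[OF sep z \<sigma>, of x y] that by auto
      moreover have "H x < H y" "L x < L y" using that mono by (auto simp: strict_mono_def)
      ultimately show ?thesis using near[of x y] that by simp
    qed
    show ?thesis
    proof (cases "x < y")
      case False
      then have "?nr \<rho> (Some y) (Some x)" using main[of y x] that by linarith
      then show ?thesis using sym by blast
    qed (use main that in auto)
  qed
  show ?thesis
  proof (cases "\<forall>p\<in>P. ?near R p")
    case True
    \<comment> \<open>No far point: the constant weight \<open>sqrt \<rho>\<close> makes every product of two weights equal to \<open>\<rho>\<close>.\<close>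
    have "coherent \<kappa> (lift H) (lift L) (\<lambda>_. sqrt \<rho>) P"
      unfolding coherent_def
    proof (intro conjI allI ballI impI)
      fix p q assume pq: "p \<in> P" "q \<in> P" "p \<noteq> q"
      then obtain x y where "p = Some x" "\<bar>x - Re z\<bar> \<le> R * Im z" "q = Some y" "\<bar>y - Re z\<bar> \<le> R * Im z"
        using True by meson
      then show "?nr (sqrt \<rho> * sqrt \<rho>) p q" using NN[of x y] pq \<rho> by simp
    qed (use \<rho> in simp)
    then show ?thesis by blast
  next
    case False
    then obtain d where d: "d \<in> P" "\<not> ?near R d" by blast
    have other: "?near (2 / \<sigma>) p" if p: "p \<in> P" "p \<noteq> d" for p
    proof -
      have s: "sep \<sigma> z d p" using sep p d by auto
      show ?thesis
      proof (cases d)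
        case None
        then obtain x where "p = Some x" using p by (cases p) auto
        then show ?thesis using s sep_infinity[OF _ z \<sigma>] sep_commute None by blast
      next
        case (Some y)
        then have y: "\<bar>y - Re z\<bar> > R * Im z" using d by auto
        moreover have "2 / \<sigma> * Im z \<le> R * Im z" using R z by (intro mult_right_mono) auto
        ultimately have y': "\<not> \<bar>y - Re z\<bar> \<le> 2 / \<sigma> * Im z" by simp
        show ?thesis
        proof (cases p)
          case None
          then show ?thesis using s sep_infinity[OF _ z \<sigma>, of y] Some y' by auto
        next
          case (Some x)
          then show ?thesis using s sep_finite(2)[OF _ z \<sigma>, of y x] \<open>d = Some y\<close> y' by auto
        qed
      qed
    qed
    obtain \<nu> where \<nu>: "\<nu> > 0" "\<And>x. \<bar>x - Re z\<bar> \<le> 2 / \<sigma> * Im z \<Longrightarrow> ?nr \<nu> d (Some x)"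
    proof (cases d)
      case None
      have "?nr 1 d (Some x)" for x using None \<kappa> by (simp add: near_ratio_def)
      then show ?thesis using that[of 1] by simp
    next
      case (Some y)
      then have "\<bar>y - Re z\<bar> > R * Im z" using d by auto
      from far[OF this] show ?thesis using that Some by auto
    qed
    \<comment> \<open>The far point gets the weight for which its products with \<open>sqrt \<rho>\<close> are \<open>\<nu>\<close>.\<close>
    define \<mu> where "\<mu> p = (if p = d then \<nu> / sqrt \<rho> else sqrt \<rho>)" for p
    have "coherent \<kappa> (lift H) (lift L) \<mu> P"
      unfolding coherent_def
    proof (intro conjI allI ballI impI)
      show "\<mu> p > 0" for p using \<nu>(1) \<rho> by (simp add: \<mu>_def)
      fix p q assume pq: "p \<in> P" "q \<in> P" "p \<noteq> q"
      have sub: "2 / \<sigma> * Im z \<le> R * Im z" using R z by (intro mult_right_mono) auto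
      consider "p = d" | "q = d" | "p \<noteq> d" "q \<noteq> d" by blast
      then show "?nr (\<mu> p * \<mu> q) p q"
      proof cases
        case 1
        then obtain x where x: "q = Some x" "\<bar>x - Re z\<bar> \<le> 2 / \<sigma> * Im z" using other pq by metis
        have "\<mu> p * \<mu> q = \<nu>" using 1 pq \<rho> by (simp add: \<mu>_def)
        then show ?thesis using \<nu>(2)[OF x(2)] 1 x(1) by simp
      next
        case 2
        then obtain x where x: "p = Some x" "\<bar>x - Re z\<bar> \<le> 2 / \<sigma> * Im z" using other pq by metis
        have "\<mu> p * \<mu> q = \<nu>" using 2 pq \<rho> by (simp add: \<mu>_def)
        then show ?thesis using \<nu>(2)[OF x(2)] 2 x(1) sym by metis
      next
        case 3
        then obtain x y where x: "p = Some x" "\<bar>x - Re z\<bar> \<le> 2 / \<sigma> * Im z"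
          and y: "q = Some y" "\<bar>y - Re z\<bar> \<le> 2 / \<sigma> * Im z" using other pq by metis
        have "\<mu> p * \<mu> q = \<rho>" using 3 \<rho> by (simp add: \<mu>_def)
        then show ?thesis using NN[of x y] pq x y sub by auto
      qed
    qed
    then show ?thesis by blast
  qed
qed

text \<open>
  Seen from a far point \<open>d\<close>, the points of \<open>S\<close> are all at about the same distance, before and after applying
  \<open>H\<close> or \<open>L\<close>.
\<close>

lemma far_comparison:
  fixes H L :: "real \<Rightarrow> real"
  assumes mono: "strict_mono H" "strict_mono L" and "d \<noteq> a"
    and \<omega>: "0 < \<omega>" "\<omega> < 1" "1 + \<omega> \<le> \<kappa> * (1 - \<omega>)"
    and H: "\<And>x. x \<in> S \<Longrightarrow> \<bar>H x - H a\<bar> \<le> \<omega> * \<bar>H d - H a\<bar>"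
    and L: "\<And>x. x \<in> S \<Longrightarrow> \<bar>L x - L a\<bar> \<le> \<omega> * \<bar>L d - L a\<bar>"
  shows "\<exists>\<mu>>0. \<forall>x\<in>S. near_ratio \<kappa> \<mu> \<bar>H d - H x\<bar> \<bar>L d - L x\<bar>"
proof (intro exI conjI ballI)
  let ?h = "\<bar>H d - H a\<bar>" and ?l = "\<bar>L d - L a\<bar>"
  have pos: "?h > 0" "?l > 0" using assms(3) mono by (auto simp: strict_mono_eq)
  then show "?h / ?l > 0" by simp
  fix x assume x: "x \<in> S"
  have h: "\<bar>H d - H x\<bar> \<le> (1 + \<omega>) * ?h" "(1 - \<omega>) * ?h \<le> \<bar>H d - H x\<bar>"
    and l: "\<bar>L d - L x\<bar> \<le> (1 + \<omega>) * ?l" "(1 - \<omega>) * ?l \<le> \<bar>L d - L x\<bar>"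
    using H[OF x] L[OF x] unfolding distrib_right left_diff_distrib mult_1_left by linarith+
  have \<kappa>: "\<kappa> > 0" using \<omega> by (smt (verit) mult_nonpos_nonneg)
  have "\<bar>H d - H x\<bar> \<le> (\<kappa> * (1 - \<omega>)) * ?h"
    using h(1) mult_right_mono[OF \<omega>(3), of ?h] by linarith
  also have "\<dots> = \<kappa> * (?h / ?l) * ((1 - \<omega>) * ?l)" using pos by simp
  also have "\<dots> \<le> \<kappa> * (?h / ?l) * \<bar>L d - L x\<bar>" using l(2) \<kappa> by (intro mult_left_mono) auto
  finally have 1: "\<bar>H d - H x\<bar> \<le> \<kappa> * (?h / ?l) * \<bar>L d - L x\<bar>" .
  have "(?h / ?l) * \<bar>L d - L x\<bar> \<le> (?h / ?l) * ((1 + \<omega>) * ?l)" using l(1) by (intro mult_left_mono) auto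
  also have "\<dots> = (1 + \<omega>) * ?h" using pos by simp
  also have "\<dots> \<le> (\<kappa> * (1 - \<omega>)) * ?h" using mult_right_mono[OF \<omega>(3), of ?h] by simp
  also have "\<dots> \<le> \<kappa> * \<bar>H d - H x\<bar>" using h(2) \<kappa> by (simp add: mult.assoc)
  finally show "near_ratio \<kappa> (?h / ?l) \<bar>H d - H x\<bar> \<bar>L d - L x\<bar>" using 1
    by (simp add: near_ratio_def)
qed

lemma near_ratio_grid_sum:
  fixes H L :: "real \<Rightarrow> real" and \<phi> :: "nat \<Rightarrow> real"
  assumes "\<And>i. i < N \<Longrightarrow> near_ratio K \<rho> (H (\<phi> (Suc i)) - H (\<phi> i)) (L (\<phi> (Suc i)) - L (\<phi> i))"
    and "i \<le> j" "j \<le> N"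
  shows "near_ratio K \<rho> (H (\<phi> j) - H (\<phi> i)) (L (\<phi> j) - L (\<phi> i))"
  using assms(2,3)
proof (induction j rule: dec_induct)
  case base
  then show ?case by (simp add: near_ratio_def)
next
  case (step j)
  then show ?case using near_ratio_add[of K \<rho> "H (\<phi> j) - H (\<phi> i)" "L (\<phi> j) - L (\<phi> i)"
      "H (\<phi> (Suc j)) - H (\<phi> j)" "L (\<phi> (Suc j)) - L (\<phi> j)"] assms(1)[of j] by simp
qed

lemma grid_cell:
  fixes \<phi> :: "nat \<Rightarrow> real"
  assumes "\<phi> 0 \<le> x" "x \<le> \<phi> N" "N > 0"
  obtains i where "i < N" "\<phi> i \<le> x" "x \<le> \<phi> (Suc i)"
proof -
  have "\<exists>i<N. \<phi> i \<le> x \<and> x \<le> \<phi> (Suc i)" using assms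
  proof (induction N)
    case (Suc N)
    show ?case
    proof (cases "\<phi> N \<le> x")
      case False
      then have "N > 0" using Suc.prems by (cases N) auto
      then show ?thesis using Suc.IH Suc.prems False by (auto simp: less_Suc_eq)
    qed (use Suc.prems in auto)
  qed simp
  then show ?thesis using that by blast
qed

text \<open>
  If increments of \<open>H\<close> and \<open>L\<close> are proportional up to a factor \<open>K\<close> on the cells of a grid, then they are
  nearly proportional on every interval that is long compared with the mesh: enlarge or shrink the
  interval to grid points. This uses a modulus of continuity of \<open>H\<close> only; for \<open>L\<close> monotonicity is enough.
\<close>

lemma near_ratio_from_grid:
  fixes H L :: "real \<Rightarrow> real" and \<phi> :: "nat \<Rightarrow> real"
  assumes mono: "strict_mono H" "strict_mono L"
    and grid: "\<And>i. i < N \<Longrightarrow> near_ratio K \<rho> (H (\<phi> (Suc i)) - H (\<phi> i)) (L (\<phi> (Suc i)) - L (\<phi> i))"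
    and mesh: "\<And>i. i < N \<Longrightarrow> \<phi> i < \<phi> (Suc i) \<and> \<phi> (Suc i) \<le> \<phi> i + \<tau>"
    and xy: "\<phi> 0 \<le> x" "x + \<tau> < y" "y \<le> \<phi> N" and N: "N > 0"
    and small: "\<And>u. \<bar>u\<bar> \<le> \<tau> \<Longrightarrow> \<bar>H (x + u) - H x\<bar> \<le> \<omega> * (H y - H x)"
      "\<And>u. \<bar>u\<bar> \<le> \<tau> \<Longrightarrow> \<bar>H (y + u) - H y\<bar> \<le> \<omega> * (H y - H x)"
    and \<omega>: "K * (1 + 2 * \<omega>) \<le> \<kappa>" "K \<le> \<kappa> * (1 - 2 * \<omega>)" and K: "K \<ge> 1" and \<rho>: "\<rho> > 0" and \<kappa>: "\<kappa> \<ge> 0"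
  shows "near_ratio \<kappa> \<rho> (H y - H x) (L y - L x)"
proof -
  have Hm: "H a \<le> H b" and Lm: "L a \<le> L b" if "a \<le> b" for a b
    using mono that by (auto simp: strict_mono_less_eq)
  have \<tau>: "0 < \<tau>" using mesh[OF N] by linarith
  then have "x < y" using xy by linarith
  obtain i where i: "i < N" "\<phi> i \<le> x" "x \<le> \<phi> (Suc i)"
    using grid_cell[of \<phi> x N] xy \<open>x < y\<close> N by auto
  obtain j where j: "j < N" "\<phi> j \<le> y" "y \<le> \<phi> (Suc j)"
    using grid_cell[of \<phi> y N] xy \<open>x < y\<close> N by auto
  have \<phi>m: "\<phi> a \<le> \<phi> b" if "a \<le> b" "b \<le> N" for a b
    using that
  proof (induction b rule: dec_induct)
    case (step b)
    then show ?case using mesh[of b] by simp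
  qed simp
  have ij: "Suc i \<le> j"
  proof (rule ccontr)
    assume "\<not> Suc i \<le> j"
    then have "\<phi> (Suc j) \<le> \<phi> (Suc i)" using \<phi>m[of "Suc j" "Suc i"] i by simp
    then show False using mesh[OF i(1)] i j xy by linarith
  qed
  let ?h = "H y - H x"
  have lo: "x - \<tau> \<le> \<phi> i" "\<phi> (Suc i) \<le> x + \<tau>" "y - \<tau> \<le> \<phi> j" "\<phi> (Suc j) \<le> y + \<tau>"
    using mesh[OF i(1)] mesh[OF j(1)] i j by linarith+
  have e: "H x - H (\<phi> i) \<le> \<omega> * ?h" "H (\<phi> (Suc i)) - H x \<le> \<omega> * ?h"
     "H y - H (\<phi> j) \<le> \<omega> * ?h" "H (\<phi> (Suc j)) - H y \<le> \<omega> * ?h"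
    using small(1)[of "\<phi> i - x"] small(1)[of "\<phi> (Suc i) - x"]
      small(2)[of "\<phi> j - y"] small(2)[of "\<phi> (Suc j) - y"] lo i j by auto
  \<comment> \<open>The grid intervals just containing, and just contained in, the interval from \<open>x\<close> to \<open>y\<close>.\<close>
  have outer: "near_ratio K \<rho> (H (\<phi> (Suc j)) - H (\<phi> i)) (L (\<phi> (Suc j)) - L (\<phi> i))"
    by (rule near_ratio_grid_sum[where H = H and L = L and \<phi> = \<phi> and N = N]) (use ij j(1) grid in auto)
  have inner: "near_ratio K \<rho> (H (\<phi> j) - H (\<phi> (Suc i))) (L (\<phi> j) - L (\<phi> (Suc i)))"
    by (rule near_ratio_grid_sum[where H = H and L = L and \<phi> = \<phi> and N = N]) (use ij j(1) grid in auto)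
  have h: "?h \<ge> 0" using Hm[of x y] \<open>x < y\<close> by simp
  have "\<rho> * (L y - L x) \<le> \<rho> * (L (\<phi> (Suc j)) - L (\<phi> i))"
    using \<rho> Lm[OF i(2)] Lm[OF j(3)] by (intro mult_left_mono) auto
  also have "\<dots> \<le> K * (H (\<phi> (Suc j)) - H (\<phi> i))" using outer by (simp add: near_ratio_def)
  also have "\<dots> \<le> K * ((1 + 2 * \<omega>) * ?h)"
    using e K by (intro mult_left_mono) (auto simp: algebra_simps)
  also have "\<dots> \<le> \<kappa> * ?h" using mult_right_mono[OF \<omega>(1) h] by (simp add: mult.assoc)
  finally have 1: "\<rho> * (L y - L x) \<le> \<kappa> * ?h" .
  have "K * ?h \<le> \<kappa> * (1 - 2 * \<omega>) * ?h" using mult_right_mono[OF \<omega>(2) h] by simp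
  also have "\<dots> \<le> \<kappa> * (H (\<phi> j) - H (\<phi> (Suc i)))"
    using e \<kappa> unfolding mult.assoc by (intro mult_left_mono) (auto simp: algebra_simps)
  also have "\<dots> \<le> \<kappa> * (K * \<rho> * (L (\<phi> j) - L (\<phi> (Suc i))))"
    using inner \<kappa> by (intro mult_left_mono) (auto simp: near_ratio_def)
  also have "\<dots> \<le> \<kappa> * (K * \<rho> * (L y - L x))"
    using \<kappa> K \<rho> Lm[OF i(3)] Lm[OF j(2)] by (intro mult_left_mono) auto
  also have "\<dots> = K * (\<kappa> * \<rho> * (L y - L x))" by simp
  finally have 2: "?h \<le> \<kappa> * \<rho> * (L y - L x)" using K by simp
  show ?thesis using 1 2 by (simp add: near_ratio_def)
qed

text \<open>
  The comparison principle on which both directions rest. If \<open>H\<close> is \<open>M\<close>-quasisymmetric, then on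
  any set of points that are separated as seen from \<open>z\<close>, the cross-ratio distortion between \<open>H\<close> and a monotone
  \<open>L\<close> is controlled by comparing increments on a grid of bounded extent \<open>R\<close> and mesh \<open>c\<close>, both measured in
  units of \<open>Im z\<close>; \<open>R\<close>, \<open>c\<close> and the tolerance \<open>K\<close> depend on \<open>M\<close>, \<open>\<sigma>\<close> and \<open>\<kappa>\<close> only.
\<close>

theorem coherent_from_grid:
  assumes M: "M \<ge> 1" and \<sigma>: "0 < \<sigma>" "\<sigma> \<le> 1" and \<kappa>: "1 < \<kappa>"
  obtains R c K where "R > 0" "c > 0" "K > 1"
    "\<And>H L z \<phi> N \<rho> P. \<lbrakk>line_qs M H; strict_mono L; Im z > 0; \<rho> > 0; N > 0;
      \<phi> 0 \<le> Re z - R * Im z; Re z + R * Im z \<le> \<phi> N;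
      \<And>i. i < N \<Longrightarrow> \<phi> i < \<phi> (Suc i) \<and> \<phi> (Suc i) \<le> \<phi> i + c * Im z;
      \<And>i. i < N \<Longrightarrow> near_ratio K \<rho> (H (\<phi> (Suc i)) - H (\<phi> i)) (L (\<phi> (Suc i)) - L (\<phi> i));
      \<And>p q. p \<in> P \<Longrightarrow> q \<in> P \<Longrightarrow> p \<noteq> q \<Longrightarrow> sep \<sigma> z p q\<rbrakk>
      \<Longrightarrow> \<exists>\<mu>. coherent \<kappa> (lift H) (lift L) \<mu> P"
proof -
  \<comment> \<open>Small enough for \<open>(1 + e) * (1 + 2 * e)\<close> and \<open>(1 + e) / (1 - 2 * e)\<close> to be at most \<open>1 + 8 * e\<close>; the bound 2
    keeps the factor lost in comparing \<open>L\<close> with \<open>H\<close> twice at most 4.\<close>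
  define e where "e = (min \<kappa> 2 - 1) / 8"
  have "8 * e = min \<kappa> 2 - 1" by (simp add: e_def)
  then have e: "0 < e" "e \<le> 1 / 8" "1 + 8 * e \<le> \<kappa>" "1 + 8 * e \<le> 2" using \<kappa> by linarith+
  obtain c1 where c1: "0 < c1" "c1 \<le> 1"
    "\<And>H x u v. line_qs M H \<Longrightarrow> \<bar>u\<bar> \<le> c1 * \<bar>v\<bar> \<Longrightarrow> \<bar>H (x + u) - H x\<bar> \<le> e * \<bar>H (x + v) - H x\<bar>"
    using line_qs_small[OF M e(1)] by metis
  obtain c2 where c2: "0 < c2" "c2 \<le> 1"
    "\<And>H x u v. line_qs M H \<Longrightarrow> \<bar>u\<bar> \<le> c2 * \<bar>v\<bar> \<Longrightarrow> \<bar>H (x + u) - H x\<bar> \<le> e / 4 * \<bar>H (x + v) - H x\<bar>"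
    using line_qs_small[OF M, of "e / 4"] e(1) by (metis divide_pos_pos zero_less_numeral)
  \<comment> \<open>Points beyond \<open>R\<close> are so far that the points within \<open>2 / \<sigma>\<close> look alike from there.\<close>
  define R where "R = 2 / \<sigma> / c2"
  have R: "R \<ge> 2 / \<sigma>" "R > 0" "c2 * R = 2 / \<sigma>"
    using c2 \<sigma> by (auto simp: R_def field_simps mult_le_cancel_left1)
  have R\<sigma>: "2 / \<sigma> \<ge> \<sigma>" using \<sigma> mult_mono[of \<sigma> 1 \<sigma> 1] by (simp add: field_simps)
  define c where "c = c1 * \<sigma> / 2"
  have c: "0 < c" "c < \<sigma>" "c \<le> c1 * \<sigma>"
    using c1 \<sigma> mult_right_mono[of c1 1 \<sigma>] by (auto simp: c_def)
  define \<kappa>' where "\<kappa>' = 1 + 8 * e"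
  have \<kappa>': "\<kappa>' \<ge> 1" "\<kappa>' \<le> 2" "\<kappa>' \<le> \<kappa>" "(1 + e) * (1 + 2 * e) \<le> \<kappa>'" "1 + e \<le> \<kappa>' * (1 - 2 * e)"
      "1 + e \<le> \<kappa>' * (1 - e)"
  proof -
    have "e * e \<le> e * (1 / 8)" using e by (intro mult_left_mono) auto
    then show "(1 + e) * (1 + 2 * e) \<le> \<kappa>'" "1 + e \<le> \<kappa>' * (1 - 2 * e)" "1 + e \<le> \<kappa>' * (1 - e)"
      using e by (auto simp: \<kappa>'_def algebra_simps)
  qed (use e in \<open>auto simp: \<kappa>'_def\<close>)
  show ?thesis
  proof (rule that[of R c "1 + e"])
    fix H L :: "real \<Rightarrow> real" and z \<phi> N \<rho> P
    assume H: "line_qs M H" and Lm: "strict_mono L" and z: "Im z > 0" and \<rho>: "\<rho> > 0" and N: "N > 0"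
      and \<phi>: "\<phi> 0 \<le> Re z - R * Im z" "Re z + R * Im z \<le> \<phi> N"
      and mesh: "\<And>i. i < N \<Longrightarrow> \<phi> i < \<phi> (Suc i) \<and> \<phi> (Suc i) \<le> \<phi> i + c * Im z"
      and grid: "\<And>i. i < N \<Longrightarrow> near_ratio (1 + e) \<rho> (H (\<phi> (Suc i)) - H (\<phi> i)) (L (\<phi> (Suc i)) - L (\<phi> i))"
      and sep: "\<And>p q. p \<in> P \<Longrightarrow> q \<in> P \<Longrightarrow> p \<noteq> q \<Longrightarrow> sep \<sigma> z p q"
    have Hm: "strict_mono H" using H by (simp add: line_qs_def)
    have near: "near_ratio \<kappa>' \<rho> (H y - H x) (L y - L x)"
      if "\<bar>x - Re z\<bar> \<le> R * Im z" "\<bar>y - Re z\<bar> \<le> R * Im z" "\<sigma> * Im z \<le> y - x" for x y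
    proof -
      have pos: "\<sigma> * Im z > 0" using \<sigma> z by simp
      then have "x < y" using that by linarith
      then have Hxy: "H x < H y" using Hm by (simp add: strict_mono_less)
      have "c1 * \<sigma> * Im z \<le> c1 * (y - x)" using that c1 by (simp add: mult.assoc)
      then have c': "c * Im z \<le> c1 * (y - x)" using c(3) z
        by (meson mult_right_mono order_trans less_imp_le)
      have s1: "\<bar>H (x + u) - H x\<bar> \<le> e * (H y - H x)" if "\<bar>u\<bar> \<le> c * Im z" for u
        using c1(3)[OF H, of u "y - x" x] that c' \<open>x < y\<close> Hxy by simp
      have s2: "\<bar>H (y + u) - H y\<bar> \<le> e * (H y - H x)" if "\<bar>u\<bar> \<le> c * Im z" for u
        using c1(3)[OF H, of u "x - y" y] that c' \<open>x < y\<close> Hxy by simp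
      have "c * Im z < \<sigma> * Im z" using c z by simp
      then show ?thesis
        using that \<phi> e \<kappa>'
        by (intro near_ratio_from_grid[where H = H and L = L and \<phi> = \<phi> and N = N and K = "1 + e"
              and \<tau> = "c * Im z" and \<omega> = e, OF Hm Lm grid mesh _ _ _ N s1 s2 _ _ _ \<rho>]) auto
    qed
    have far: "\<exists>\<mu>>0. \<forall>x. \<bar>x - Re z\<bar> \<le> 2 / \<sigma> * Im z \<longrightarrow>
        near_ratio \<kappa>' \<mu> \<bar>H d - H x\<bar> \<bar>L d - L x\<bar>" if d: "\<bar>d - Re z\<bar> > R * Im z" for d
    proof -
      let ?S = "{x. \<bar>x - Re z\<bar> \<le> 2 / \<sigma> * Im z}"
      define s where "s = (if d \<ge> Re z then R * Im z else - (R * Im z))"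
      have RI: "R * Im z > 0" using R z by simp
      have s: "\<bar>s\<bar> = R * Im z" "s * (d - Re z) \<ge> 0"
        using RI mult_nonneg_nonneg[of "R * Im z" "d - Re z"] mult_nonneg_nonneg[of "R * Im z" "Re z - d"]
        by (auto simp: s_def right_diff_distrib)
      have nz: "d \<noteq> Re z" using d RI by auto
      have Hd: "\<bar>H x - H (Re z)\<bar> \<le> e / 4 * \<bar>H (Re z + s) - H (Re z)\<bar>" if "x \<in> ?S" for x
      proof -
        have "\<bar>x - Re z\<bar> \<le> c2 * \<bar>s\<bar>" using that R by (simp add: s mult.assoc[symmetric])
        then show ?thesis using c2(3)[OF H, of "x - Re z" s "Re z"] by simp
      qed
      have HH: "\<bar>H (Re z + s) - H (Re z)\<bar> \<le> \<bar>H d - H (Re z)\<bar>"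
        and LL: "\<bar>L (Re z + s) - L (Re z)\<bar> \<le> \<bar>L d - L (Re z)\<bar>"
        using strict_mono_abs_le[OF Hm, of s "d - Re z" "Re z"] strict_mono_abs_le[OF Lm, of s "d - Re z" "Re z"]
          s d by auto
      have nr: "\<bar>L (Re z + u) - L (Re z)\<bar> * \<rho> \<le> \<kappa>' * \<bar>H (Re z + u) - H (Re z)\<bar> \<and>
          \<bar>H (Re z + u) - H (Re z)\<bar> \<le> \<kappa>' * \<rho> * \<bar>L (Re z + u) - L (Re z)\<bar>"
        if u: "\<sigma> * Im z \<le> \<bar>u\<bar>" "\<bar>u\<bar> \<le> R * Im z" for u
      proof (cases "u \<ge> 0")
        case True
        then have "H (Re z) \<le> H (Re z + u)" "L (Re z) \<le> L (Re z + u)"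
          using Hm Lm by (simp_all add: strict_mono_less_eq)
        then show ?thesis using near[of "Re z" "Re z + u"] u True RI
          by (simp add: near_ratio_def mult.commute)
      next
        case False
        then have "H (Re z + u) \<le> H (Re z)" "L (Re z + u) \<le> L (Re z)"
          using Hm Lm by (simp_all add: strict_mono_less_eq)
        then show ?thesis using near[of "Re z + u" "Re z"] u False RI
          by (simp add: near_ratio_def mult.commute)
      qed
      have Ld: "\<bar>L x - L (Re z)\<bar> \<le> e * \<bar>L d - L (Re z)\<bar>" if x: "x \<in> ?S" for x
      proof -
        define r where "r = 2 / \<sigma> * Im z"
        define u where "u = (if x \<ge> Re z then r else - r)"
        have pos: "r > 0" using \<sigma> z by (simp add: r_def)
        have u: "\<bar>u\<bar> = 2 / \<sigma> * Im z" "(x - Re z) * u \<ge> 0"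
          using pos mult_nonneg_nonneg[of "x - Re z" r] mult_nonneg_nonneg[of "Re z - x" r]
          unfolding u_def r_def[symmetric] by (auto simp: left_diff_distrib)
        have r: "\<sigma> * Im z \<le> \<bar>u\<bar>" "\<bar>u\<bar> \<le> R * Im z" "\<sigma> * Im z \<le> \<bar>s\<bar>"
          unfolding u s using R R\<sigma> z
          by (auto intro!: mult_right_mono simp del: times_divide_eq_left)
        have "\<bar>L x - L (Re z)\<bar> \<le> \<bar>L (Re z + u) - L (Re z)\<bar>"
          using strict_mono_abs_le[OF Lm, of "x - Re z" u "Re z"] u x by auto
        then have "\<bar>L x - L (Re z)\<bar> * \<rho> \<le> \<bar>L (Re z + u) - L (Re z)\<bar> * \<rho>" using \<rho> by simp
        also have "\<dots> \<le> \<kappa>' * \<bar>H (Re z + u) - H (Re z)\<bar>" using nr r by blast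
        also have "\<dots> \<le> \<kappa>' * (e / 4 * \<bar>H (Re z + s) - H (Re z)\<bar>)"
          using Hd[of "Re z + u"] u \<kappa>' by (intro mult_left_mono) auto
        also have "\<dots> \<le> \<kappa>' * (e / 4 * (\<kappa>' * \<rho> * \<bar>L (Re z + s) - L (Re z)\<bar>))"
          using nr[of s] s r e \<kappa>' by (intro mult_left_mono) auto
        also have "\<dots> = (\<kappa>' * \<kappa>') * (e / 4 * \<bar>L (Re z + s) - L (Re z)\<bar> * \<rho>)" by simp
        also have "\<dots> \<le> 4 * (e / 4 * \<bar>L (Re z + s) - L (Re z)\<bar> * \<rho>)"
          using e \<rho> mult_mono[of \<kappa>' 2 \<kappa>' 2] \<kappa>' by (intro mult_right_mono) auto
        also have "\<dots> = (e * \<bar>L (Re z + s) - L (Re z)\<bar>) * \<rho>" by simp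
        finally have "\<bar>L x - L (Re z)\<bar> \<le> e * \<bar>L (Re z + s) - L (Re z)\<bar>" using \<rho> by simp
        also have "\<dots> \<le> e * \<bar>L d - L (Re z)\<bar>" using LL e by simp
        finally show ?thesis .
      qed
      have "\<exists>\<mu>>0. \<forall>x\<in>?S. near_ratio \<kappa>' \<mu> \<bar>H d - H x\<bar> \<bar>L d - L x\<bar>"
      proof (rule far_comparison[OF Hm Lm nz, of e])
        fix x assume x: "x \<in> ?S"
        have "\<bar>H x - H (Re z)\<bar> \<le> e / 4 * \<bar>H d - H (Re z)\<bar>"
          using Hd[OF x] mult_left_mono[OF HH, of "e / 4"] e by linarith
        also have "\<dots> \<le> e * \<bar>H d - H (Re z)\<bar>" using e by (intro mult_right_mono) auto
        finally show "\<bar>H x - H (Re z)\<bar> \<le> e * \<bar>H d - H (Re z)\<bar>" .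
      qed (use e \<kappa>' Ld in auto)
      then show ?thesis by simp
    qed
    obtain \<mu> where \<mu>: "coherent \<kappa>' (lift H) (lift L) \<mu> P"
      using coherent_of_near_far[OF sep z \<sigma>(1) \<kappa>'(1) \<rho> R(1) near far Hm Lm] by blast
    have "coherent \<kappa> (lift H) (lift L) \<mu> P"
      unfolding coherent_def
    proof (intro conjI allI ballI impI)
      show \<mu>0: "\<mu> p > 0" for p using \<mu> by (simp add: coherent_def)
      fix p q assume "p \<in> P" "q \<in> P" "p \<noteq> q"
      then have "near_ratio \<kappa>' (\<mu> p * \<mu> q) \<bar>sdet (lift H p) (lift H q)\<bar> \<bar>sdet (lift L p) (lift L q)\<bar>"
        using \<mu> by (simp add: coherent_def)
      then show "near_ratio \<kappa> (\<mu> p * \<mu> q) \<bar>sdet (lift H p) (lift H q)\<bar> \<bar>sdet (lift L p) (lift L q)\<bar>"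
        using \<kappa>'(3) \<mu>0[of p] \<mu>0[of q] by (elim near_ratio_mono) auto
    qed
    then show "\<exists>\<mu>. coherent \<kappa> (lift H) (lift L) \<mu> P" by blast
  qed (use R c e in auto)
qed

section \<open>Quasisymmetric maps are quasi-Moebius\<close>

text \<open>
  A single quasisymmetric map is compared with the identity, up to a constant that depends on \<open>M\<close> and
  \<open>\<sigma>\<close> only.
\<close>

lemma line_qs_imp_coherent:
  assumes M: "M \<ge> 1" and \<sigma>: "0 < \<sigma>" "\<sigma> \<le> 1"
  obtains C where "C \<ge> 1"
    "\<And>H z P. \<lbrakk>line_qs M H; Im z > 0; \<And>p q. p \<in> P \<Longrightarrow> q \<in> P \<Longrightarrow> p \<noteq> q \<Longrightarrow> sep \<sigma> z p q\<rbrakk>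
      \<Longrightarrow> \<exists>\<mu>. coherent C (lift H) id \<mu> P"
proof -
  obtain c where c: "0 < c" "c \<le> 1"
    "\<And>H x u v. line_qs M H \<Longrightarrow> \<bar>u\<bar> \<le> c * \<bar>v\<bar> \<Longrightarrow> \<bar>H (x + u) - H x\<bar> \<le> 1 / 2 * \<bar>H (x + v) - H x\<bar>"
    using line_qs_small[OF M, of "1 / 2"] by (metis half_gt_zero zero_less_one)
  define R where "R = 2 / \<sigma> / (c / 2)"
  have R: "R \<ge> 2 / \<sigma>" "R > 0" "c / 2 * R = 2 / \<sigma>" "c * R \<ge> 2 / \<sigma>"
    using c \<sigma> by (auto simp: R_def field_simps)
  have "2 / \<sigma> \<ge> 2" using \<sigma> by (simp add: field_simps)
  then have R\<sigma>: "R \<ge> \<sigma>" using R(1) \<sigma> by linarith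
  obtain C where C: "C \<ge> 1"
    "\<And>H x u v. line_qs M H \<Longrightarrow> \<bar>u\<bar> \<le> (2 * R / \<sigma>) * \<bar>v\<bar> \<Longrightarrow> \<bar>H (x + u) - H x\<bar> \<le> C * \<bar>H (x + v) - H x\<bar>"
    using line_qs_growth[OF M, of "2 * R / \<sigma>"] by metis
  define D where "D = 2 * C * (R / \<sigma>) + 4 * C + 3"
  have D: "D \<ge> 3" "2 * C * (R / \<sigma>) \<le> D" "4 * C \<le> D" "D \<ge> 1" using R \<sigma> C by (auto simp: D_def)
  show ?thesis
  proof (rule that[of D])
    fix H z P
    assume H: "line_qs M H" and z: "Im z > 0" and sep: "\<And>p q. p \<in> P \<Longrightarrow> q \<in> P \<Longrightarrow> p \<noteq> q \<Longrightarrow> sep \<sigma> z p q"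
    have Hm: "strict_mono H" using H by (simp add: line_qs_def)
    define W where "W = H (Re z + R * Im z) - H (Re z)"
    define \<rho> where "\<rho> = W / (R * Im z)"
    have RI: "R * Im z > 0" using R z by simp
    have W: "W > 0" using Hm RI by (simp add: W_def strict_mono_less)
    have \<rho>: "\<rho> > 0" using W RI by (simp add: \<rho>_def)
    have near: "near_ratio D \<rho> (H y - H x) (y - x)"
      if x: "\<bar>x - Re z\<bar> \<le> R * Im z" and y: "\<bar>y - Re z\<bar> \<le> R * Im z" and xy: "\<sigma> * Im z \<le> y - x" for x y
    proof -
      let ?a = "Re z" and ?r = "R * Im z"
      have pos: "\<sigma> * Im z > 0" using \<sigma> z by simp
      then have "x < y" using xy by linarith
      then have h: "H x < H y" using Hm by (simp add: strict_mono_less)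
      have r: "?r \<le> (R / \<sigma>) * (y - x)"
      proof -
        have "?r = (R / \<sigma>) * (\<sigma> * Im z)" using \<sigma> by simp
        also have "\<dots> \<le> (R / \<sigma>) * (y - x)" using xy R \<sigma> by (intro mult_left_mono) auto
        finally show ?thesis .
      qed
      have r': "?r \<le> (2 * R / \<sigma>) * ?r"
      proof -
        have "1 \<le> 2 * R / \<sigma>" using R\<sigma> \<sigma> by (simp add: field_simps)
        then show ?thesis using RI mult_right_mono[of 1 "2 * R / \<sigma>" ?r] by linarith
      qed
      have up: "\<bar>H w - H ?a\<bar> \<le> C * W" if "\<bar>w - ?a\<bar> \<le> ?r" for w
      proof -
        have "\<bar>w - ?a\<bar> \<le> (2 * R / \<sigma>) * \<bar>?r\<bar>" using that r' RI by simp
        then have "\<bar>H (?a + (w - ?a)) - H ?a\<bar> \<le> C * \<bar>H (?a + ?r) - H ?a\<bar>" by (rule C(2)[OF H])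
        then show ?thesis using W by (simp add: W_def)
      qed
      have down: "\<bar>H w - H x\<bar> \<le> C * (H y - H x)" if "\<bar>w - ?a\<bar> \<le> ?r" for w
      proof -
        have "\<bar>w - x\<bar> \<le> (2 * R / \<sigma>) * \<bar>y - x\<bar>"
        proof -
          have "\<bar>w - x\<bar> \<le> 2 * ?r" using that x by linarith
          also have "\<dots> \<le> 2 * ((R / \<sigma>) * (y - x))" using r by simp
          finally show ?thesis using \<open>x < y\<close> by simp
        qed
        then have "\<bar>H (x + (w - x)) - H x\<bar> \<le> C * \<bar>H (x + (y - x)) - H x\<bar>" by (rule C(2)[OF H])
        then show ?thesis using h by simp
      qed
      have U: "H y - H x \<le> 2 * C * W" using up[OF x] up[OF y] by linarith
      have Lo: "W \<le> 2 * C * (H y - H x)" using down[of ?a] down[of "?a + ?r"] RI unfolding W_def by simp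
      have \<rho>r: "\<rho> * ?r = W" using R z by (simp add: \<rho>_def)
      have "2 * C * W = 2 * C * (\<rho> * ?r)" by (simp only: \<rho>r)
      also have "\<dots> \<le> 2 * C * (\<rho> * ((R / \<sigma>) * (y - x)))" using r \<rho> C by (intro mult_left_mono) auto
      also have "\<dots> = (2 * C * (R / \<sigma>)) * (\<rho> * (y - x))" by simp
      also have "\<dots> \<le> D * (\<rho> * (y - x))" using D \<rho> \<open>x < y\<close> by (intro mult_right_mono) auto
      finally have 1: "H y - H x \<le> D * \<rho> * (y - x)" using U by (simp add: mult.assoc)
      have "\<rho> * (y - x) \<le> \<rho> * (2 * ?r)" using x y \<rho> by (intro mult_left_mono) auto
      also have "\<dots> = 2 * W" using \<rho>r by simp
      also have "\<dots> \<le> 4 * C * (H y - H x)" using Lo by simp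
      also have "\<dots> \<le> D * (H y - H x)" using D h by (intro mult_right_mono) auto
      finally show ?thesis using 1 by (simp add: near_ratio_def)
    qed
    have far: "\<exists>\<mu>>0. \<forall>x. \<bar>x - Re z\<bar> \<le> 2 / \<sigma> * Im z \<longrightarrow>
        near_ratio D \<mu> \<bar>H d - H x\<bar> \<bar>d - x\<bar>" if d: "\<bar>d - Re z\<bar> > R * Im z" for d
    proof -
      let ?S = "{x. \<bar>x - Re z\<bar> \<le> 2 / \<sigma> * Im z}"
      have nz: "d \<noteq> Re z" using d RI by auto
      have *: "2 / \<sigma> * Im z \<le> c / 2 * \<bar>d - Re z\<bar>"
      proof -
        have "2 / \<sigma> * Im z = c / 2 * (R * Im z)" unfolding R(3)[symmetric] by simp
        also have "\<dots> \<le> c / 2 * \<bar>d - Re z\<bar>" using d c by (intro mult_left_mono) auto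
        finally show ?thesis .
      qed
      have "\<exists>\<mu>>0. \<forall>x\<in>?S. near_ratio D \<mu> \<bar>H d - H x\<bar> \<bar>d - x\<bar>"
      proof (rule far_comparison[where L = "\<lambda>x. x", OF Hm _ nz, of "1 / 2"])
        fix x assume x: "x \<in> ?S"
        then have "\<bar>x - Re z\<bar> \<le> c / 2 * \<bar>d - Re z\<bar>" using * by simp
        moreover have "c / 2 * \<bar>d - Re z\<bar> \<le> c * \<bar>d - Re z\<bar>" "c / 2 * \<bar>d - Re z\<bar> \<le> 1 / 2 * \<bar>d - Re z\<bar>"
          using c mult_right_mono[of c 1 "\<bar>d - Re z\<bar>"] by auto
        ultimately have "\<bar>x - Re z\<bar> \<le> c * \<bar>d - Re z\<bar>" and l: "\<bar>x - Re z\<bar> \<le> 1 / 2 * \<bar>d - Re z\<bar>" by linarith+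
        then show "\<bar>H x - H (Re z)\<bar> \<le> 1 / 2 * \<bar>H d - H (Re z)\<bar>" 
          using c(3)[OF H, of "x - Re z" "d - Re z" "Re z"] by simp
        show "\<bar>x - Re z\<bar> \<le> 1 / 2 * \<bar>d - Re z\<bar>" by (rule l)
      qed (use D in \<open>auto simp: strict_mono_def\<close>)
      then show ?thesis by simp
    qed
    have "\<exists>\<mu>. coherent D (lift H) (lift (\<lambda>x. x)) \<mu> P"
      by (rule coherent_of_near_far[where H = H and L = "\<lambda>x. x", OF sep z \<sigma>(1) D(4) \<rho> R(1) near far Hm])
         (auto simp: strict_mono_def)
    moreover have "lift (\<lambda>x. x) = id" by (simp add: lift_def fun_eq_iff option.map_ident)
    ultimately show "\<exists>\<mu>. coherent D (lift H) id \<mu> P" by simp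
  qed (use D in auto)
qed

text \<open>
  The points \<open>a < b < c\<close> and infinity.
\<close>

definition quadruple :: "real \<Rightarrow> real \<Rightarrow> real \<Rightarrow> rhat set" where
  "quadruple a b c = {Some c, Some b, Some a, None}"

text \<open>
  Three points with a bounded quotient of consecutive distances, together with infinity, are separated as
  seen from the point at height \<open>b - a\<close> above \<open>b\<close>.
\<close>

lemma sep_quadruple:
  assumes ab: "a < b" and bc: "b < c" and K: "K \<ge> 1" "c - b \<le> K * (b - a)" "b - a \<le> K * (c - b)"
    and pq: "p \<in> quadruple a b c" "q \<in> quadruple a b c" "p \<noteq> q"
  shows "sep (1 / (2 * (K + 1))) (Complex b (b - a)) p q"
proof -
  let ?z = "Complex b (b - a)" and ?\<sigma> = "1 / (2 * (K + 1))"
  define u v where "u = b - a" and "v = c - b"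
  have uv: "u > 0" "v > 0" "v \<le> K * u" "u \<le> K * v" using assms by (auto simp: u_def v_def)
  have ha: "hdist ?z (Some a) \<le> 2 * u"
  proof -
    have "of_real a - ?z = Complex (- u) (- u)" by (simp add: complex_eq_iff u_def)
    then show ?thesis using cmod_le[of "Complex (-u) (-u)"] uv by simp
  qed
  have hb: "hdist ?z (Some b) \<le> u"
  proof -
    have "of_real b - ?z = Complex 0 (- u)" by (simp add: complex_eq_iff u_def)
    then show ?thesis using uv by (simp add: complex_norm)
  qed
  have hc: "hdist ?z (Some c) \<le> u + v"
  proof -
    have "of_real c - ?z = Complex v (- u)" by (simp add: complex_eq_iff u_def v_def)
    then show ?thesis using cmod_le[of "Complex v (-u)"] uv by simp
  qed
  have nn: "hdist ?z r \<ge> 0" for r by (cases r) auto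
  have *: "sep ?\<sigma> ?z p q" if "hdist ?z p \<le> x" "hdist ?z q \<le> y" "x * y \<le> 2 * (K + 1) * (\<bar>sdet p q\<bar> * u)"
    for p q x y
  proof -
    have "hdist ?z p * hdist ?z q \<le> x * y"
      using that nn[of p] nn[of q] by (intro mult_mono) auto
    then have "hdist ?z p * hdist ?z q \<le> 2 * (K + 1) * (\<bar>sdet p q\<bar> * u)" using that by linarith
    then show ?thesis using K by (simp add: sep_def u_def field_simps)
  qed
  have Kuv: "0 \<le> K * u" "0 \<le> K * v" "u \<le> K * u" "v \<le> K * v" 
    using K(1) uv mult_right_mono[of 1 K u] mult_right_mono[of 1 K v] by auto
  have 1: "sep ?\<sigma> ?z (Some a) (Some b)"
  proof (rule *[OF ha hb])
    have "u \<le> (K + 1) * u" using Kuv uv by (simp add: algebra_simps)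
    then have "2 * u * u \<le> 2 * ((K + 1) * u) * u" using uv by (intro mult_right_mono) auto
    moreover have s: "\<bar>sdet (Some a) (Some b)\<bar> = u" using uv by (simp add: u_def)
    ultimately show "2 * u * u \<le> 2 * (K + 1) * (\<bar>sdet (Some a) (Some b)\<bar> * u)"
      unfolding s by (simp only: mult.assoc)
  qed
  have 2: "sep ?\<sigma> ?z (Some b) (Some c)"
  proof (rule *[OF hb hc])
    have "u + v \<le> 2 * ((K + 1) * v)" using Kuv uv by (simp add: algebra_simps)
    then have "(u + v) * u \<le> 2 * ((K + 1) * v) * u" using uv by (intro mult_right_mono) auto
    then show "u * (u + v) \<le> 2 * (K + 1) * (\<bar>sdet (Some b) (Some c)\<bar> * u)"
      using uv by (simp add: v_def mult_ac)
  qed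
  have 3: "sep ?\<sigma> ?z (Some a) (Some c)"
  proof (rule *[OF ha hc])
    have s: "\<bar>sdet (Some a) (Some c)\<bar> = u + v" using uv by (simp add: u_def v_def)
    have "u + v \<le> (K + 1) * (u + v)" using K uv mult_right_mono[of 1 "K + 1" "u + v"] by simp
    then have "2 * (u + v) * u \<le> 2 * ((K + 1) * (u + v)) * u" using uv
      by (intro mult_right_mono mult_left_mono) auto
    then show "2 * u * (u + v) \<le> 2 * (K + 1) * (\<bar>sdet (Some a) (Some c)\<bar> * u)"
      unfolding s by (simp only: mult_ac)
  qed
  have 4: "sep ?\<sigma> ?z None (Some a)"
    by (rule *[of _ 1, OF _ ha]) (use Kuv uv in \<open>auto simp: algebra_simps\<close>)
  have 5: "sep ?\<sigma> ?z None (Some b)"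
    by (rule *[of _ 1, OF _ hb]) (use Kuv uv in \<open>auto simp: algebra_simps\<close>)
  have 6: "sep ?\<sigma> ?z None (Some c)"
    by (rule *[of _ 1, OF _ hc]) (use Kuv uv in \<open>auto simp: algebra_simps\<close>)
  show ?thesis using pq 1 2 3 4 5 6 sep_commute unfolding quadruple_def by blast
qed

lemma sep_PSL2R:
  assumes "g \<in> PSL2R" "Im z > 0"
  obtains w where "Im w > 0" "\<And>\<sigma> p q. sep \<sigma> w (g p) (g q) \<longleftrightarrow> sep \<sigma> z p q"
proof -
  obtain a b c d where g: "g = mob a b c d" "a * d - b * c = 1" using assms(1) by (rule PSL2R_cases)
  let ?w = "hmob a b c d z"
  have "Im ?w > 0" unfolding Im_moebius_complex(1)[OF g(2) assms(2)]
    using assms(2) Im_moebius_complex(2)[OF g(2) assms(2)] by simp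
  then show ?thesis using that sep_mob[OF g(2) assms(2)] g(1) by blast
qed

text \<open>
  In the coordinate \<open>g\<close> of the source, and after post-composition with a Moebius map, a
  cyclic order preserving bijection becomes an increasing function on the real line.
\<close>

lemma chart_exists:
  assumes "cyc_bij k" "g \<in> PSL2R"
  obtains A K where "A \<in> PSL2R" "A \<circ> k \<circ> g = lift K" "strict_mono K" "surj K"
proof -
  obtain A where A: "A \<in> PSL2R" "A (k (g None)) = None" by (rule PSL2R_send_to_infinity)
  have "cyc_bij (A \<circ> k \<circ> g)" by (intro cyc_bij_comp assms(1) cyc_bij_PSL2R[OF A(1)] cyc_bij_PSL2R[OF assms(2)])
  then show ?thesis using cyc_bij_fixing_infinity[of "A \<circ> k \<circ> g"] A that by auto
qed

lemma good_charts:
  assumes "A \<in> PSL2R" "B \<in> PSL2R" "A \<circ> k \<circ> g = k'" "B \<circ> l \<circ> g = l'"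
  shows "good \<kappa> k' l' p q r s \<longleftrightarrow> good \<kappa> k l (g p) (g q) (g r) (g s)"
  unfolding good_def assms(3,4)[symmetric] o_def cr_PSL2R[OF assms(1)] cr_PSL2R[OF assms(2)] ..

text \<open>
  Quasisymmetric maps are quasi-Moebius: changing coordinates by Moebius maps on both sides preserves
  quasisymmetry, with a new constant that depends on the old one only.
\<close>

lemma line_qs_quasi_moebius:
  assumes M: "M \<ge> 1"
  obtains M' where "M' \<ge> 1"
    "\<And>H A g K. \<lbrakk>line_qs M H; A \<in> PSL2R; g \<in> PSL2R; A \<circ> lift H \<circ> g = lift K; strict_mono K\<rbrakk>
      \<Longrightarrow> line_qs M' K"
proof -
  obtain C where C: "C \<ge> 1"
    "\<And>H z P. \<lbrakk>line_qs M H; Im z > 0; \<And>p q. p \<in> P \<Longrightarrow> q \<in> P \<Longrightarrow> p \<noteq> q \<Longrightarrow> sep (1 / 4) z p q\<rbrakk>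
      \<Longrightarrow> \<exists>\<mu>. coherent C (lift H) id \<mu> P"
    by (rule line_qs_imp_coherent[OF M, of "1 / 4"]) auto
  show ?thesis
  proof (rule that[of "C ^ 4"])
    show "1 \<le> C ^ 4" using C by simp
    fix H A g K
    assume H: "line_qs M H" and A: "A \<in> PSL2R" and g: "g \<in> PSL2R" and K: "A \<circ> lift H \<circ> g = lift K"
      and Km: "strict_mono K"
    have inj: "inj (lift H)" "inj g" using H PSL2R_bij[OF g]
      by (auto simp: line_qs_def lift_def bij_def strict_mono_imp_inj_on intro!: option.inj_map)
    have main: "K (x + t) - K x \<le> C ^ 4 * (K x - K (x - t)) \<and> K x - K (x - t) \<le> C ^ 4 * (K (x + t) - K x)"
      if t: "t > 0" for x t
    proof -
      let ?Q = "quadruple (x - t) x (x + t)"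
      have s: "sep (1 / 4) (Complex x t) p q" if "p \<in> ?Q" "q \<in> ?Q" "p \<noteq> q" for p q
        using sep_quadruple[of "x - t" x "x + t" 1 p q] t that by simp
      obtain w where w: "Im w > 0" "\<And>\<sigma> p q. sep \<sigma> w (g p) (g q) \<longleftrightarrow> sep \<sigma> (Complex x t) p q"
        using sep_PSL2R[OF g, of "Complex x t"] t by auto
      obtain \<mu> where \<mu>: "coherent C (lift H) id \<mu> (g ` ?Q)"
        using C(2)[OF H w(1), of "g ` ?Q"] w(2) s by blast
      have "good (C ^ 4) (lift H) id (g (Some (x + t))) (g (Some x)) (g (Some (x - t))) (g None)"
        using t C inj by (intro coherent_imp_good[OF \<mu>]) (auto simp: quadruple_def inj_eq)
      then have "good (C ^ 4) (lift K) id (Some (x + t)) (Some x) (Some (x - t)) None"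
        using good_charts[OF A _ K, of _ id] PSL2R_inverse[OF g] comp_id by metis
      moreover have "cr (Some (x + t)) (Some x) (Some (x - t)) None = 1"
        using t by (simp add: cr_symmetric_quadruple)
      moreover have "K x < K (x + t)" "K (x - t) < K x" using Km t by (auto simp: strict_mono_less)
      ultimately show ?thesis by (simp add: good_def cr_finite field_simps)
    qed
    show "line_qs (C ^ 4) K" by (rule line_qsI[OF _ Km main]) (use C in simp)
  qed
qed

section \<open>Chains of comparable quotients\<close>

text \<open>
  The quotients \<open>u / v\<close> and \<open>u' / v'\<close> agree up to the factor \<open>\<kappa>\<close>; for positive arguments this is an
  equivalence up to multiplication of the factors.
\<close>

definition sim :: "real \<Rightarrow> real \<Rightarrow> real \<Rightarrow> real \<Rightarrow> real \<Rightarrow> bool" where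
  "sim \<kappa> u v u' v' \<longleftrightarrow> u * v' \<le> \<kappa> * (u' * v) \<and> u' * v \<le> \<kappa> * (u * v')"

lemma sim_sym: "sim \<kappa> u v u' v' \<Longrightarrow> sim \<kappa> u' v' u v"
  by (auto simp: sim_def mult.commute)

lemma sim_commute: "sim \<kappa> u v u' v' \<longleftrightarrow> sim \<kappa> u' v' u v"
  by (auto simp: sim_def mult.commute)

lemma sim_trans:
  assumes "sim \<kappa> u v u' v'" "sim \<kappa>' u' v' u'' v''"
    and "u > 0" "v > 0" "u' > 0" "v' > 0" "u'' > 0" "v'' > 0" "\<kappa> \<ge> 0" "\<kappa>' \<ge> 0"
  shows "sim (\<kappa> * \<kappa>') u v u'' v''"
proof -
  have "(u * v'') * (u' * v') = (u * v') * (u' * v'')" by simp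
  also have "\<dots> \<le> (\<kappa> * (u' * v)) * (\<kappa>' * (u'' * v'))"
    by (rule mult_mono) (use assms in \<open>auto simp: sim_def\<close>)
  also have "\<dots> = \<kappa> * \<kappa>' * (u'' * v) * (u' * v')" by simp
  finally have 1: "u * v'' \<le> \<kappa> * \<kappa>' * (u'' * v)"
    using mult_pos_pos[OF assms(5,6)] by (rule mult_right_le_imp_le)
  have "(u'' * v) * (u' * v') = (u' * v) * (u'' * v')" by simp
  also have "\<dots> \<le> (\<kappa> * (u * v')) * (\<kappa>' * (u' * v''))"
    by (rule mult_mono) (use assms in \<open>auto simp: sim_def\<close>)
  also have "\<dots> = \<kappa> * \<kappa>' * (u * v'') * (u' * v')" by simp
  finally have 2: "u'' * v \<le> \<kappa> * \<kappa>' * (u * v'')"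
    using mult_pos_pos[OF assms(5,6)] by (rule mult_right_le_imp_le)
  show ?thesis using 1 2 by (simp add: sim_def)
qed

lemma sim_mono:
  assumes "sim \<kappa> u v u' v'" "\<kappa> \<le> \<kappa>'" "u > 0" "v > 0" "u' > 0" "v' > 0"
  shows "sim \<kappa>' u v u' v'"
proof -
  have "\<kappa> * (u' * v) \<le> \<kappa>' * (u' * v)" "\<kappa> * (u * v') \<le> \<kappa>' * (u * v')"
    using assms by (auto intro!: mult_right_mono)
  then show ?thesis using assms(1) by (auto simp: sim_def)
qed

lemma sim_refl: "\<kappa> \<ge> 1 \<Longrightarrow> u > 0 \<Longrightarrow> v > 0 \<Longrightarrow> sim \<kappa> u v u v"
  using mult_right_mono[of 1 \<kappa> "u * v"] by (simp add: sim_def)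

text \<open>
  A part compares with the whole as well as it does with the complementary part.
\<close>

lemma sim_part:
  assumes "sim \<kappa> u v u' v'" "\<kappa> \<ge> 1" "u > 0" "v > 0" "u' > 0" "v' > 0"
  shows "sim \<kappa> u v (u + u') (v + v')"
proof -
  have "u * v \<le> \<kappa> * (u * v)" using assms mult_right_mono[of 1 \<kappa> "u * v"] by simp
  moreover have "u * v' \<le> \<kappa> * (u' * v)" "u' * v \<le> \<kappa> * (u * v')" using assms(1) by (auto simp: sim_def)
  ultimately show ?thesis unfolding sim_def distrib_left distrib_right by linarith
qed

lemma sim_imp_near_ratio:
  assumes "sim \<kappa> u v u' v'" "v > 0" "v' > 0"
  shows "near_ratio \<kappa> (u / v) u' v'"
proof -
  have "u' * v \<le> (\<kappa> * (u / v) * v') * v" "(u / v * v') * v \<le> (\<kappa> * u') * v"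
    using assms by (auto simp: sim_def mult_ac)
  then show ?thesis using assms(2) unfolding near_ratio_def by (simp only: mult_le_cancel_right_pos)
qed

lemma near_ratio_chain:
  fixes \<delta> \<epsilon> :: "nat \<Rightarrow> real"
  assumes pos: "\<And>i. i < N \<Longrightarrow> \<delta> i > 0 \<and> \<epsilon> i > 0" and \<kappa>: "\<kappa> \<ge> 1"
    and step: "\<And>i. Suc i < N \<Longrightarrow> sim \<kappa> (\<delta> i) (\<epsilon> i) (\<delta> (Suc i)) (\<epsilon> (Suc i))"
    and i: "i < N"
  shows "near_ratio (\<kappa> ^ N) (\<delta> 0 / \<epsilon> 0) (\<delta> i) (\<epsilon> i)"
proof -
  have "sim (\<kappa> ^ i) (\<delta> 0) (\<epsilon> 0) (\<delta> i) (\<epsilon> i)" using i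
  proof (induction i)
    case 0
    then show ?case using pos[of 0] by (simp add: sim_refl)
  next
    case (Suc i)
    have "sim (\<kappa> ^ i * \<kappa>) (\<delta> 0) (\<epsilon> 0) (\<delta> (Suc i)) (\<epsilon> (Suc i))"
      using Suc step[of i] pos[of 0] pos[of i] pos[of "Suc i"] \<kappa>
      by (intro sim_trans[of _ _ _ "\<delta> i" "\<epsilon> i"]) auto
    then show ?case by (simp add: mult.commute)
  qed
  then have "sim (\<kappa> ^ N) (\<delta> 0) (\<epsilon> 0) (\<delta> i) (\<epsilon> i)"
    by (rule sim_mono) (use pos[of 0] pos[of i] i power_increasing[of i N \<kappa>] \<kappa> in auto)
  then show ?thesis using pos[of 0] pos[of i] i by (intro sim_imp_near_ratio) auto
qed

lemma good_iff_sim: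
  assumes "strict_mono H" "strict_mono L" "a < b" "b < c"
  shows "good \<kappa> (lift H) (lift L) (Some c) (Some b) (Some a) None \<longleftrightarrow>
    sim \<kappa> (H c - H b) (L c - L b) (H b - H a) (L b - L a)"
proof -
  have pos: "H a < H b" "H b < H c" "L a < L b" "L b < L c" using assms by (auto simp: strict_mono_less)
  have *: "u / u' \<le> \<kappa> * (v / v') \<longleftrightarrow> u * v' \<le> \<kappa> * (u' * v)" if "u' > 0" "v' > 0" for u u' v v' :: real
    using that by (simp add: field_simps)
  have cr: "cr (lift K (Some c)) (lift K (Some b)) (lift K (Some a)) (lift K None) = (K c - K b) / (K b - K a)"
    if "K a < K b" "K b < K c" for K :: "real \<Rightarrow> real" using that by (simp add: cr_finite)
  have pos': "H b - H a > 0" "L b - L a > 0" using pos by auto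
  show ?thesis unfolding good_def sim_def cr[OF pos(1,2)] cr[OF pos(3,4)] *[OF pos'] *[OF pos'(2,1)]
    by (simp only: mult.commute)
qed

lemma root_bound:
  assumes "K > (1::real)"
  obtains r where "r > 1" "r ^ N \<le> K"
proof (cases "N = 0")
  case True
  then show ?thesis using that[of 2] assms by simp
next
  case False
  then show ?thesis using that[of "root N K"] assms by (simp add: real_root_pow_pos2)
qed

section \<open>Maps with quasisymmetry constant near 1\<close>

text \<open>
  If \<open>F\<close> is \<open>\<epsilon>\<close>-quasisymmetric with \<open>\<epsilon>\<close> close to 1, then post-composing the quasisymmetric map \<open>H\<close> with \<open>F\<close>
  changes the cross-ratio of \<open>H\<close> on every symmetric quadruple \<open>g (x + t, x, x - t, infinity)\<close> only a little,
  uniformly in the Moebius map \<open>g\<close>.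
\<close>

theorem near_identity_distorts_little:
  assumes M: "M \<ge> 1" and \<kappa>: "\<kappa> > 1"
  obtains \<epsilon> where "\<epsilon> > 1"
    "\<And>H F g x t. \<lbrakk>line_qs M H; line_qs \<epsilon> F; surj H; g \<in> PSL2R; t > 0\<rbrakk> \<Longrightarrow>
      good \<kappa> (lift H) (lift F \<circ> lift H) (g (Some (x + t))) (g (Some x)) (g (Some (x - t))) (g None)"
proof -
  obtain M' where M': "M' \<ge> 1"
    "\<And>H A g K. \<lbrakk>line_qs M H; A \<in> PSL2R; g \<in> PSL2R; A \<circ> lift H \<circ> g = lift K; strict_mono K\<rbrakk>
      \<Longrightarrow> line_qs M' K" using line_qs_quasi_moebius[OF M] by blast
  obtain \<eta> where \<eta>: "\<eta> > 1" "\<eta> ^ 4 \<le> \<kappa>" using root_bound[OF \<kappa>] by blast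
  define \<sigma> where "\<sigma> = 1 / (2 * (M' + 1))"
  have \<sigma>: "0 < \<sigma>" "\<sigma> \<le> 1" using M' by (auto simp: \<sigma>_def field_simps)
  obtain R c K where RcK: "R > 0" "c > 0" "K > 1"
    "\<And>H L z \<phi> N \<rho> P. \<lbrakk>line_qs 1 H; strict_mono L; Im z > 0; \<rho> > 0; N > 0;
      \<phi> 0 \<le> Re z - R * Im z; Re z + R * Im z \<le> \<phi> N;
      \<And>i. i < N \<Longrightarrow> \<phi> i < \<phi> (Suc i) \<and> \<phi> (Suc i) \<le> \<phi> i + c * Im z;
      \<And>i. i < N \<Longrightarrow> near_ratio K \<rho> (H (\<phi> (Suc i)) - H (\<phi> i)) (L (\<phi> (Suc i)) - L (\<phi> i));
      \<And>p q. p \<in> P \<Longrightarrow> q \<in> P \<Longrightarrow> p \<noteq> q \<Longrightarrow> sep \<sigma> z p q\<rbrakk>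
      \<Longrightarrow> \<exists>\<mu>. coherent \<eta> (lift H) (lift L) \<mu> P"
    using coherent_from_grid[OF order_refl \<sigma> \<eta>(1)] by metis
  obtain N where N: "2 * R / c < real N" using reals_Archimedean2 by blast
  have N0: "N > 0" using N RcK by (metis divide_pos_pos gr0I mult_pos_pos not_less_iff_gr_or_eq of_nat_0 order_less_trans zero_less_numeral)
  obtain \<epsilon> where \<epsilon>: "\<epsilon> > 1" "\<epsilon> ^ N \<le> K" using root_bound[OF RcK(3)] by blast
  show ?thesis
  proof (rule that[OF \<epsilon>(1)])
    fix H F g x t
    assume H: "line_qs M H" and F: "line_qs \<epsilon> F" and Hs: "surj H" and g: "g \<in> PSL2R" and t: "t > (0::real)"
    have Hm: "strict_mono H" and Fm: "strict_mono F" using H F by (auto simp: line_qs_def)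
    obtain A k where A: "A \<in> PSL2R" "A \<circ> lift H \<circ> g = lift k" "strict_mono k"
      using chart_exists[OF cyc_bij_lift[OF Hm Hs] g] by metis
    have k: "line_qs M' k" by (rule M'(2)[OF H A(1) g A(2,3)])
    have kk: "k (x - t) < k x" "k x < k (x + t)" using A(3) t by (auto simp: strict_mono_less)
    let ?Q = "quadruple (k (x - t)) (k x) (k (x + t))"
    have s: "sep \<sigma> (Complex (k x) (k x - k (x - t))) p q" if "p \<in> ?Q" "q \<in> ?Q" "p \<noteq> q" for p q
      unfolding \<sigma>_def using sep_quadruple[OF kk M'(1) line_qsD(1,2)[OF k t]] that by blast
    obtain B where B: "B \<in> PSL2R" "A \<circ> B = id" "B \<circ> A = id" by (rule PSL2R_inverse[OF A(1)])
    \<comment> \<open>In the chart \<open>k\<close> the quadruple is separated as seen from a point above \<open>k x\<close>; \<open>B\<close> leads back from the chart and moves this point to \<open>w\<close>.\<close>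
    obtain w where w: "Im w > 0" "\<And>\<sigma> p q. sep \<sigma> w (B p) (B q) \<longleftrightarrow> sep \<sigma> (Complex (k x) (k x - k (x - t))) p q"
      using sep_PSL2R[OF B(1), of "Complex (k x) (k x - k (x - t))"] kk by auto
    let ?\<phi> = "\<lambda>i::nat. Re w - R * Im w + real i * (c * Im w)"
    have cI: "c * Im w > 0" using RcK w by simp
    have st: "?\<phi> (Suc i) = ?\<phi> i + c * Im w" for i by (simp add: algebra_simps)
    have inc: "?\<phi> i < ?\<phi> (Suc i)" for i unfolding st using cI by simp
    have Finc: "F (?\<phi> i) < F (?\<phi> (Suc i))" for i using Fm inc by (simp only: strict_mono_less)
    \<comment> \<open>Compare the identity with \<open>F\<close> on an equidistant grid on the scale of \<open>w\<close>.\<close>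
    have "\<exists>\<mu>. coherent \<eta> (lift (\<lambda>x. x)) (lift F) \<mu> (B ` ?Q)"
    proof (rule RcK(4)[where \<phi> = ?\<phi> and N = N and \<rho> = "(?\<phi> (Suc 0) - ?\<phi> 0) / (F (?\<phi> (Suc 0)) - F (?\<phi> 0))",
        OF line_qs_id Fm w(1) _ N0])
      show "(?\<phi> (Suc 0) - ?\<phi> 0) / (F (?\<phi> (Suc 0)) - F (?\<phi> 0)) > 0"
        using Finc[of 0] inc[of 0] by (simp only: diff_gt_0_iff_gt zero_less_divide_iff) blast
      have "2 * R \<le> real N * c" using N RcK by (simp add: field_simps)
      then have "2 * R * Im w \<le> real N * c * Im w" using w by (intro mult_right_mono) auto
      then show "Re w + R * Im w \<le> ?\<phi> N" by (simp add: algebra_simps)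
      show "?\<phi> i < ?\<phi> (Suc i) \<and> ?\<phi> (Suc i) \<le> ?\<phi> i + c * Im w" for i using inc[of i] st[of i] by simp
      fix i assume i: "i < N"
      have "sim \<epsilon> (?\<phi> (Suc i) - ?\<phi> i) (F (?\<phi> (Suc i)) - F (?\<phi> i))
        (?\<phi> (Suc (Suc i)) - ?\<phi> (Suc i)) (F (?\<phi> (Suc (Suc i))) - F (?\<phi> (Suc i)))" for i
      proof -
        define y where "y = ?\<phi> (Suc i)"
        define e where "e = c * Im w"
        have p: "?\<phi> (Suc i) = y" "?\<phi> i = y - e" "?\<phi> (Suc (Suc i)) = y + e"
          using st[of i] st[of "Suc i"] unfolding y_def e_def by linarith+
        have e: "e > 0" using cI by (simp add: e_def)
        have "F (y + e) - F y \<le> \<epsilon> * (F y - F (y - e))" "F y - F (y - e) \<le> \<epsilon> * (F (y + e) - F y)"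
          by (rule line_qsD[OF F e])+
        then show ?thesis unfolding p sim_def using e by (simp add: mult_le_cancel_left_pos flip: mult.left_commute[of e])
      qed
      then have "near_ratio (\<epsilon> ^ N) ((?\<phi> (Suc 0) - ?\<phi> 0) / (F (?\<phi> (Suc 0)) - F (?\<phi> 0)))
        (?\<phi> (Suc i) - ?\<phi> i) (F (?\<phi> (Suc i)) - F (?\<phi> i))"
        using \<epsilon> Finc inc i 
        by (intro near_ratio_chain[where \<delta> = "\<lambda>i. ?\<phi> (Suc i) - ?\<phi> i" and \<epsilon> = "\<lambda>i. F (?\<phi> (Suc i)) - F (?\<phi> i)"])
           (simp_all only: diff_gt_0_iff_gt simp_thms less_imp_le)
      then show "near_ratio K ((?\<phi> (Suc 0) - ?\<phi> 0) / (F (?\<phi> (Suc 0)) - F (?\<phi> 0)))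
        (?\<phi> (Suc i) - ?\<phi> i) (F (?\<phi> (Suc i)) - F (?\<phi> i))"
        using \<epsilon>(2) Finc[of 0] inc[of 0] Finc[of i] inc[of i]
        by (elim near_ratio_mono) (simp_all only: diff_ge_0_iff_ge less_imp_le divide_nonneg_nonneg)
    next
      show "sep \<sigma> w p q" if "p \<in> B ` ?Q" "q \<in> B ` ?Q" "p \<noteq> q" for p q
      proof -
        from that obtain p' q' where "p = B p'" "q = B q'" "p' \<in> ?Q" "q' \<in> ?Q" by blast
        then show ?thesis using s[of p' q'] w(2)[of \<sigma> p' q'] that(3) by blast
      qed
    qed simp
    then obtain \<mu> where \<mu>: "coherent \<eta> (lift (\<lambda>x. x)) (lift F) \<mu> (B ` ?Q)" by blast
    have idl: "lift (\<lambda>x. x) = id" by (simp add: lift_def fun_eq_iff option.map_ident)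
    have Bk: "B (lift k p) = lift H (g p)" for p
      using fun_cong[OF A(2), of p] fun_cong[OF B(3), of "lift H (g p)"] by simp
    have injF: "inj (lift F)" using Fm by (auto simp: lift_def strict_mono_imp_inj_on intro!: option.inj_map)
    have injB: "inj B" using PSL2R_bij[OF B(1)] by (simp add: bij_def)
    have "good (\<eta> ^ 4) (lift (\<lambda>x. x)) (lift F) (B (Some (k (x + t)))) (B (Some (k x))) (B (Some (k (x - t)))) (B None)"
      using \<eta> kk injF injB by (intro coherent_imp_good[OF \<mu>]) (auto simp: quadruple_def inj_eq idl)
    then have "good (\<eta> ^ 4) id (lift F) (lift H (g (Some (x + t)))) (lift H (g (Some x))) (lift H (g (Some (x - t)))) (lift H (g None))"
      using Bk[of "Some (x + t)"] Bk[of "Some x"] Bk[of "Some (x - t)"] Bk[of None] idl by simp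
    then have g4: "good (\<eta> ^ 4) (lift H) (lift F \<circ> lift H) (g (Some (x + t))) (g (Some x)) (g (Some (x - t))) (g None)"
      by (simp add: good_def)
    show "good \<kappa> (lift H) (lift F \<circ> lift H) (g (Some (x + t))) (g (Some x)) (g (Some (x - t))) (g None)"
      by (rule good_mono[OF g4 \<eta>(2)])
  qed
qed

section \<open>Closeness on fans and the Stern-Brocot grid\<close>

text \<open>
  Moebius maps with integer coefficients.
\<close>

definition imob :: "int \<Rightarrow> int \<Rightarrow> int \<Rightarrow> int \<Rightarrow> rhat \<Rightarrow> rhat" where
  "imob a b c d = mob (of_int a) (of_int b) (of_int c) (of_int d)"

text \<open>
  For \<open>t > 0\<close> and \<open>g\<close> in PSL(2,Z), the cross-ratios of the images of \<open>g (t, 0, - t, infinity)\<close> under \<open>k\<close> and \<open>l\<close>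
  agree up to the factor \<open>\<kappa>\<close>. As \<open>g\<close> may be precomposed with translations by integers, this covers the
  quadruples \<open>g (m + t, m, m - t, infinity)\<close> in the fan with tip \<open>g infinity\<close>.
\<close>

definition fan_close :: "real \<Rightarrow> (rhat \<Rightarrow> rhat) \<Rightarrow> (rhat \<Rightarrow> rhat) \<Rightarrow> bool" where
  "fan_close \<kappa> k l \<longleftrightarrow> (\<forall>(a::int) (b::int) (c::int) (d::int) (t::nat). a * d - b * c = 1 \<longrightarrow> t > 0 \<longrightarrow>
     (let g = imob a b c d in
        good \<kappa> k l (g (Some (real t))) (g (Some 0)) (g (Some (- real t))) (g None)))"

lemma fan_closeD:
  assumes "fan_close \<kappa> k l" "(a::int) * d - b * c = 1" "t > 0"
    and "g = imob a b c d"
  shows "good \<kappa> k l (g (Some (real t))) (g (Some 0)) (g (Some (- real t))) (g None)"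
  using assms unfolding fan_close_def Let_def by blast

lemma det_of_int:
  "(a::int) * d - b * c = 1 \<Longrightarrow> real_of_int a * of_int d - of_int b * of_int c = 1"
  by (metis of_int_1 of_int_diff of_int_mult)

lemma fan_close_charts:
  assumes fc: "fan_close \<kappa> k l" and det: "(a::int) * d - b * c = 1"
    and g: "g = imob a b c d"
    and "A \<in> PSL2R" "B \<in> PSL2R" "A \<circ> k \<circ> g = k'" "B \<circ> l \<circ> g = l'"
  shows "fan_close \<kappa> k' l'"
  unfolding fan_close_def Let_def
proof (intro allI impI)
  fix a' b' c' d' :: int and t :: nat
  assume det': "a' * d' - b' * c' = 1" and t: "t > 0"
  define f where "f = imob a' b' c' d'"
  have "(a * a' + b * c') * (c * b' + d * d') - (a * b' + b * d') * (c * a' + d * c')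
      = (a * d - b * c) * (a' * d' - b' * c')"
    by (simp add: algebra_simps)
  then have dd: "(a * a' + b * c') * (c * b' + d * d') - (a * b' + b * d') * (c * a' + d * c') = 1"
    using det det' by simp
  have "g \<circ> f = imob (a * a' + b * c') (a * b' + b * d') (c * a' + d * c') (c * b' + d * d')"
    unfolding g f_def imob_def using det_of_int[OF det] det_of_int[OF det'] by (simp add: mob_comp)
  from fan_closeD[OF fc dd t this]
  show "good \<kappa> k' l' (f (Some (real t))) (f (Some 0)) (f (Some (- real t))) (f None)"
    unfolding good_charts[OF assms(4-7)] by simp
qed

lemma fan_close_integers:
  assumes "fan_close \<kappa> (lift H) (lift L)" "strict_mono H" "strict_mono L" "t > 0"
  shows "sim \<kappa> (H (of_int m + real t) - H (of_int m)) (L (of_int m + real t) - L (of_int m))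
     (H (of_int m) - H (of_int m - real t)) (L (of_int m) - L (of_int m - real t))"
proof -
  have "good \<kappa> (lift H) (lift L) (imob 1 m 0 1 (Some (real t))) (imob 1 m 0 1 (Some 0))
     (imob 1 m 0 1 (Some (- real t))) (imob 1 m 0 1 None)"
    by (rule fan_closeD[OF assms(1) _ assms(4) refl]) simp
  then have "good \<kappa> (lift H) (lift L) (Some (of_int m + real t)) (Some (of_int m)) (Some (of_int m - real t)) None"
    by (simp add: imob_def moebius_def algebra_simps)
  then show ?thesis using assms by (subst (asm) good_iff_sim) auto
qed

lemma mediant_between:
  fixes a b c d :: int
  assumes "b > 0" "d > 0" "b * c - a * d = 1"
  shows "real_of_int a / b < of_int (a + c) / of_int (b + d)" "of_int (a + c) / of_int (b + d) < real_of_int c / d"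
proof -
  have det: "real_of_int b * c - a * d = 1" using assms(3) by (metis of_int_1 of_int_diff of_int_mult)
  show "real_of_int a / b < of_int (a + c) / of_int (b + d)" "of_int (a + c) / of_int (b + d) < real_of_int c / d"
    using assms(1,2) det by (auto simp: field_simps)
qed

lemma cr_four_finite:
  "cr (Some a) (Some b) (Some c) (Some d) = \<bar>a - b\<bar> * \<bar>c - d\<bar> / (\<bar>b - c\<bar> * \<bar>d - a\<bar>)"
  by (simp add: cr_def abs_mult)

lemma good_imp_sim:
  assumes "good \<kappa> k l a b c d"
    and "cr (k a) (k b) (k c) (k d) = u / u'" "cr (l a) (l b) (l c) (l d) = v / v'" "u' > 0" "v' > 0"
  shows "sim \<kappa> u v u' v'"
proof -
  have "u / u' \<le> \<kappa> * (v / v')" "v / v' \<le> \<kappa> * (u / u')"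
    using assms(1) unfolding good_def assms(2,3) by auto
  then show ?thesis using assms(4,5) by (simp add: sim_def field_simps)
qed

text \<open>
  Cross-ratio distortion under a flip. Let \<open>B\<close>, \<open>A\<close>, \<open>C\<close> be the lengths of three adjacent intervals and \<open>B'\<close>, \<open>A'\<close>, \<open>C'\<close>
  those of three others. If the cross-ratios of the two quadruples of endpoints agree up to \<open>\<kappa>\<close>, and the quotients of \<open>C\<close>
  by \<open>A + B\<close> and of \<open>C'\<close> by \<open>A' + B'\<close> agree up to \<open>\<kappa>'\<close>, then the quotients of \<open>A\<close> by \<open>B\<close> and of \<open>A'\<close> by \<open>B'\<close> agree up to the
  product: passing from \<open>C / (A + B)\<close> to \<open>1 + C / (A + B)\<close> does not increase the discrepancy.
\<close>

lemma sim_flip: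
  fixes A B C A' B' C' \<kappa> \<kappa>' :: real
  assumes pos: "A > 0" "B > 0" "C > 0" "A' > 0" "B' > 0" "C' > 0" and \<kappa>: "\<kappa> \<ge> 1" "\<kappa>' \<ge> 1"
    and cross: "sim \<kappa> (A * (A + B + C)) (A' * (A' + B' + C')) (C * B) (C' * B')"
    and old: "sim \<kappa>' C C' (A + B) (A' + B')"
  shows "sim (\<kappa> * \<kappa>') A A' B B'"
proof -
  have half: "A * B' \<le> \<kappa> * \<kappa>' * (B * A')"
    if pos: "A > 0" "B > 0" "C > 0" "A' > 0" "B' > 0" "C' > 0"
      and 1: "(A * (A + B + C)) * (C' * B') \<le> \<kappa> * ((C * B) * (A' * (A' + B' + C')))"
      and 2: "C * (A' + B') \<le> \<kappa>' * ((A + B) * C')" for A B C A' B' C'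
  proof -
    have "C * C' \<le> \<kappa>' * (C * C')" using pos \<kappa> mult_right_mono[of 1 \<kappa>' "C * C'"] by simp
    then have 3: "C * (A' + B' + C') \<le> \<kappa>' * ((A + B + C) * C')" using 2 by (simp add: algebra_simps)
    have "(A * B') * ((A + B + C) * C') = (A * (A + B + C)) * (C' * B')" by simp
    also have "\<dots> \<le> \<kappa> * (B * A') * (C * (A' + B' + C'))" using 1 by (simp only: mult_ac)
    also have "\<dots> \<le> \<kappa> * (B * A') * (\<kappa>' * ((A + B + C) * C'))"
      using 3 pos \<kappa> by (intro mult_left_mono) auto
    also have "\<dots> = (\<kappa> * \<kappa>' * (B * A')) * ((A + B + C) * C')" by simp
    finally show ?thesis by (rule mult_right_le_imp_le) (use pos in simp)
  qed
  have "A * B' \<le> \<kappa> * \<kappa>' * (B * A')"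
    by (rule half[OF pos]) (use cross old in \<open>auto simp: sim_def\<close>)
  moreover have "A' * B \<le> \<kappa> * \<kappa>' * (B' * A)"
    by (rule half[OF pos(4-6) pos(1-3)]) (use cross old in \<open>auto simp: sim_def mult_ac\<close>)
  ultimately show ?thesis by (simp add: sim_def mult_ac)
qed

context
  fixes H L :: "real \<Rightarrow> real" and \<kappa> :: real
  assumes mono: "strict_mono H" "strict_mono L" and \<kappa>: "\<kappa> \<ge> 1"
    and close: "fan_close \<kappa> (lift H) (lift L)"
begin

text \<open>
  Subdividing a Farey interval at its mediant cuts the images under \<open>H\<close> and \<open>L\<close> in nearly the same
  proportion. The induction moves from the edge from \<open>a / b\<close> to \<open>c / d\<close> to its predecessor in the Farey
  tree: the third vertex \<open>(c - a) / (d - b)\<close> of the triangle on the other side of the edge forms with the mediant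
  and the two endpoints a symmetric quadruple of a fan.
\<close>

lemma fan_close_mediant:
  fixes a b c d :: int
  assumes "b > 0" "d > 0" "b * c - a * d = 1"
    and "p = real_of_int a / b" "q = real_of_int c / d" "m = real_of_int (a + c) / of_int (b + d)"
  shows "sim (\<kappa> ^ nat (b + d)) (H q - H m) (L q - L m) (H m - H p) (L m - L p)"
  using assms
proof (induction "nat (b + d)" arbitrary: a b c d p q m rule: less_induct)
  case (less b d a c p q m)
  note pqm = less.prems(4-6)
  have pm: "p < m" "m < q" unfolding pqm using mediant_between[OF less.prems(1-3)] by auto
  have Hpm: "H p < H m" "H m < H q" "L p < L m" "L m < L q" using mono pm by (auto simp: strict_mono_less)
  have det: "(- a) * d - c * (- b) = 1" using less.prems(3) by (simp add: algebra_simps)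
  \<comment> \<open>This map sends infinity, 0 and -1 to \<open>p\<close>, \<open>q\<close> and \<open>m\<close>, and 1 to the third vertex of the other triangle.\<close>
  let ?g = "imob (- a) c (- b) d"
  have g: "?g None = Some p" "?g (Some 0) = Some q" "?g (Some (- real 1)) = Some m"
    using less.prems(1,2) unfolding pqm by (auto simp: imob_def moebius_def add.commute)
  have G: "good \<kappa> (lift H) (lift L) (?g (Some (real 1))) (Some q) (Some m) (Some p)"
    using fan_closeD[OF close det _ refl, of 1] unfolding g by simp

  consider "b = d" | "b < d" | "d < b" by linarith
  then show ?case
  proof cases
    case 1
    then have "b * (c - a) = 1" using less.prems(3) by (simp add: algebra_simps)
    then have b: "b = 1" "d = 1" using 1 less.prems(1) by (auto simp: zmult_eq_1_iff)
    then have r: "?g (Some (real 1)) = None" by (simp add: imob_def)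
    have "sim \<kappa> (H q - H m) (L q - L m) (H m - H p) (L m - L p)"
    proof -
      have "good \<kappa> (lift H) (lift L) None (Some q) (Some m) (Some p)" using G unfolding r .
      then have "sim \<kappa> (H m - H p) (L m - L p) (H q - H m) (L q - L m)"
        by (rule good_imp_sim) (use Hpm in \<open>auto simp: cr_def\<close>)
      then show ?thesis by (rule sim_sym)
    qed
    moreover have "\<kappa> \<le> \<kappa> ^ nat (b + d)" using \<kappa> b power_increasing[of 1 2 \<kappa>] by simp
    ultimately show ?thesis by (rule sim_mono) (use Hpm in auto)
  next
    case 2
    define r where "r = real_of_int (c - a) / of_int (d - b)"
    have r: "?g (Some (real 1)) = Some r" using 2 by (simp add: imob_def moebius_def r_def)
    have det': "b * (c - a) - a * (d - b) = 1" using less.prems(3) by (simp add: algebra_simps)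
    have "sim (\<kappa> ^ nat (b + (d - b))) (H r - H q) (L r - L q) (H q - H p) (L q - L p)"
      using less.hyps[of b "d - b" "c - a" a] 2 less.prems(1) det' unfolding pqm r_def by simp
    then have IH: "sim (\<kappa> ^ nat d) (H r - H q) (L r - L q) (H q - H p) (L q - L p)" by simp
    have "q < r" unfolding pqm r_def using mediant_between(2)[of b "d - b" "c - a" a] 2 less.prems(1) det' by simp
    then have Hr: "H q < H r" "L q < L r" using mono by (auto simp: strict_mono_less)
    have "sim (\<kappa> * \<kappa> ^ nat d) (H q - H m) (L q - L m) (H m - H p) (L m - L p)"
    proof (rule sim_flip)
      show "sim \<kappa> ((H q - H m) * ((H q - H m) + (H m - H p) + (H r - H q)))
         ((L q - L m) * ((L q - L m) + (L m - L p) + (L r - L q)))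
         ((H r - H q) * (H m - H p)) ((L r - L q) * (L m - L p))"
      proof (rule sim_sym, rule good_imp_sim)
        show "good \<kappa> (lift H) (lift L) (Some r) (Some q) (Some m) (Some p)" using G unfolding r .
      qed (use Hpm Hr in \<open>auto simp: cr_four_finite\<close>)
    qed (use Hpm Hr IH \<kappa> in auto)
    moreover have "\<kappa> * \<kappa> ^ nat d \<le> \<kappa> ^ nat (b + d)"
      using \<kappa> less.prems(1,2) power_increasing[of "Suc (nat d)" "nat (b + d)" \<kappa>] by simp
    ultimately show ?thesis by (rule sim_mono) (use Hpm in auto)
  next
    case 3
    define r where "r = real_of_int (c - a) / of_int (d - b)"
    have r': "r = real_of_int (a - c) / of_int (b - d)" 
      unfolding r_def by (metis minus_diff_eq minus_divide_divide of_int_minus)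
    have r: "?g (Some (real 1)) = Some r" using 3 by (simp add: imob_def moebius_def r_def)
    have det': "(b - d) * c - (a - c) * d = 1" using less.prems(3) by (simp add: algebra_simps)
    have "sim (\<kappa> ^ nat ((b - d) + d)) (H q - H p) (L q - L p) (H p - H r) (L p - L r)"
      using less.hyps[of "b - d" d c "a - c"] 3 less.prems(2) det' unfolding pqm r' by simp
    then have IH: "sim (\<kappa> ^ nat b) (H p - H r) (L p - L r) (H q - H p) (L q - L p)" by (simp add: sim_sym)
    have "r < p" unfolding pqm r' using mediant_between(1)[of "b - d" d c "a - c"] 3 less.prems(2) det' by simp
    then have Hr: "H r < H p" "L r < L p" using mono by (auto simp: strict_mono_less)
    have "sim (\<kappa> * \<kappa> ^ nat b) (H m - H p) (L m - L p) (H q - H m) (L q - L m)"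
    proof (rule sim_flip)
      show "sim \<kappa> ((H m - H p) * ((H m - H p) + (H q - H m) + (H p - H r)))
         ((L m - L p) * ((L m - L p) + (L q - L m) + (L p - L r)))
         ((H p - H r) * (H q - H m)) ((L p - L r) * (L q - L m))"
      proof (rule good_imp_sim)
        show "good \<kappa> (lift H) (lift L) (Some r) (Some q) (Some m) (Some p)" using G unfolding r .
      qed (use Hpm Hr in \<open>auto simp: cr_four_finite mult.commute\<close>)
    qed (use Hpm Hr IH \<kappa> in auto)
    moreover have "\<kappa> * \<kappa> ^ nat b \<le> \<kappa> ^ nat (b + d)"
      using \<kappa> less.prems(1,2) power_increasing[of "Suc (nat b)" "nat (b + d)" \<kappa>] by simp
    ultimately show ?thesis by (subst sim_commute, elim sim_mono) (use Hpm in auto)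
  qed
qed

end

text \<open>
  The grid obtained from the integers by inserting all mediants \<open>n\<close> times (Stern-Brocot), given by numerators
  and denominators; level \<open>n\<close> has \<open>2 ^ n\<close> cells in every unit interval.
\<close>

fun sb_num :: "nat \<Rightarrow> int \<Rightarrow> int" and sb_den :: "nat \<Rightarrow> int \<Rightarrow> int" where
  "sb_num 0 j = j"
| "sb_num (Suc n) j = (if even j then sb_num n (j div 2) else sb_num n (j div 2) + sb_num n (j div 2 + 1))"
| "sb_den 0 j = 1"
| "sb_den (Suc n) j = (if even j then sb_den n (j div 2) else sb_den n (j div 2) + sb_den n (j div 2 + 1))"

text \<open>
  The grid point with number \<open>j\<close> at level \<open>n\<close>.
\<close>

definition sb :: "nat \<Rightarrow> int \<Rightarrow> real" where
  "sb n j = of_int (sb_num n j) / of_int (sb_den n j)"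

lemma sb_den_pos: "sb_den n j > 0"
  by (induction n arbitrary: j) (auto simp: add_pos_pos)

lemma sb_den_le: "sb_den n j \<le> 2 ^ n"
proof (induction n arbitrary: j)
  case (Suc n)
  have "0 < (2::int) ^ n" by simp
  then show ?case using Suc[of "j div 2"] Suc[of "j div 2 + 1"]       unfolding sb_den.simps power_Suc by (cases "even j") (simp only: if_True if_False simp_thms; linarith)+
qed simp

lemma sb_den_add_ge: "sb_den n j + sb_den n (j + 1) \<ge> int n + 2"
proof (induction n arbitrary: j)
  case (Suc n)
  have "(j + 1) div 2 = (if even j then j div 2 else j div 2 + 1)" by presburger
  then show ?case using Suc[of "j div 2"] sb_den_pos[of n "j div 2"] sb_den_pos[of n "j div 2 + 1"]
    by (cases "even j") auto
qed simp

lemma sb_det: "sb_den n j * sb_num n (j + 1) - sb_num n j * sb_den n (j + 1) = 1"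
proof (induction n arbitrary: j)
  case (Suc n)
  have "(j + 1) div 2 = (if even j then j div 2 else j div 2 + 1)" by presburger
  then show ?case using Suc[of "j div 2"] by (cases "even j") (auto simp: algebra_simps)
qed simp

lemma sb_power: "sb n (2 ^ n * k) = of_int k"
proof -
  have "sb_num n (2 ^ n * k) = k \<and> sb_den n (2 ^ n * k) = 1"
    by (induction n) (auto simp: mult.assoc)
  then show ?thesis by (simp add: sb_def)
qed

lemma sb_step: "sb n (j + 1) - sb n j = 1 / (of_int (sb_den n j) * of_int (sb_den n (j + 1)))"
proof -
  have "real_of_int (sb_den n j) * of_int (sb_num n (j + 1)) - of_int (sb_num n j) * of_int (sb_den n (j + 1)) = 1"
    using sb_det[of n j] by (metis of_int_1 of_int_diff of_int_mult)
  then show ?thesis using sb_den_pos[of n j] sb_den_pos[of n "j + 1"]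
    by (simp add: sb_def field_simps)
qed

lemma sb_less: "sb n j < sb n (j + 1)"
proof -
  have "sb n (j + 1) - sb n j > 0" unfolding sb_step using sb_den_pos[of n j] sb_den_pos[of n "j + 1"] by simp
  then show ?thesis by simp
qed

lemma sb_mesh: "sb n (j + 1) \<le> sb n j + 1 / (real n + 1)"
proof -
  let ?a = "sb_den n j" and ?b = "sb_den n (j + 1)"
  have pos: "?a \<ge> 1" "?b \<ge> 1" using sb_den_pos[of n j] sb_den_pos[of n "j + 1"] by auto
  then have "0 \<le> (?a - 1) * (?b - 1)" by simp
  then have "int n + 1 \<le> ?a * ?b" using sb_den_add_ge[of n j] by (simp add: algebra_simps)
  then have "real_of_int (int n + 1) \<le> real_of_int (?a * ?b)" by (simp only: of_int_le_iff)
  then have "1 / (of_int ?a * real_of_int ?b) \<le> 1 / (real n + 1)"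
    by (intro divide_left_mono) (use pos in \<open>auto simp: add_pos_nonneg\<close>)
  then show ?thesis using sb_step[of n j] by simp
qed

lemma sb_even: "sb (Suc n) (2 * j) = sb n j"
  by (simp add: sb_def)

lemma sb_odd: "sb (Suc n) (2 * j + 1)
  = of_int (sb_num n j + sb_num n (j + 1)) / of_int (sb_den n j + sb_den n (j + 1))"
  by (simp add: sb_def)

text \<open>
  Adjacent cells of the Stern-Brocot grid have images of nearly the same proportion under \<open>H\<close> and \<open>L\<close>, with an
  exponent that depends on the level only.
\<close>

lemma fan_close_sb_grid:
  assumes mono: "strict_mono H" "strict_mono L" and \<kappa>: "\<kappa> \<ge> 1"
    and close: "fan_close \<kappa> (lift H) (lift L)"
  shows "sim (\<kappa> ^ (4 * 2 ^ n)) (H (sb n (j + 1)) - H (sb n j)) (L (sb n (j + 1)) - L (sb n j))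
     (H (sb n (j + 2)) - H (sb n (j + 1))) (L (sb n (j + 2)) - L (sb n (j + 1)))"
proof (induction n arbitrary: j)
  case 0
  have "sim \<kappa> (H (sb 0 (j + 1)) - H (sb 0 j)) (L (sb 0 (j + 1)) - L (sb 0 j))
     (H (sb 0 (j + 2)) - H (sb 0 (j + 1))) (L (sb 0 (j + 2)) - L (sb 0 (j + 1)))"
    using fan_close_integers[OF close mono, of 1 "j + 1"]
    by (subst sim_commute) (simp add: sb_def add.assoc)
  moreover have "\<kappa> \<le> \<kappa> ^ (4 * 2 ^ 0)" using power_increasing[of 1 4 \<kappa>] \<kappa> by simp
  ultimately show ?case
    by (rule sim_mono) (use mono in \<open>auto simp: strict_mono_less sb_def\<close>)
next
  case (Suc n)
  let ?e = "2 * 2 ^ n :: nat"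
  let ?h = "\<lambda>n i. H (sb n (i + 1)) - H (sb n i)" and ?l = "\<lambda>n i. L (sb n (i + 1)) - L (sb n i)"
  have pos: "?h n i > 0" "?l n i > 0" for n i using mono sb_less[of n i] by (auto simp: strict_mono_less)
  have \<kappa>e: "\<kappa> ^ m \<ge> 1" for m using \<kappa> by (rule one_le_power)
  have halves: "sim (\<kappa> ^ ?e) (?h (Suc n) (2 * i + 1)) (?l (Suc n) (2 * i + 1)) (?h (Suc n) (2 * i)) (?l (Suc n) (2 * i))" for i
  proof -
    have "sim (\<kappa> ^ nat (sb_den n i + sb_den n (i + 1)))
       (H (sb n (i + 1)) - H (sb (Suc n) (2 * i + 1))) (L (sb n (i + 1)) - L (sb (Suc n) (2 * i + 1)))
       (H (sb (Suc n) (2 * i + 1)) - H (sb n i)) (L (sb (Suc n) (2 * i + 1)) - L (sb n i))"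
      by (rule fan_close_mediant[OF mono \<kappa> close sb_den_pos sb_den_pos sb_det sb_def sb_def sb_odd])
    moreover have "\<kappa> ^ nat (sb_den n i + sb_den n (i + 1)) \<le> \<kappa> ^ ?e"
    proof (rule power_increasing[OF _ \<kappa>])
      have "sb_den n i + sb_den n (i + 1) \<le> int ?e" using sb_den_le[of n i] sb_den_le[of n "i + 1"] by simp
      then show "nat (sb_den n i + sb_den n (i + 1)) \<le> ?e" by linarith
    qed
    moreover have "sb (Suc n) (2 * i + 1 + 1) = sb n (i + 1)" "sb (Suc n) (2 * i) = sb n i"
      using sb_even[of n "i + 1"] sb_even[of n i] by (auto simp: algebra_simps)
    ultimately show ?thesis using pos[of "Suc n" "2 * i"] pos[of "Suc n" "2 * i + 1"] by (auto elim: sim_mono)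
  qed
  have sum: "?h (Suc n) (2 * i) + ?h (Suc n) (2 * i + 1) = ?h n i"
     "?l (Suc n) (2 * i) + ?l (Suc n) (2 * i + 1) = ?l n i" for i
    using sb_even[of n "i + 1"] sb_even[of n i] by (auto simp: algebra_simps)
  have child: "sim (\<kappa> ^ ?e) (?h (Suc n) (2 * i + 1)) (?l (Suc n) (2 * i + 1)) (?h n i) (?l n i)"
     "sim (\<kappa> ^ ?e) (?h (Suc n) (2 * i)) (?l (Suc n) (2 * i)) (?h n i) (?l n i)" for i
    using sim_part[OF halves[of i] \<kappa>e] sim_part[OF sim_sym[OF halves[of i]] \<kappa>e] pos[of "Suc n" "2 * i"]
      pos[of "Suc n" "2 * i + 1"] sum[of i] by (auto simp: add.commute)
  show ?case
  proof (cases "even j")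
    case True
    then obtain i where i: "j = 2 * i" by (elim evenE)
    have "sim (\<kappa> ^ ?e) (?h (Suc n) j) (?l (Suc n) j) (?h (Suc n) (j + 1)) (?l (Suc n) (j + 1))"
      unfolding i by (rule sim_sym[OF halves])
    moreover have "\<kappa> ^ ?e \<le> \<kappa> ^ (4 * 2 ^ Suc n)" by (rule power_increasing[OF _ \<kappa>]) simp
    ultimately have "sim (\<kappa> ^ (4 * 2 ^ Suc n)) (?h (Suc n) j) (?l (Suc n) j) (?h (Suc n) (j + 1)) (?l (Suc n) (j + 1))"
      by (rule sim_mono) (rule pos)+
    then show ?thesis by (simp add: add.assoc)
  next
    case False
    then obtain i where i: "j = 2 * i + 1" by (elim oddE)
    have s: "2 * (i + 1) = j + 1" using i by simp
    have 1: "sim (\<kappa> ^ ?e * \<kappa> ^ (4 * 2 ^ n)) (?h (Suc n) j) (?l (Suc n) j) (?h n (i + 1)) (?l n (i + 1))"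
    proof (rule sim_trans[of _ _ _ "?h n i" "?l n i", OF _ _ pos pos pos])
      show "sim (\<kappa> ^ ?e) (?h (Suc n) j) (?l (Suc n) j) (?h n i) (?l n i)" unfolding i by (rule child(1))
      show "sim (\<kappa> ^ (4 * 2 ^ n)) (?h n i) (?l n i) (?h n (i + 1)) (?l n (i + 1))"
        using Suc[of i] by (simp add: add.assoc)
    qed (use \<kappa> in auto)
    have "sim (\<kappa> ^ ?e * \<kappa> ^ (4 * 2 ^ n) * \<kappa> ^ ?e) (?h (Suc n) j) (?l (Suc n) j) (?h (Suc n) (j + 1)) (?l (Suc n) (j + 1))"
    proof (rule sim_trans[OF 1 _ pos pos pos])
      show "sim (\<kappa> ^ ?e) (?h n (i + 1)) (?l n (i + 1)) (?h (Suc n) (j + 1)) (?l (Suc n) (j + 1))"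
        using sim_sym[OF child(2)[of "i + 1"]] unfolding s .
    qed (use \<kappa> in auto)
    moreover have "\<kappa> ^ ?e * \<kappa> ^ (4 * 2 ^ n) * \<kappa> ^ ?e = \<kappa> ^ (4 * 2 ^ Suc n)"
      unfolding power_add[symmetric] by simp
    ultimately show ?thesis by (simp add: add.assoc)
  qed
qed

section \<open>From fans to all quadruples\<close>

text \<open>
  Every point of the upper half-plane can be moved to height at least 1/5 by PSL(2,Z).
\<close>

lemma modular_reduction:
  assumes z: "Im z > 0"
  obtains a b c d :: int where "a * d - b * c = 1"
    "Im (hmob (of_int a) (of_int b) (of_int c) (of_int d) z) \<ge> 1 / 5"
proof (cases "Im z \<ge> 1 / 5")
  case True
  then show ?thesis using that[of 1 1 0 0] by (simp add: moebius_def)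
next
  case False
  define T where "T = Im z"
  have T: "0 < T" "T < 1" using z False by (auto simp: T_def)
  \<comment> \<open>For this \<open>N\<close>, Dirichlet's theorem gives \<open>h / k\<close> for which the squares of \<open>k * Re z - h\<close> and \<open>k * T\<close>, whose sum is the
    square of the absolute value of \<open>k * z - h\<close>, are at most \<open>T\<close> and \<open>4 * T\<close>.\<close>
  define N where "N = nat \<lceil>1 / sqrt T\<rceil>"
  have sT: "0 < sqrt T" "sqrt T < 1" "sqrt T * sqrt T = T" using T by auto
  have one: "1 < 1 / sqrt T" using sT by simp
  have N: "1 / sqrt T \<le> real N" "real N \<le> 2 / sqrt T"
  proof -
    have c: "\<lceil>1 / sqrt T\<rceil> \<ge> 0" using one by linarith
    then have eq: "real N = of_int \<lceil>1 / sqrt T\<rceil>" unfolding N_def by (simp only: of_nat_nat)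
    show "1 / sqrt T \<le> real N" unfolding eq by (rule le_of_int_ceiling)
    have "of_int \<lceil>1 / sqrt T\<rceil> \<le> 1 / sqrt T + 1" by linarith
    then show "real N \<le> 2 / sqrt T" unfolding eq using one by linarith
  qed
  have "real N > 0" using N(1) one by linarith
  then have N0: "N > 0" by simp
  obtain h k where hk: "coprime h k" "0 < k" "k \<le> int N" "\<bar>of_int k * Re z - of_int h\<bar> < 1 / N"
    using Dirichlet_approx_coprime[OF N0, of "Re z"] by metis
  obtain u v where uv: "u * h + v * k = 1" using hk(1) by (metis bezout_int coprime_iff_gcd_eq_1)
  have det: "(- u) * (- h) - v * (- k) = 1 \<and> (- u) * (- h) - (- v) * k = 1" using uv by (simp add: mult.commute)
  then have det1: "(- u) * (- h) - (- v) * k = 1" by blast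
  let ?D = "of_real (of_int k) * z + complex_of_real (of_int (- h))"
  have "(cmod ?D)\<^sup>2 = (of_int k * Re z - of_int h)\<^sup>2 + (of_int k * T)\<^sup>2"
    by (simp add: cmod_power2 T_def)
  also have "(of_int k * Re z - of_int h)\<^sup>2 \<le> (1 / N)\<^sup>2"
    using hk(4) by (metis abs_ge_zero less_imp_le power2_abs power_mono)
  also have "(1 / real N)\<^sup>2 \<le> T"
  proof -
    have "1 / real N \<le> sqrt T" using N(1) sT N0 by (simp add: field_simps)
    then have "(1 / real N)\<^sup>2 \<le> (sqrt T)\<^sup>2" by (intro power_mono) auto
    then show ?thesis using T by simp
  qed
  also have "(real_of_int k * T)\<^sup>2 \<le> 4 * T"
  proof -
    have "real_of_int k \<le> 2 / sqrt T" using hk(3) N(2) by linarith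
    then have "real_of_int k * T \<le> 2 / sqrt T * T" using T by (intro mult_right_mono) auto
    also have "2 / sqrt T * T = 2 * sqrt T" using sT(1) by (simp add: field_simps sT(3))
    finally have "(real_of_int k * T)\<^sup>2 \<le> (2 * sqrt T)\<^sup>2" using hk(2) T by (intro power_mono) auto
    then show ?thesis using T by (simp add: power_mult_distrib)
  qed
  finally have D: "(cmod ?D)\<^sup>2 \<le> 5 * T" by simp
  have dr: "real_of_int (- u) * of_int (- h) - of_int (- v) * of_int k = 1"
    by (rule det_of_int[OF det1])
  have nz: "?D \<noteq> 0" by (rule Im_moebius_complex(2)[OF dr z])
  have "1 / 5 \<le> T / (cmod ?D)\<^sup>2" using D nz T by (simp add: field_simps)
  then have "Im (hmob (of_int (- u)) (of_int (- v)) (of_int k) (of_int (- h)) z) \<ge> 1 / 5"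
    unfolding Im_moebius_complex(1)[OF dr z] T_def .
  then show ?thesis by (rule that[OF det1])
qed

text \<open>
  If \<open>L\<close> is close to the quasisymmetric map \<open>H\<close> on the fans, then it distorts the cross-ratio of \<open>H\<close> only a
  little on all quadruples \<open>a < b < c\<close>, infinity with a bounded quotient of distances. The base point of the
  quadruple is moved up by PSL(2,Z). If it ends up very high, integers form a sufficiently fine grid on its
  scale; otherwise its height lies in a bounded range and a fixed level of the Stern-Brocot grid is fine enough.
\<close>

theorem fan_close_distorts_little:
  assumes M: "M \<ge> 1" and \<kappa>: "\<kappa> > 1" and K0: "K\<^sub>0 \<ge> 1"
  obtains \<epsilon> where "\<epsilon> > 1"
    "\<And>H L a b c. \<lbrakk>line_qs M H; surj H; strict_mono L; surj L; fan_close \<epsilon> (lift H) (lift L); a < b; b < c;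
       c - b \<le> K\<^sub>0 * (b - a); b - a \<le> K\<^sub>0 * (c - b)\<rbrakk> \<Longrightarrow>
      good \<kappa> (lift H) (lift L) (Some c) (Some b) (Some a) None"
proof -
  obtain M' where M': "M' \<ge> 1"
    "\<And>H A g K. \<lbrakk>line_qs M H; A \<in> PSL2R; g \<in> PSL2R; A \<circ> lift H \<circ> g = lift K; strict_mono K\<rbrakk>
      \<Longrightarrow> line_qs M' K" using line_qs_quasi_moebius[OF M] by blast
  obtain \<eta> where \<eta>: "\<eta> > 1" "\<eta> ^ 4 \<le> \<kappa>" using root_bound[OF \<kappa>] by blast
  define \<sigma> where "\<sigma> = 1 / (2 * (K\<^sub>0 + 1))"
  have \<sigma>: "0 < \<sigma>" "\<sigma> \<le> 1" using K0 by (auto simp: \<sigma>_def field_simps)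
  obtain R c K where RcK: "R > 0" "c > 0" "K > 1"
    "\<And>H L z \<phi> N \<rho> P. \<lbrakk>line_qs M' H; strict_mono L; Im z > 0; \<rho> > 0; N > 0;
      \<phi> 0 \<le> Re z - R * Im z; Re z + R * Im z \<le> \<phi> N;
      \<And>i. i < N \<Longrightarrow> \<phi> i < \<phi> (Suc i) \<and> \<phi> (Suc i) \<le> \<phi> i + c * Im z;
      \<And>i. i < N \<Longrightarrow> near_ratio K \<rho> (H (\<phi> (Suc i)) - H (\<phi> i)) (L (\<phi> (Suc i)) - L (\<phi> i));
      \<And>p q. p \<in> P \<Longrightarrow> q \<in> P \<Longrightarrow> p \<noteq> q \<Longrightarrow> sep \<sigma> z p q\<rbrakk>
      \<Longrightarrow> \<exists>\<mu>. coherent \<eta> (lift H) (lift L) \<mu> P"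
    using coherent_from_grid[OF M'(1) \<sigma> \<eta>(1)] by metis
  obtain N1 where N1: "4 * R / c + 2 < real N1" using reals_Archimedean2 by blast
  obtain n where n: "5 / c < real n" using reals_Archimedean2 by blast
  obtain L2 where L2: "2 * R / c + 1 < real L2" using reals_Archimedean2 by blast
  define N2 where "N2 = 2 ^ n * L2"
  obtain \<epsilon> where \<epsilon>: "\<epsilon> > 1" "\<epsilon> ^ (N1 + 4 * 2 ^ n * N2) \<le> K" using root_bound[OF RcK(3)] by blast
  have grid_coherent: "\<exists>\<mu>. coherent \<eta> (lift H) (lift L) \<mu> P"
    if H: "line_qs M' H" and L: "strict_mono L" and z: "Im z > 0" and N: "N > 0"
      and ends: "\<phi> 0 \<le> Re z - R * Im z" "Re z + R * Im z \<le> \<phi> N"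
      and mesh: "\<And>i. \<phi> i < \<phi> (Suc i)" "\<And>i. \<phi> (Suc i) \<le> \<phi> i + c * Im z"
      and sim: "\<And>i. sim (\<epsilon> ^ m) (H (\<phi> (Suc i)) - H (\<phi> i)) (L (\<phi> (Suc i)) - L (\<phi> i))
         (H (\<phi> (Suc (Suc i))) - H (\<phi> (Suc i))) (L (\<phi> (Suc (Suc i))) - L (\<phi> (Suc i)))"
      and m: "m * N \<le> N1 + 4 * 2 ^ n * N2"
      and sep: "\<And>p q. p \<in> P \<Longrightarrow> q \<in> P \<Longrightarrow> p \<noteq> q \<Longrightarrow> sep \<sigma> z p q"
    for H L z \<phi> N m P
  proof -
    let ?h = "\<lambda>i. H (\<phi> (Suc i)) - H (\<phi> i)" and ?l = "\<lambda>i. L (\<phi> (Suc i)) - L (\<phi> i)"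
    have pos: "?h i > 0" "?l i > 0" for i
      using H L mesh(1)[of i] by (auto simp: line_qs_def strict_mono_less)
    have "near_ratio K (?h 0 / ?l 0) (?h i) (?l i)" if "i < N" for i
    proof -
      have "near_ratio ((\<epsilon> ^ m) ^ N) (?h 0 / ?l 0) (?h i) (?l i)"
        using near_ratio_chain[of N ?h ?l "\<epsilon> ^ m" i] pos \<epsilon> sim that by (simp add: one_le_power)
      moreover have "(\<epsilon> ^ m) ^ N \<le> K"
      proof -
        have "(\<epsilon> ^ m) ^ N \<le> \<epsilon> ^ (N1 + 4 * 2 ^ n * N2)"
          unfolding power_mult[symmetric] using m \<epsilon>(1) by (intro power_increasing) auto
        then show ?thesis using \<epsilon>(2) by simp
      qed
      ultimately show ?thesis
        by (rule near_ratio_mono) (use pos[of 0] pos[of i] in auto)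
    qed
    then show ?thesis using mesh sep ends pos[of 0]
      by (intro RcK(4)[OF H L z _ N, of "?h 0 / ?l 0" \<phi>]) auto
  qed
  show ?thesis
  proof (rule that[OF \<epsilon>(1)])
    fix H L a b c'
    assume H: "line_qs M H" "surj H" and L: "strict_mono L" "surj L"
      and close: "fan_close \<epsilon> (lift H) (lift L)"
      and abc: "a < b" "b < c'" "c' - b \<le> K\<^sub>0 * (b - a)" "b - a \<le> K\<^sub>0 * (c' - b)"
    have Hm: "strict_mono H" using H by (simp add: line_qs_def)
    let ?Q = "quadruple a b c'" and ?z = "Complex b (b - a)"
    have z0: "Im ?z > 0" using abc by simp
    obtain \<alpha> \<beta> \<gamma> \<delta> :: int where det: "\<alpha> * \<delta> - \<beta> * \<gamma> = 1"
      and high: "Im (hmob (of_int \<alpha>) (of_int \<beta>) (of_int \<gamma>) (of_int \<delta>) ?z) \<ge> 1 / 5"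
      by (rule modular_reduction[OF z0])
    define f where "f = imob \<alpha> \<beta> \<gamma> \<delta>"
    define g where "g = imob \<delta> (- \<beta>) (- \<gamma>) \<alpha>"
    define z where "z = hmob (of_int \<alpha>) (of_int \<beta>) (of_int \<gamma>) (of_int \<delta>) ?z"
    have det': "\<delta> * \<alpha> - (- \<beta>) * (- \<gamma>) = 1" using det by (simp add: mult.commute)
    have gf: "g (f p) = p" for p
      using fun_cong[OF mob_inverse(1)[OF det_of_int[OF det]], of p] unfolding f_def g_def imob_def by simp
    have gP: "g \<in> PSL2R" unfolding g_def imob_def by (intro mob_in_PSL2R det_of_int[OF det'])
    have Imz: "Im z \<ge> 1 / 5" "Im z > 0" using high by (auto simp: z_def)
    have sep: "sep \<sigma> z p q" if "p \<in> f ` ?Q" "q \<in> f ` ?Q" "p \<noteq> q" for p q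
    proof -
      from that obtain p' q' where pq: "p = f p'" "q = f q'" "p' \<in> ?Q" "q' \<in> ?Q" by blast
      then have "sep \<sigma> ?z p' q'" unfolding \<sigma>_def using that(3)
        by (intro sep_quadruple[OF abc(1,2) K0 abc(3,4)]) auto
      then show ?thesis unfolding pq f_def z_def imob_def by (simp only: sep_mob[OF det_of_int[OF det] z0])
    qed
    obtain A h where A: "A \<in> PSL2R" "A \<circ> lift H \<circ> g = lift h" "strict_mono h"
      using chart_exists[OF cyc_bij_lift[OF Hm H(2)] gP] by metis
    obtain B l where B: "B \<in> PSL2R" "B \<circ> lift L \<circ> g = lift l" "strict_mono l"
      using chart_exists[OF cyc_bij_lift[OF L] gP] by metis
    have h: "line_qs M' h" by (rule M'(2)[OF H(1) A(1) gP A(2,3)])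
    have close': "fan_close \<epsilon> (lift h) (lift l)"
      by (rule fan_close_charts[OF close det' g_def A(1) B(1) A(2) B(2)])
    define base where "base = \<lfloor>Re z - R * Im z\<rfloor>"
    have base: "of_int base \<le> Re z - R * Im z" "Re z - R * Im z - 1 \<le> of_int base"
      unfolding base_def by linarith+
    have "\<exists>\<mu>. coherent \<eta> (lift h) (lift l) \<mu> (f ` ?Q)"
    proof (cases "c * Im z \<ge> 1")
      case True
      \<comment> \<open>A grid of integers; the mesh \<open>\<tau>\<close> is comparable with \<open>c * Im z\<close>, so that the number of cells is bounded.\<close>
      define \<tau> where "\<tau> = nat \<lfloor>c * Im z\<rfloor>"
      have \<tau>: "real \<tau> \<le> c * Im z" "c * Im z / 2 \<le> real \<tau>" "\<tau> > 0"
      proof -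
        have fl: "\<lfloor>c * Im z\<rfloor> \<ge> 1" using True by simp
        then have eq: "real \<tau> = of_int \<lfloor>c * Im z\<rfloor>" unfolding \<tau>_def by (intro of_nat_nat) linarith
        have "real_of_int \<lfloor>c * Im z\<rfloor> \<ge> 1" using fl by linarith
        then show "real \<tau> \<le> c * Im z" "c * Im z / 2 \<le> real \<tau>" unfolding eq by linarith+
        show "\<tau> > 0" unfolding \<tau>_def using fl by simp
      qed
      let ?\<phi> = "\<lambda>i::nat. of_int base + real i * real \<tau>"
      have end': "Re z + R * Im z \<le> ?\<phi> N1"
      proof -
        have "2 * R * Im z + 1 \<le> (4 * R / c + 2) * (c * Im z / 2)"
          using RcK True by (simp add: field_simps)
        also have "\<dots> \<le> real N1 * real \<tau>" using N1 \<tau>(2) RcK Imz by (intro mult_mono) auto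
        finally show ?thesis using base by linarith
      qed
      have "N1 > 0" using N1 RcK by (metis add_pos_pos divide_pos_pos gr0I less_asym mult_pos_pos of_nat_0 zero_less_numeral)
      show ?thesis
      proof (rule grid_coherent[where \<phi> = ?\<phi> and N = N1 and m = 1, OF h B(3) Imz(2) \<open>N1 > 0\<close> _ end'])
        show "sim (\<epsilon> ^ 1) (h (?\<phi> (Suc i)) - h (?\<phi> i)) (l (?\<phi> (Suc i)) - l (?\<phi> i))
          (h (?\<phi> (Suc (Suc i))) - h (?\<phi> (Suc i))) (l (?\<phi> (Suc (Suc i))) - l (?\<phi> (Suc i)))" for i
          using fan_close_integers[OF close' A(3) B(3) \<tau>(3), of "base + int (Suc i) * int \<tau>"]
          by (subst sim_commute) (simp add: algebra_simps)
      qed (use \<tau> base sep in \<open>auto simp: algebra_simps\<close>)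
    next
      case False
      \<comment> \<open>The height is at least 1/5 and below \<open>1 / c\<close>: level \<open>n\<close> has a small mesh, and \<open>N2\<close> cells suffice.\<close>
      let ?\<phi> = "\<lambda>i::nat. sb n (2 ^ n * base + int i)"
      have i1: "?\<phi> (Suc i) = sb n ((2 ^ n * base + int i) + 1)" for i by (simp add: algebra_simps)
      have i2: "?\<phi> (Suc (Suc i)) = sb n ((2 ^ n * base + int i) + 2)" for i by (simp add: algebra_simps)
      have "2 ^ n * base + int N2 = 2 ^ n * (base + int L2)" by (simp add: N2_def algebra_simps)
      then have "?\<phi> N2 = of_int (base + int L2)" by (simp only: sb_power)
      moreover have "2 * R * Im z + 1 \<le> real L2"
      proof -
        have "Im z \<le> 1 / c" using False RcK by (simp add: field_simps)
        then have "2 * R * Im z \<le> 2 * R * (1 / c)" using RcK by (intro mult_left_mono) auto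
        then show ?thesis using L2 by simp
      qed
      ultimately have end': "Re z + R * Im z \<le> ?\<phi> N2" using base by simp
      have "L2 > 0" using L2 RcK by (metis add_pos_pos divide_pos_pos gr0I less_asym mult_pos_pos of_nat_0 zero_less_numeral zero_less_one)
      then have N20: "N2 > 0" by (simp add: N2_def)
      have mesh: "1 / (real n + 1) \<le> c * Im z"
      proof -
        have "5 < c * (real n + 1)" using n RcK by (simp add: field_simps)
        then have "1 / (real n + 1) \<le> c * (1 / 5)" by (simp add: field_simps)
        also have "\<dots> \<le> c * Im z" using Imz RcK by (intro mult_left_mono) auto
        finally show ?thesis .
      qed
      show ?thesis
      proof (rule grid_coherent[where \<phi> = ?\<phi> and N = N2 and m = "4 * 2 ^ n", OF h B(3) Imz(2) N20 _ end'])
        show "?\<phi> 0 \<le> Re z - R * Im z" using base by (simp add: sb_power)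
        show "?\<phi> i < ?\<phi> (Suc i)" for i unfolding i1 by (rule sb_less)
        show "?\<phi> (Suc i) \<le> ?\<phi> i + c * Im z" for i
          unfolding i1 using sb_mesh[of n "2 ^ n * base + int i"] mesh by linarith
        show "sim (\<epsilon> ^ (4 * 2 ^ n)) (h (?\<phi> (Suc i)) - h (?\<phi> i)) (l (?\<phi> (Suc i)) - l (?\<phi> i))
          (h (?\<phi> (Suc (Suc i))) - h (?\<phi> (Suc i))) (l (?\<phi> (Suc (Suc i))) - l (?\<phi> (Suc i)))" for i
          unfolding i2 unfolding i1 using \<epsilon> by (intro fan_close_sb_grid[OF A(3) B(3) _ close']) auto
      qed (use sep in auto)
    qed
    then obtain \<mu> where \<mu>: "coherent \<eta> (lift h) (lift l) \<mu> (f ` ?Q)" by blast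
    have inj: "inj (lift h)" "inj (lift l)" 
      using A(3) B(3) by (auto simp: lift_def strict_mono_imp_inj_on intro!: option.inj_map)
    have injf: "f p = f q \<longleftrightarrow> p = q" for p q using gf by metis
    have "good (\<eta> ^ 4) (lift h) (lift l) (f (Some c')) (f (Some b)) (f (Some a)) (f None)"
      using \<eta> abc by (intro coherent_imp_good[OF \<mu> _ inj]) (auto simp: quadruple_def injf)
    then have g4: "good (\<eta> ^ 4) (lift H) (lift L) (Some c') (Some b) (Some a) None"
      unfolding good_charts[OF A(1) B(1) A(2) B(2)] gf .
    show "good \<kappa> (lift H) (lift L) (Some c') (Some b) (Some a) None"
      by (rule good_mono[OF g4 \<eta>(2)])
  qed
qed

section \<open>The Farey tesselation and the modular group\<close>

text \<open>
  The action of PGL(2,Z) on the extended line.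
\<close>

definition unimodular :: "(rhat \<Rightarrow> rhat) set" where
  "unimodular = {imob a b c d | a b c d. \<bar>a * d - b * c\<bar> = 1}"

lemma imob_minus: "imob (-a) (-b) (-c) (-d) = imob a b c d"
proof
  show "imob (-a) (-b) (-c) (-d) p = imob a b c d p" for p
  proof (cases p)
    case (Some x)
    have e: "of_int (- c) * x + of_int (- d) = - (of_int c * x + of_int d)"
      "of_int (- a) * x + of_int (- b) = - (of_int a * x + of_int b)"
      by simp_all
    show ?thesis unfolding Some imob_def mob.simps moebius_def e
      by (simp only: minus_divide_divide neg_equal_0_iff_equal)
  qed (simp add: imob_def)
qed

lemma unimodularI: "\<bar>a * d - b * c\<bar> = 1 \<Longrightarrow> imob a b c d \<in> unimodular"
  unfolding unimodular_def by blast

lemma det_nonzero_of_int: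
  "\<bar>a * d - b * c\<bar> = (1::int) \<Longrightarrow> real_of_int a * of_int d - of_int b * of_int c \<noteq> 0"
  by (metis abs_0 of_int_0_eq_iff of_int_diff of_int_mult zero_neq_one)

lemma imob_comp:
  assumes "\<bar>a * d - b * c\<bar> = 1" "\<bar>a' * d' - b' * c'\<bar> = 1"
  shows "imob a b c d \<circ> imob a' b' c' d' = imob (a * a' + b * c') (a * b' + b * d') (c * a' + d * c') (c * b' + d * d')"
    "\<bar>(a * a' + b * c') * (c * b' + d * d') - (a * b' + b * d') * (c * a' + d * c')\<bar> = 1"
proof -
  show "imob a b c d \<circ> imob a' b' c' d' = imob (a * a' + b * c') (a * b' + b * d') (c * a' + d * c') (c * b' + d * d')"
    unfolding imob_def using det_nonzero_of_int assms by (simp add: mob_comp)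
  have "(a * a' + b * c') * (c * b' + d * d') - (a * b' + b * d') * (c * a' + d * c')
      = (a * d - b * c) * (a' * d' - b' * c')"
    by (simp add: algebra_simps)
  then show "\<bar>(a * a' + b * c') * (c * b' + d * d') - (a * b' + b * d') * (c * a' + d * c')\<bar> = 1"
    using assms by (simp add: abs_mult)
qed

lemma unimodular_comp: "f \<in> unimodular \<Longrightarrow> g \<in> unimodular \<Longrightarrow> f \<circ> g \<in> unimodular"
proof -
  assume "f \<in> unimodular" "g \<in> unimodular"
  then obtain a b c d a' b' c' d' where "\<bar>a * d - b * c\<bar> = 1" "f = imob a b c d"
    "\<bar>a' * d' - b' * c'\<bar> = 1" "g = imob a' b' c' d'"
    unfolding unimodular_def by blast
  then show ?thesis using imob_comp[of a d b c a' d' b' c'] unimodularI by simp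
qed

lemma refl_line_0: "refl_line 0 = imob (-1) 0 0 1"
proof
  show "refl_line 0 p = imob (-1) 0 0 1 p" for p by (cases p) (simp_all add: imob_def moebius_def)
qed

lemma refl_line_1: "refl_line 1 = imob (-1) 2 0 1"
proof
  show "refl_line 1 p = imob (-1) 2 0 1 p" for p by (cases p) (simp_all add: imob_def moebius_def)
qed

lemma refl_circle_half: "refl_circle (1/2) (1/2) = imob 1 0 2 (-1)"
proof
  show "refl_circle (1/2) (1/2) p = imob 1 0 2 (-1) p" for p
  proof (cases p)
    case (Some x)
    then show ?thesis by (cases "x = 1 / 2") (auto simp: imob_def moebius_def field_simps power2_eq_square)
  qed (simp add: imob_def)
qed

lemmas refl_imob = refl_line_0 refl_line_1 refl_circle_half

lemma imob_id: "imob 1 0 0 1 = id"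
  by (simp add: imob_def mob_one)

lemma farey_group_unimodular: "g \<in> farey_group \<Longrightarrow> g \<in> unimodular"
proof (induction rule: farey_group.induct)
  case farey_group_id
  show ?case unfolding imob_id[symmetric] by (rule unimodularI) simp
qed (unfold refl_imob, (rule unimodular_comp[OF unimodularI], simp, assumption)+)

text \<open>
  Symmetries of the Farey tesselation. The reflection group has finite index in PGL(2,Z); that the bigger group
  preserves the tesselation follows from the fact that its remaining generators permute the sides
  of the basic triangle and normalise the reflection group.
\<close>

definition preserves_farey :: "(rhat \<Rightarrow> rhat) \<Rightarrow> bool" where
  "preserves_farey g \<longleftrightarrow> (\<forall>T\<in>farey_triangles. g ` T \<in> farey_triangles) \<and> (\<forall>e\<in>farey_edges. g ` e \<in> farey_edges)"

lemma preserves_farey_comp: "preserves_farey f \<Longrightarrow> preserves_farey g \<Longrightarrow> preserves_farey (f \<circ> g)"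
  unfolding preserves_farey_def by (metis image_comp)

text \<open>
  The sides of the triangle with vertices 0, 1 and infinity.
\<close>

abbreviation farey_sides :: "rhat set set" where
  "farey_sides \<equiv> {{Some 0, Some 1}, {Some 1, None}, {Some 0, None}}"

lemma preserves_farey_normaliser:
  assumes gen: "\<And>r. r \<in> {refl_line 0, refl_line 1, refl_circle (1/2) (1/2)} \<Longrightarrow>
      \<exists>r'\<in>{refl_line 0, refl_line 1, refl_circle (1/2) (1/2)}. f \<circ> r = r' \<circ> f"
    and T: "f ` {Some 0, Some 1, None} = {Some 0, Some 1, None}"
    and e: "\<And>e. e \<in> farey_sides \<Longrightarrow> f ` e \<in> farey_sides"
  shows "preserves_farey f"
proof -
  have step: "\<exists>g'\<in>farey_group. f \<circ> (r \<circ> g) = g' \<circ> f"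
    if r: "r \<in> {refl_line 0, refl_line 1, refl_circle (1/2) (1/2)}" and g: "\<exists>g'\<in>farey_group. f \<circ> g = g' \<circ> f" for r g
  proof -
    obtain g' where g': "g' \<in> farey_group" "f \<circ> g = g' \<circ> f" using g by blast
    obtain r' where r': "r' \<in> {refl_line 0, refl_line 1, refl_circle (1/2) (1/2)}" "f \<circ> r = r' \<circ> f"
      using gen[OF r] by blast
    have "f \<circ> (r \<circ> g) = (r' \<circ> g') \<circ> f" using g'(2) r'(2) by (metis comp_assoc)
    moreover have "r' \<circ> g' \<in> farey_group" using r'(1) g'(1) by (auto intro: farey_group.intros)
    ultimately show ?thesis by blast
  qed
  have conj: "\<exists>g'\<in>farey_group. f \<circ> g = g' \<circ> f" if "g \<in> farey_group" for g
    using that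
  proof (induction rule: farey_group.induct)
    case farey_group_id show ?case by (rule bexI[OF _ farey_group.farey_group_id]) simp
  qed (rule step, simp, assumption)+
  show ?thesis
    unfolding preserves_farey_def
  proof (intro conjI ballI)
    fix S assume "S \<in> farey_triangles"
    then obtain g where g: "g \<in> farey_group" "S = g ` {Some 0, Some 1, None}" unfolding farey_triangles_def by blast
    obtain g' where g': "g' \<in> farey_group" "f \<circ> g = g' \<circ> f" using conj g by blast
    have "f ` S = g' ` {Some 0, Some 1, None}" unfolding g image_comp g' by (simp only: image_comp[symmetric] T)
    then show "f ` S \<in> farey_triangles" unfolding farey_triangles_def using g' by blast
  next
    fix S assume "S \<in> farey_edges"
    then obtain g s where g: "g \<in> farey_group" "S = g ` s" "s \<in> farey_sides" unfolding farey_edges_def by blast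
    obtain g' where g': "g' \<in> farey_group" "f \<circ> g = g' \<circ> f" using conj g by blast
    have "f ` S = g' ` (f ` s)" unfolding g image_comp g' ..
    then show "f ` S \<in> farey_edges" unfolding farey_edges_def using g' e[OF g(3)] by blast
  qed
qed

lemma preserves_farey_swap: "preserves_farey (imob (-1) 1 0 1)" (is "preserves_farey ?f")
proof (rule preserves_farey_normaliser)
  have "?f \<circ> imob (-1) 0 0 1 = imob (-1) 2 0 1 \<circ> ?f" "?f \<circ> imob (-1) 2 0 1 = imob (-1) 0 0 1 \<circ> ?f"
    "?f \<circ> imob 1 0 2 (-1) = imob 1 0 2 (-1) \<circ> ?f"
    using imob_minus[of 1 "-1" 2 "-1"] by (simp_all add: imob_comp)
  then show "\<exists>r'\<in>{refl_line 0, refl_line 1, refl_circle (1/2) (1/2)}. ?f \<circ> r = r' \<circ> ?f"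
    if "r \<in> {refl_line 0, refl_line 1, refl_circle (1/2) (1/2)}" for r
    using that unfolding refl_imob by blast
qed (auto simp: imob_def moebius_def)

lemma preserves_farey_inversion: "preserves_farey (imob 0 1 1 0)" (is "preserves_farey ?f")
proof (rule preserves_farey_normaliser)
  have "?f \<circ> imob (-1) 0 0 1 = imob (-1) 0 0 1 \<circ> ?f" "?f \<circ> imob (-1) 2 0 1 = imob 1 0 2 (-1) \<circ> ?f"
    "?f \<circ> imob 1 0 2 (-1) = imob (-1) 2 0 1 \<circ> ?f"
    using imob_minus[of 0 1 "-1" 0] by (simp_all add: imob_comp)
  then show "\<exists>r'\<in>{refl_line 0, refl_line 1, refl_circle (1/2) (1/2)}. ?f \<circ> r = r' \<circ> ?f"
    if "r \<in> {refl_line 0, refl_line 1, refl_circle (1/2) (1/2)}" for r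
    using that unfolding refl_imob by blast
qed (auto simp: imob_def moebius_def)

lemma preserves_farey_negation: "preserves_farey (imob (-1) 0 0 1)"
  unfolding preserves_farey_def
proof (intro conjI ballI)
  fix S assume "S \<in> farey_triangles"
  then obtain g where g: "g \<in> farey_group" "S = g ` {Some 0, Some 1, None}" unfolding farey_triangles_def by blast
  then show "imob (-1) 0 0 1 ` S \<in> farey_triangles" 
    unfolding farey_triangles_def refl_line_0[symmetric] g(2) image_comp using farey_group_line0 by blast
next
  fix S assume "S \<in> farey_edges"
  then obtain g s where g: "g \<in> farey_group" "S = g ` s" "s \<in> farey_sides" unfolding farey_edges_def by blast
  then show "imob (-1) 0 0 1 ` S \<in> farey_edges"
    unfolding farey_edges_def refl_line_0[symmetric] g(2) image_comp using farey_group_line0 by blast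
qed

lemma preserves_farey_translation: "preserves_farey (imob 1 n 0 1)"
proof -
  have p: "preserves_farey (imob 1 (int n) 0 1)" for n
  proof (induction n)
    case 0
    then show ?case by (simp add: imob_id preserves_farey_def)
  next
    case (Suc n)
    have "imob (-1) 1 0 1 \<circ> (imob (-1) 0 0 1 \<circ> imob 1 (int n) 0 1) = imob 1 (int (Suc n)) 0 1"
      by (simp add: imob_comp add.commute)
    then show ?case using Suc preserves_farey_comp preserves_farey_swap preserves_farey_negation by metis
  qed
  show ?thesis
  proof (cases "n \<ge> 0")
    case True
    then show ?thesis using p[of "nat n"] by simp
  next
    case False
    have "imob (-1) 0 0 1 \<circ> (imob 1 (int (nat (- n))) 0 1 \<circ> imob (-1) 0 0 1) = imob 1 n 0 1"
      using False by (simp add: imob_comp)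
    then show ?thesis using p preserves_farey_comp preserves_farey_negation by metis
  qed
qed

text \<open>
  The Euclidean algorithm on the first column writes a unimodular matrix as a product of translations, the
  inversion \<open>1 / x\<close> and, at the end, upper triangular matrices.
\<close>

lemma preserves_farey_imob:
  "\<bar>a * d - b * c\<bar> = 1 \<Longrightarrow> preserves_farey (imob a b c d)"
proof (induction "nat \<bar>c\<bar>" arbitrary: a b c d rule: less_induct)
  case less
  show ?case
  proof (cases "c = 0")
    case True
    then have "\<bar>a\<bar> * \<bar>d\<bar> = 1" using less.prems by (simp add: abs_mult)
    then have ad: "\<bar>a\<bar> = 1" "\<bar>d\<bar> = 1" by (auto simp: zmult_eq_1_iff)
    consider "d = 1" "a = 1" | "d = 1" "a = -1" | "d = -1" "a = -1" | "d = -1" "a = 1" using ad by linarith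
    then show ?thesis
    proof cases
      case 1
      then show ?thesis using True preserves_farey_translation by simp
    next
      case 2
      have "imob 1 b 0 1 \<circ> imob (-1) 0 0 1 = imob a b c d" using 2 True by (simp add: imob_comp)
      then show ?thesis using preserves_farey_translation preserves_farey_negation preserves_farey_comp by metis
    next
      case 3
      then show ?thesis using True preserves_farey_translation[of "- b"] imob_minus[of a b c d] by simp
    next
      case 4
      have "imob 1 (-b) 0 1 \<circ> imob (-1) 0 0 1 = imob a b c d" using 4 True imob_minus[of a b c d] by (simp add: imob_comp)
      then show ?thesis using preserves_farey_translation preserves_farey_negation preserves_farey_comp by metis
    qed
  next
    case False
    define k where "k = a div c"
    define a' where "a' = a mod c"
    define b' where "b' = b - k * d"
    have a: "a = a' + k * c" unfolding a'_def k_def by simp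
    have "\<bar>a'\<bar> < \<bar>c\<bar>" unfolding a'_def using False by (rule abs_mod_less)
    then have lt: "nat \<bar>a'\<bar> < nat \<bar>c\<bar>" by simp
    have "a' * d - b' * c = a * d - b * c" unfolding a b'_def by (simp add: algebra_simps)
    then have det: "\<bar>c * b' - d * a'\<bar> = 1" "\<bar>a' * d - b' * c\<bar> = 1" using less.prems by (simp_all add: algebra_simps abs_minus_commute)
    have "imob 1 k 0 1 \<circ> (imob 0 1 1 0 \<circ> imob c d a' b') = imob 1 k 0 1 \<circ> imob a' b' c d"
      using det by (simp add: imob_comp(1))
    also have "\<dots> = imob a b c d" using det by (simp add: imob_comp a b'_def)
    finally show ?thesis using less.hyps[OF lt det(1)] preserves_farey_comp
        preserves_farey_translation preserves_farey_inversion by metis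
  qed
qed

lemma imob_inverse:
  assumes "a * d - b * c = 1"
  shows "imob d (-b) (-c) a \<circ> imob a b c d = id" "imob a b c d \<circ> imob d (-b) (-c) a = id"
  using mob_inverse[OF det_of_int[OF assms]] by (simp_all add: imob_def)

text \<open>
  Farey neighbours: the pairs in the orbit of infinity and 0 under PGL(2,Z), which are the edges of the
  tesselation.
\<close>

definition farey_nb :: "rhat \<Rightarrow> rhat \<Rightarrow> bool" where
  "farey_nb p q \<longleftrightarrow> (\<exists>g\<in>unimodular. p = g None \<and> q = g (Some 0))"

lemma farey_nb_sym: "farey_nb p q \<Longrightarrow> farey_nb q p"
proof -
  assume "farey_nb p q"
  then obtain g where g: "g \<in> unimodular" "p = g None" "q = g (Some 0)" by (auto simp: farey_nb_def)
  have "g \<circ> imob 0 1 1 0 \<in> unimodular" by (intro unimodular_comp g unimodularI) simp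
  then show ?thesis unfolding farey_nb_def using g by (intro bexI[of _ "g \<circ> imob 0 1 1 0"]) (auto simp: imob_def)
qed

lemma farey_nb_image: "g \<in> unimodular \<Longrightarrow> farey_nb p q \<Longrightarrow> farey_nb (g p) (g q)"
  unfolding farey_nb_def using unimodular_comp by (metis comp_apply)

lemma farey_nb_infinity: "farey_nb None (Some x) \<Longrightarrow> \<exists>n::int. x = of_int n"
proof -
  assume "farey_nb None (Some x)"
  then obtain a b c d where det: "\<bar>a * d - b * c\<bar> = 1" and g: "imob a b c d None = None" "imob a b c d (Some 0) = Some x"
    by (auto simp: farey_nb_def unimodular_def)
  have c: "c = 0" using g(1) by (auto simp: imob_def split: if_splits)
  then have "\<bar>a\<bar> * \<bar>d\<bar> = 1" using det by (simp add: abs_mult)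
  then have "\<bar>d\<bar> = 1" by (auto simp: zmult_eq_1_iff)
  then have "d = 1 \<or> d = -1" by linarith
  moreover have "x = of_int b / of_int d" using g(2) c by (auto simp: imob_def moebius_def split: if_splits)
  ultimately have "x = of_int b \<or> x = of_int (- b)" by auto
  then show ?thesis by blast
qed

lemma farey_nb_integers: "farey_nb (Some (of_int n)) (Some (of_int m)) \<Longrightarrow> \<bar>n - m\<bar> = 1"
proof -
  assume "farey_nb (Some (of_int n)) (Some (of_int m))"
  then obtain a b c d where det: "\<bar>a * d - b * c\<bar> = 1" and g: "imob a b c d None = Some (of_int n)" "imob a b c d (Some 0) = Some (of_int m)"
    by (auto simp: farey_nb_def unimodular_def)
  have c: "c \<noteq> 0" "real_of_int n = of_int a / of_int c" using g(1) by (auto simp: imob_def split: if_splits)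
  have d: "d \<noteq> 0" "real_of_int m = of_int b / of_int d" using g(2) by (auto simp: imob_def moebius_def split: if_splits)
  have "a = n * c" "b = m * d" using c d by (simp_all add: field_simps flip: of_int_mult)
  then have "\<bar>n - m\<bar> * \<bar>c * d\<bar> = 1" using det by (simp add: algebra_simps flip: abs_mult)
  then show ?thesis by (auto simp: zmult_eq_1_iff)
qed

lemma farey_nb_neq: "farey_nb p q \<Longrightarrow> p \<noteq> q"
proof
  assume "farey_nb p q" "p = q"
  then obtain a b c d where det: "\<bar>a * d - b * c\<bar> = 1" and g: "imob a b c d None = imob a b c d (Some 0)"
    by (auto simp: farey_nb_def unimodular_def)
  show False
  proof (cases "c = 0")
    case True
    then have "d \<noteq> 0" using det by auto
    then show ?thesis using g True by (simp add: imob_def)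
  next
    case False
    then have "d \<noteq> 0" "real_of_int a / of_int c = of_int b / of_int d" using g
      by (auto simp: imob_def moebius_def split: if_splits)
    then have "real_of_int (a * d - b * c) = 0" using False by (simp add: field_simps)
    then have "a * d - b * c = 0" by (simp only: of_int_eq_0_iff)
    then show False using det by simp
  qed
qed

lemma farey_nb_sides: "farey_nb (Some 0) (Some 1)" "farey_nb (Some 1) None" "farey_nb (Some 0) None"
proof -
  have 1: "farey_nb None (Some 0)" unfolding farey_nb_def
    by (rule bexI[OF _ unimodularI[of 1 1 0 0]]) (auto simp: imob_def moebius_def)
  have 2: "farey_nb None (Some 1)" unfolding farey_nb_def
    by (rule bexI[OF _ unimodularI[of 1 1 1 0]]) (auto simp: imob_def moebius_def)
  show "farey_nb (Some 0) (Some 1)" unfolding farey_nb_def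
    by (rule bexI[OF _ unimodularI[of 0 1 1 1]]) (auto simp: imob_def moebius_def)
  show "farey_nb (Some 1) None" "farey_nb (Some 0) None" using 1 2 farey_nb_sym by auto
qed

lemma farey_edges_nb:
  assumes "e \<in> farey_edges"
  obtains p q where "e = {p, q}" "farey_nb p q"
proof -
  obtain g s where g: "g \<in> farey_group" "e = g ` s" "s \<in> farey_sides" using assms unfolding farey_edges_def by blast
  then obtain p q where "s = {p, q}" "farey_nb p q" using farey_nb_sides by blast
  then show ?thesis using that[of "g p" "g q"] g farey_nb_image[OF farey_group_unimodular] by auto
qed

lemma farey_triangles_nb:
  assumes "T \<in> farey_triangles"
  obtains p q r where "T = {p, q, r}" "farey_nb p q" "farey_nb q r" "farey_nb p r"
proof -
  obtain g where g: "g \<in> farey_group" "T = g ` {Some 0, Some 1, None}" using assms unfolding farey_triangles_def by blast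
  show ?thesis
    by (rule that[of "g (Some 0)" "g (Some 1)" "g None"])
       (use g farey_nb_image[OF farey_group_unimodular] farey_nb_sides in auto)
qed

lemma farey_edge_infinity_iff: "{None, p} \<in> farey_edges \<longleftrightarrow> (\<exists>n::int. p = Some (of_int n))"
proof
  assume "{None, p} \<in> farey_edges"
  then obtain q r where qr: "{None, p} = {q, r}" "farey_nb q r" by (rule farey_edges_nb)
  then have "farey_nb None p" using farey_nb_neq[OF qr(2)] farey_nb_sym by (auto simp: doubleton_eq_iff)
  then show "\<exists>n::int. p = Some (of_int n)"
    using farey_nb_infinity farey_nb_neq by (cases p) auto
next
  assume "\<exists>n::int. p = Some (of_int n)"
  then obtain n :: int where n: "p = Some (of_int n)" by blast
  have "{Some 0, None} = id ` {Some 0, None}" by simp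
  then have "{Some 0, None} \<in> farey_edges" unfolding farey_edges_def using farey_group_id by blast
  then have "imob 1 n 0 1 ` {Some 0, None} \<in> farey_edges"
    using preserves_farey_translation unfolding preserves_farey_def by blast
  then show "{None, p} \<in> farey_edges" using n by (simp add: imob_def moebius_def insert_commute)
qed

text \<open>
  The two triangles adjacent to a vertical edge.
\<close>

lemma farey_triangle_infinity_iff:
  fixes n :: int
  shows "T \<in> farey_triangles \<and> {None, Some (of_int n)} \<subseteq> T \<longleftrightarrow>
    T = {None, Some (of_int n), Some (of_int (n + 1))} \<or> T = {None, Some (of_int n), Some (of_int (n - 1))}"
proof
  assume T: "T \<in> farey_triangles \<and> {None, Some (of_int n)} \<subseteq> T"
  obtain p q r where pqr: "T = {p, q, r}" "farey_nb p q" "farey_nb q r" "farey_nb p r"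
    using T farey_triangles_nb by metis
  then have sym: "farey_nb q p" "farey_nb r q" "farey_nb r p" using farey_nb_sym by blast+
  have "\<exists>s. T = {None, Some (of_int n), s} \<and> farey_nb None s \<and> farey_nb (Some (of_int n)) s"
    using T pqr sym unfolding pqr(1) by (smt (verit) insert_commute insert_iff insert_subset option.distinct(1) singletonD)
  then obtain s where s: "T = {None, Some (of_int n), s}" "farey_nb None s" "farey_nb (Some (of_int n)) s" by blast
  then obtain m :: int where m: "s = Some (of_int m)"
    using farey_nb_infinity farey_nb_neq by (cases s) auto
  then have "\<bar>n - m\<bar> = 1" using s farey_nb_integers by blast
  then have "m = n + 1 \<or> m = n - 1" by linarith
  then show "T = {None, Some (of_int n), Some (of_int (n + 1))} \<or> T = {None, Some (of_int n), Some (of_int (n - 1))}"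
    using s m by auto
next
  have base: "{Some 0, Some 1, None} \<in> farey_triangles"
  proof -
    have "{Some 0, Some 1, None} = id ` {Some 0, Some 1, None}" by simp
    then show ?thesis unfolding farey_triangles_def using farey_group_id by blast
  qed
  have t: "{None, Some (of_int k), Some (of_int (k + 1))} \<in> farey_triangles" for k :: int
  proof -
    have "imob 1 k 0 1 ` {Some 0, Some 1, None} \<in> farey_triangles"
      using preserves_farey_translation base unfolding preserves_farey_def by blast
    then show ?thesis by (simp add: imob_def moebius_def insert_commute add.commute)
  qed
  assume "T = {None, Some (of_int n), Some (of_int (n + 1))} \<or> T = {None, Some (of_int n), Some (of_int (n - 1))}"
  then show "T \<in> farey_triangles \<and> {None, Some (of_int n)} \<subseteq> T"
    using t[of n] t[of "n - 1"] by (auto simp: insert_commute)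
qed

lemma imob_inj: "a * d - b * c = 1 \<Longrightarrow> inj (imob a b c d)"
  by (metis imob_inverse(1) inj_on_id inj_on_imageI2)

lemma farey_edges_imob_iff:
  assumes "a * d - b * c = 1"
  shows "imob a b c d ` e \<in> farey_edges \<longleftrightarrow> e \<in> farey_edges"
    and "imob a b c d ` e \<in> farey_triangles \<longleftrightarrow> e \<in> farey_triangles"
proof -
  have "d * a - (- b) * (- c) = 1" using assms by (simp add: mult.commute)
  then have p: "preserves_farey (imob a b c d)" "preserves_farey (imob d (-b) (-c) a)"
    using assms by (intro preserves_farey_imob; simp)+
  have e: "imob d (-b) (-c) a ` (imob a b c d ` e) = e"
    unfolding image_comp imob_inverse(1)[OF assms] by simp
  show "imob a b c d ` e \<in> farey_edges \<longleftrightarrow> e \<in> farey_edges"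
    "imob a b c d ` e \<in> farey_triangles \<longleftrightarrow> e \<in> farey_triangles"
    using p e unfolding preserves_farey_def by metis+
qed

text \<open>
  The fan with tip \<open>g infinity\<close> consists of the edges from there to \<open>g n\<close> for integers \<open>n\<close>.
\<close>

lemma fan_imob:
  assumes det: "a * d - b * c = 1"
  shows "fan (imob a b c d None) = range (\<lambda>n::int. imob a b c d ` {None, Some (of_int n)})"
proof -
  let ?g = "imob a b c d"
  have surj: "?g (imob d (-b) (-c) a p) = p" for p using fun_cong[OF imob_inverse(2)[OF det], of p] by simp
  show ?thesis
  proof (intro equalityI subsetI)
    fix e assume "e \<in> fan (?g None)"
    then have e: "e \<in> farey_edges" "?g None \<in> e" by (auto simp: fan_def)
    obtain p q where pq: "e = {p, q}" using e(1) by (rule farey_edges_nb)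
    then obtain q' where "e = {?g None, q'}" using e(2) by (auto simp: insert_commute)
    then have e': "e = ?g ` {None, imob d (-b) (-c) a q'}" using surj by simp
    then have "{None, imob d (-b) (-c) a q'} \<in> farey_edges" using e(1) farey_edges_imob_iff(1)[OF det] by metis
    then obtain n :: int where "imob d (-b) (-c) a q' = Some (of_int n)" by (auto simp: farey_edge_infinity_iff)
    then show "e \<in> range (\<lambda>n::int. ?g ` {None, Some (of_int n)})" using e' by auto
  next
    fix e assume "e \<in> range (\<lambda>n::int. ?g ` {None, Some (of_int n)})"
    then obtain n :: int where n: "e = ?g ` {None, Some (of_int n)}" by blast
    then have "e \<in> farey_edges" using farey_edges_imob_iff(1)[OF det] farey_edge_infinity_iff by blast
    then show "e \<in> fan (?g None)" using n by (auto simp: fan_def)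
  qed
qed

lemma qhat_iff_imob: "p \<in> qhat \<longleftrightarrow> (\<exists>a b c d. a * d - b * c = 1 \<and> p = imob a b c d None)"
proof
  assume "p \<in> qhat"
  then consider "p = None" | x where "p = Some x" "x \<in> \<rat>" by (auto simp: qhat_def)
  then show "\<exists>a b c d. a * d - b * c = 1 \<and> p = imob a b c d None"
  proof cases
    case 1
    then show ?thesis by (intro exI[of _ 1] exI[of _ 0]) (simp add: imob_def)
  next
    case 2
    then obtain a c :: int where ac: "c > 0" "coprime a c" "x = of_int a / of_int c"
      by (metis Rats_cases')
    obtain u v where "u * a + v * c = 1" using ac(2) by (metis bezout_int coprime_iff_gcd_eq_1)
    then have "a * u - (- v) * c = 1" by (simp add: mult.commute)
    moreover have "p = imob a (- v) c u None" using ac 2 by (simp add: imob_def)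
    ultimately show ?thesis by blast
  qed
next
  assume "\<exists>a b c d. a * d - b * c = 1 \<and> p = imob a b c d None"
  then obtain a c :: int where "p = None \<or> p = Some (of_int a / of_int c)"
    by (auto simp: imob_def split: if_splits)
  then show "p \<in> qhat" by (auto simp: qhat_def)
qed

section \<open>Fan ratios as cross-ratios\<close>

lemma horocycle_infinity_meets:
  assumes "t > 0"
  shows "horocycle None t u \<in> geodesic_points {None, Some y} \<longleftrightarrow> u = y"
  using assms by (auto simp: geodesic_points_def doubleton_eq_iff)

lemma Im_horocycle: "t > 0 \<Longrightarrow> Im (of_real x - 1 / Complex u t) > 0"
  by (simp add: Im_divide add_nonneg_pos)

lemma horocycle_finite_meets_vertical:
  assumes "t > 0"
  shows "horocycle (Some x) t u \<in> geodesic_points {Some x, None} \<longleftrightarrow> u = 0"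
proof -
  have "Re (1 / Complex u t) = u / (u\<^sup>2 + t\<^sup>2)" by (simp add: Re_divide)
  moreover have "u\<^sup>2 + t\<^sup>2 > 0" using assms by (simp add: add_nonneg_pos)
  ultimately show ?thesis using Im_horocycle[OF assms, of x u]
    by (auto simp: geodesic_points_def doubleton_eq_iff)
qed

lemma geodesic_points_half_circle:
  assumes "x \<noteq> y"
  shows "z \<in> geodesic_points {Some x, Some y} \<longleftrightarrow>
    Im z > 0 \<and> cmod (z - of_real ((x + y) / 2)) = \<bar>x - y\<bar> / 2"
proof -
  have lt: "z \<in> geodesic_points {Some x, Some y} \<longleftrightarrow>
    Im z > 0 \<and> cmod (z - of_real ((x + y) / 2)) = \<bar>x - y\<bar> / 2" if "x < y" for x y
  proof
    assume "z \<in> geodesic_points {Some x, Some y}"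
    then show "Im z > 0 \<and> cmod (z - of_real ((x + y) / 2)) = \<bar>x - y\<bar> / 2"
      using that by (auto simp: geodesic_points_def doubleton_eq_iff)
  next
    assume "Im z > 0 \<and> cmod (z - of_real ((x + y) / 2)) = \<bar>x - y\<bar> / 2"
    then show "z \<in> geodesic_points {Some x, Some y}"
      using that unfolding geodesic_points_def by (intro CollectI conjI disjI2 exI[of _ x] exI[of _ y]) auto
  qed
  show ?thesis
  proof (cases "x < y")
    case False
    then have "y < x" using assms by simp
    from lt[OF this] show ?thesis by (simp only: insert_commute[of "Some y"] add.commute[of y] abs_minus_commute[of y])
  qed (rule lt)
qed

lemma horocycle_finite_meets_circle:
  assumes "t > 0" "x \<noteq> y"
  shows "horocycle (Some x) t u \<in> geodesic_points {Some x, Some y} \<longleftrightarrow> u = 1 / (x - y)"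
proof -
  define w where "w = Complex u t"
  define \<delta> where "\<delta> = (x - y) / 2"
  have w: "w \<noteq> 0" using assms by (simp add: w_def complex_eq_iff)
  have \<delta>: "\<delta> \<noteq> 0" using assms by (simp add: \<delta>_def)
  have "horocycle (Some x) t u \<in> geodesic_points {Some x, Some y} \<longleftrightarrow>
     cmod (of_real x - 1 / w - of_real ((x + y) / 2)) = \<bar>x - y\<bar> / 2"
    using Im_horocycle[OF assms(1), of x u]
    unfolding geodesic_points_half_circle[OF assms(2)] by (simp add: w_def)
  also have "of_real x - 1 / w - of_real ((x + y) / 2) = (of_real \<delta> * w - 1) / w"
    using w by (simp add: \<delta>_def field_simps)
  also have "cmod ((of_real \<delta> * w - 1) / w) = \<bar>x - y\<bar> / 2 \<longleftrightarrow> cmod (of_real \<delta> * w - 1) = \<bar>\<delta>\<bar> * cmod w"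
    using w by (simp add: norm_divide \<delta>_def field_simps abs_divide)
  also have "\<dots> \<longleftrightarrow> (cmod (of_real \<delta> * w - 1))\<^sup>2 = (\<bar>\<delta>\<bar> * cmod w)\<^sup>2"
    by (subst power2_eq_iff_nonneg) auto
  also have "\<dots> \<longleftrightarrow> (\<delta> * u - 1)\<^sup>2 + (\<delta> * t)\<^sup>2 = \<delta>\<^sup>2 * (u\<^sup>2 + t\<^sup>2)"
    by (simp add: cmod_power2 power_mult_distrib w_def)
  also have "\<dots> \<longleftrightarrow> 2 * \<delta> * u = 1" by (auto simp: power2_eq_square algebra_simps)
  also have "2 * \<delta> = x - y" by (simp add: \<delta>_def)
  also have "(x - y) * u = 1 \<longleftrightarrow> u = 1 / (x - y)" using assms(2) by (simp add: nonzero_eq_divide_eq mult.commute)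
  finally show ?thesis .
qed

text \<open>
  The order of a fan by horocycles is the order of the integers \<open>n\<close>.
\<close>

lemma fan_less_imob:
  fixes m n :: int
  assumes det: "a * d - b * c = 1"
  defines "g \<equiv> imob a b c d"
  shows "fan_less (g None) (g ` {None, Some (of_int m)}) (g ` {None, Some (of_int n)}) \<longleftrightarrow> m < n"
proof -
  \<comment> \<open>The parameter at which the horocycles at the tip meet the edge with number \<open>m\<close>; it does not depend on the size \<open>t\<close> of
    the horocycle.\<close>
  define \<kappa> :: "int \<Rightarrow> real" where "\<kappa> m = (if c = 0 then of_int m + of_int b / of_int d else of_int c * (of_int c * of_int m + of_int d))"
    for m :: int
  have rdet: "real_of_int a * of_int d - of_int b * of_int c = 1" by (rule det_of_int[OF det])
  have meets: "horocycle (g None) t u \<in> geodesic_points (g ` {None, Some (of_int m)}) \<longleftrightarrow> u = \<kappa> m"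
    if t: "t > 0" for t u m
  proof (cases "c = 0")
    case True
    then have ad: "a * d = 1" using det by simp
    then have "a = d \<and> (d = 1 \<or> d = -1)" by (auto simp: zmult_eq_1_iff)
    then have "g (Some (of_int m)) = Some (\<kappa> m)" "g None = None"
      using True by (auto simp: g_def imob_def moebius_def \<kappa>_def)
    then show ?thesis using horocycle_infinity_meets[OF t] by simp
  next
    case c: False
    let ?x = "real_of_int a / of_int c"
    have gN: "g None = Some ?x" using c by (simp add: g_def imob_def)
    show ?thesis
    proof (cases "c * m + d = 0")
      case True
      then have z: "real_of_int c * of_int m + of_int d = 0" by (metis of_int_0 of_int_add of_int_mult)
      then have "g (Some (of_int m)) = None" by (simp add: g_def imob_def)
      moreover have "\<kappa> m = 0" using z c by (simp add: \<kappa>_def)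
      ultimately show ?thesis using horocycle_finite_meets_vertical[OF t, of ?x u]
        by (simp only: image_insert image_empty gN)
    next
      case False
      then have nz: "real_of_int c * of_int m + of_int d \<noteq> 0" by (metis of_int_0_eq_iff of_int_add of_int_mult)
      let ?y = "(of_int a * of_int m + of_int b) / (of_int c * of_int m + real_of_int d)"
      have gm: "g (Some (of_int m)) = Some ?y" using nz by (simp add: g_def imob_def moebius_def)
      have "?x - ?y = (of_int a * (of_int c * of_int m + of_int d) - (of_int a * of_int m + of_int b) * of_int c)
          / (of_int c * (of_int c * of_int m + of_int d))"
        using nz c by (intro diff_frac_eq) auto
      also have "of_int a * (of_int c * of_int m + of_int d) - (of_int a * of_int m + of_int b) * of_int c = (1::real)"
        using rdet by (simp add: algebra_simps)
      finally have xy: "?x - ?y = 1 / \<kappa> m" using c by (simp add: \<kappa>_def)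
      moreover have k: "\<kappa> m \<noteq> 0" using c nz by (simp add: \<kappa>_def)
      ultimately have "?x \<noteq> ?y" by auto
      moreover have "1 / (?x - ?y) = \<kappa> m" unfolding xy using k by simp
      ultimately show ?thesis using horocycle_finite_meets_circle[OF t, of ?x ?y u]
        by (simp only: image_insert image_empty gN gm simp_thms)
    qed
  qed
  have "\<kappa> m < \<kappa> n \<longleftrightarrow> m < n"
  proof (cases "c = 0")
    case False
    then have "real_of_int c * of_int c > 0" by (simp add: zero_less_mult_iff) linarith
    moreover have "\<kappa> n - \<kappa> m = (real_of_int c * of_int c) * (of_int n - of_int m)" 
      using False by (simp add: \<kappa>_def algebra_simps)
    ultimately show ?thesis by (smt (verit) of_int_less_iff zero_less_mult_iff)
  qed (simp add: \<kappa>_def)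
  moreover have "fan_less (g None) (g ` {None, Some (of_int m)}) (g ` {None, Some (of_int n)}) \<longleftrightarrow> \<kappa> m < \<kappa> n"
    unfolding fan_less_def using meets by (metis zero_less_one)
  ultimately show ?thesis by simp
qed

lemma strict_mono_surj_int:
  fixes f :: "int \<Rightarrow> int"
  assumes mono: "strict_mono f" and surj: "surj f"
  shows "f n = n + f 0"
proof -
  have step: "f (n + 1) = f n + 1" for n
  proof -
    have "f n < f (n + 1)" using mono by (simp add: strict_mono_less)
    moreover obtain k where k: "f k = f n + 1" using surj by (metis surjD)
    ultimately have "f n < f k" "f k \<le> f (n + 1)" by linarith+
    then have "n < k" "k \<le> n + 1" using strict_mono_less[OF mono] strict_mono_less_eq[OF mono] by blast+
    then have "k = n + 1" by linarith
    then show ?thesis using k by simp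
  qed
  show ?thesis
  proof (induction n rule: int_induct[where k = 0])
    case (step2 i)
    then show ?case using step[of "i - 1"] by simp
  qed (use step in auto)
qed

text \<open>
  An enumeration of a fan differs from the one by \<open>g n\<close> by a translation only.
\<close>

lemma fan_enumeration_imob:
  assumes det: "a * d - b * c = 1" and E: "fan_enumeration (imob a b c d None) E"
  obtains n0 where "\<And>n. E n = imob a b c d ` {None, Some (of_int (n + n0))}"
proof -
  let ?g = "imob a b c d"
  let ?e = "\<lambda>n::int. ?g ` {None, Some (of_int n)}"
  have bij: "bij_betw E UNIV (fan (?g None))" and less: "\<And>m n. m < n \<Longrightarrow> fan_less (?g None) (E m) (E n)"
    using E by (auto simp: fan_enumeration_def)
  have "E n \<in> range ?e" for n
    using bij unfolding fan_imob[OF det] bij_betw_def by blast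
  then have "\<exists>k. E n = ?e k" for n by blast
  then obtain f where f: "\<And>n. E n = ?e (f n)" by metis
  have inj: "?e m = ?e n \<Longrightarrow> m = n" for m n
    unfolding inj_image_eq_iff[OF imob_inj[OF det]] by (auto simp: doubleton_eq_iff)
  have "strict_mono f"
  proof (rule strict_monoI)
    fix m n :: int assume "m < n"
    then have "fan_less (?g None) (?e (f m)) (?e (f n))" using less[of m n] by (simp only: f)
    then show "f m < f n" using fan_less_imob[OF det] by blast
  qed
  moreover have "surj f"
    unfolding surj_def
  proof
    fix k
    have "?e k \<in> fan (?g None)" using fan_imob[OF det] by blast
    then obtain n where "E n = ?e k" using bij unfolding bij_betw_def by (metis imageE)
    then show "\<exists>n. k = f n" using f inj by metis
  qed
  ultimately have "f n = n + f 0" for n by (rule strict_mono_surj_int)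
  then show ?thesis using f that by metis
qed

text \<open>
  The shear is the logarithm of a cross-ratio. Orientation is essential: a normalising map that exchanged the two
  ends of the edge would send the third vertex of the first triangle to the positive side.
\<close>

lemma shear_eq:
  assumes c1: "rhat_cyc P L Q" and c2: "rhat_cyc P Q R"
  shows "shear {P, Q} {P, Q, L} {P, Q, R} = ln (cr R Q L P)"
proof -
  have ne: "P \<noteq> L" "L \<noteq> Q" "Q \<noteq> P" "Q \<noteq> R" "R \<noteq> P" using c1 c2 rhat_cyc_distinct by blast+
  have crpos: "cr R Q L P > 0" using ne by (intro cr_pos) auto
  show ?thesis unfolding shear_def
  proof (rule the_equality)
    obtain A where A: "A \<in> PSL2R" "A P = None" by (rule PSL2R_send_to_infinity)
    have injA: "A p = A q \<longleftrightarrow> p = q" for p q using PSL2R_bij[OF A(1)] by (auto simp: bij_def dest: injD)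
    obtain l where l: "A L = Some l" using injA[of L P] A ne by (cases "A L") auto
    obtain q where q: "A Q = Some q" using injA[of Q P] A ne by (cases "A Q") auto
    obtain r where r: "A R = Some r" using injA[of R P] A ne by (cases "A R") auto
    have "rhat_cyc (A P) (A L) (A Q)" "rhat_cyc (A P) (A Q) (A R)" using c1 c2 PSL2R_cyc[OF A(1)] by blast+
    then have lqr: "l < q" "q < r" unfolding A(2) l q r by (auto simp: rhat_cyc_def rhat_less_def)
    obtain B where B: "B \<in> PSL2R" "B None = None" "\<And>x. B (Some x) = Some (1 / (q - l) * x + (- q / (q - l)))"
      using PSL2R_affine[of "1 / (q - l)" "- q / (q - l)"] lqr by auto
    have cr: "cr R Q L P = (r - q) / (q - l)"
      unfolding cr_PSL2R[OF A(1), symmetric, of R] A(2) l q r using lqr by (simp add: cr_finite)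
    have "(B \<circ> A) L = Some (- 1)" "(B \<circ> A) Q = Some 0" "(B \<circ> A) P = None" "(B \<circ> A) R = Some (exp (ln (cr R Q L P)))"
    proof -
      have B': "B (Some x) = Some ((x - q) / (q - l))" for x by (simp add: B(3) diff_divide_distrib)
      have "(l - q) / (q - l) = -1" using lqr by (simp add: divide_eq_eq)
      then show "(B \<circ> A) L = Some (- 1)" "(B \<circ> A) Q = Some 0" "(B \<circ> A) P = None"
        "(B \<circ> A) R = Some (exp (ln (cr R Q L P)))"
        using A l q r B(2) B' lqr crpos cr by simp_all
    qed
    then show "\<exists>A\<in>PSL2R. A ` {P, Q, L} = {Some (- 1), Some 0, None} \<and> A ` {P, Q} = {Some 0, None} \<and>
      A ` {P, Q, R} = {Some 0, Some (exp (ln (cr R Q L P))), None}"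
      by (intro bexI[OF _ PSL2R_comp[OF B(1) A(1)]]) auto
  next
    fix s
    assume "\<exists>A\<in>PSL2R. A ` {P, Q, L} = {Some (- 1), Some 0, None} \<and> A ` {P, Q} = {Some 0, None} \<and>
      A ` {P, Q, R} = {Some 0, Some (exp s), None}"
    then obtain A where A: "A \<in> PSL2R" "A ` {P, Q, L} = {Some (- 1), Some 0, None}" "A ` {P, Q} = {Some 0, None}"
      "A ` {P, Q, R} = {Some 0, Some (exp s), None}" by blast
    have injA: "A p = A q \<longleftrightarrow> p = q" for p q using PSL2R_bij[OF A(1)] by (auto simp: bij_def dest: injD)
    have PQ: "A P = Some 0 \<and> A Q = None \<or> A P = None \<and> A Q = Some 0"
      using A(3) by (auto simp: doubleton_eq_iff)
    have "A L \<noteq> A P" "A L \<noteq> A Q" using injA ne by auto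
    then have L: "A L = Some (- 1)" using A(2) PQ by auto
    have "A R \<noteq> A P" "A R \<noteq> A Q" using injA ne by auto
    then have R: "A R = Some (exp s)" using A(4) PQ by auto
    have "rhat_cyc (A P) (A L) (A Q)" using c1 PSL2R_cyc[OF A(1)] by blast
    then have PQ: "A P = None" "A Q = Some 0" using PQ L by (auto simp: rhat_cyc_def rhat_less_def)
    have "cr R Q L P = exp s"
      unfolding cr_PSL2R[OF A(1), symmetric, of R] PQ L R by (simp add: cr_finite)
    then show "s = ln (cr R Q L P)" by simp
  qed
qed

text \<open>
  Both orders of the two adjacent triangles give the same shear, by the symmetry of the
  cross-ratio.
\<close>

lemma shear_map_eq:
  fixes n :: int
  assumes h: "cyc_bij h" and det: "a * d - b * c = 1"
  defines "g \<equiv> imob a b c d"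
  shows "shear_map h (g ` {None, Some (of_int n)})
    = ln (cr (h (g (Some (of_int (n + 1))))) (h (g (Some (of_int n)))) (h (g (Some (of_int (n - 1))))) (h (g None)))"
proof -
  let ?e = "g ` {None, Some (of_int n)}"
  let ?P = "h (g None)" and ?Q = "h (g (Some (of_int n)))" and ?L = "h (g (Some (of_int (n - 1))))" and ?R = "h (g (Some (of_int (n + 1))))"
  let ?T1 = "g ` {None, Some (of_int n), Some (of_int (n - 1))}" and ?T2 = "g ` {None, Some (of_int n), Some (of_int (n + 1))}"
  have "g \<in> PSL2R" unfolding g_def imob_def by (rule mob_in_PSL2R[OF det_of_int[OF det]])
  then have hg: "cyc_bij (h \<circ> g)" by (intro cyc_bij_comp h cyc_bij_PSL2R)
  have "rhat_cyc None (Some (real_of_int (n - 1))) (Some (of_int n))" "rhat_cyc None (Some (real_of_int n)) (Some (of_int (n + 1)))"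
    by (auto simp: rhat_cyc_def rhat_less_def)
  then have "rhat_cyc ((h \<circ> g) None) ((h \<circ> g) (Some (real_of_int (n - 1)))) ((h \<circ> g) (Some (of_int n)))"
    "rhat_cyc ((h \<circ> g) None) ((h \<circ> g) (Some (real_of_int n))) ((h \<circ> g) (Some (of_int (n + 1))))"
    using hg unfolding cyc_bij_def by blast+
  then have cyc: "rhat_cyc ?P ?L ?Q" "rhat_cyc ?P ?Q ?R" by simp_all
  have img: "h ` ?e = {?P, ?Q}" "h ` ?T1 = {?P, ?Q, ?L}" "h ` ?T2 = {?P, ?Q, ?R}" by auto
  have sym: "cr ?L ?P ?R ?Q = cr ?R ?Q ?L ?P" by (simp add: cr_def mult.commute)
  have s1: "shear (h ` ?e) (h ` ?T1) (h ` ?T2) = ln (cr ?R ?Q ?L ?P)"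
    unfolding img by (rule shear_eq[OF cyc])
  have s2: "shear (h ` ?e) (h ` ?T2) (h ` ?T1) = ln (cr ?R ?Q ?L ?P)"
    using shear_eq[OF rhat_cyc_rotate[OF cyc(2)] rhat_cyc_rotate[OF rhat_cyc_rotate[OF cyc(1)]]]
    unfolding img sym[symmetric] by (simp add: insert_commute)
  have surj: "g (imob d (-b) (-c) a p) = p" for p using fun_cong[OF imob_inverse(2)[OF det], of p] by (simp add: g_def)
  have inj: "inj g" unfolding g_def by (rule imob_inj[OF det])
  have tri: "T \<in> farey_triangles \<and> ?e \<subseteq> T \<longleftrightarrow> T = ?T1 \<or> T = ?T2" for T
  proof -
    define S where "S = imob d (-b) (-c) a ` T"
    have T: "T = g ` S" unfolding S_def image_image surj by simp
    have "T \<in> farey_triangles \<and> ?e \<subseteq> T \<longleftrightarrow> S \<in> farey_triangles \<and> {None, Some (of_int n)} \<subseteq> S"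
      unfolding T using farey_edges_imob_iff(2)[OF det] inj_image_subset_iff[OF inj] by (simp only: g_def)
    also have "\<dots> \<longleftrightarrow> T = ?T1 \<or> T = ?T2"
      unfolding farey_triangle_infinity_iff T inj_image_eq_iff[OF inj] by blast
    finally show ?thesis .
  qed
  have "?T1 \<noteq> ?T2" unfolding inj_image_eq_iff[OF inj]
  proof
    assume eq: "{None, Some (real_of_int n), Some (of_int (n - 1))} = {None, Some (of_int n), Some (of_int (n + 1))}"
    have "Some (real_of_int (n + 1)) \<in> {None, Some (real_of_int n), Some (of_int (n - 1))}" unfolding eq by simp
    then show False by auto
  qed
  show ?thesis unfolding shear_map_def
  proof (rule the_equality)
    show "\<exists>T1 T2. T1 \<in> farey_triangles \<and> T2 \<in> farey_triangles \<and> T1 \<noteq> T2 \<and>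
     ?e \<subseteq> T1 \<and> ?e \<subseteq> T2 \<and> ln (cr ?R ?Q ?L ?P) = shear (h ` ?e) (h ` T1) (h ` T2)"
      using tri[of ?T1] tri[of ?T2] \<open>?T1 \<noteq> ?T2\<close> s1 by metis
    fix r
    assume "\<exists>T1 T2. T1 \<in> farey_triangles \<and> T2 \<in> farey_triangles \<and> T1 \<noteq> T2 \<and>
     ?e \<subseteq> T1 \<and> ?e \<subseteq> T2 \<and> r = shear (h ` ?e) (h ` T1) (h ` T2)"
    then obtain T1 T2 where T: "T1 \<in> farey_triangles" "T2 \<in> farey_triangles" "T1 \<noteq> T2"
      "?e \<subseteq> T1" "?e \<subseteq> T2" "r = shear (h ` ?e) (h ` T1) (h ` T2)" by blast
    note T12 = iffD1[OF tri conjI[OF T(1) T(4)]] iffD1[OF tri conjI[OF T(2) T(5)]]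
    have pick: "\<lbrakk>x = y \<or> x = z; u = y \<or> u = z; x \<noteq> u\<rbrakk> \<Longrightarrow> x = y \<and> u = z \<or> x = z \<and> u = y"
      for x y z u :: "rhat set" by blast
    consider "T1 = ?T1 \<and> T2 = ?T2" | "T1 = ?T2 \<and> T2 = ?T1" using pick[OF T12 T(3)] by argo
    then show "r = ln (cr ?R ?Q ?L ?P)"
    proof cases
      case 1
      then show ?thesis using T(6) s1 by metis
    next
      case 2
      then show ?thesis using T(6) s2 by metis
    qed
  qed
qed

text \<open>
  Sums of exponentials of consecutive shears telescope: in a coordinate with the tip at infinity, the fan ratio is
  the quotient of the images of two adjacent intervals of length \<open>k + 1\<close>.
\<close>

lemma fan_ratio_telescope:
  fixes K :: "int \<Rightarrow> real"
  assumes mono: "\<And>i. K i < K (i + 1)"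
    and s: "\<And>m. s (E m) = ln ((K (m + 1) - K m) / (K m - K (m - 1)))"
  shows "fan_ratio s E m k = (K (m + int k + 1) - K m) / (K m - K (m - int k - 1))"
proof -
  define \<delta> where "\<delta> i = K (i + 1) - K i" for i
  have pos: "\<delta> i > 0" for i using mono by (simp add: \<delta>_def)
  have es: "exp (s (E m)) = \<delta> m / \<delta> (m - 1)" for m
    using pos[of m] pos[of "m - 1"] by (simp add: s \<delta>_def)
  have up: "exp (\<Sum>i=1..j. s (E (m + int i))) = \<delta> (m + int j) / \<delta> m" for j
  proof (induction j)
    case (Suc j)
    then show ?case using es[of "m + int (Suc j)"] pos[of "m + int j"]
      by (simp add: exp_add algebra_simps)
  qed (use pos[of m] in simp)
  have down: "exp (- (\<Sum>i=1..j. s (E (m - int i)))) = \<delta> (m - 1 - int j) / \<delta> (m - 1)" for j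
  proof (induction j)
    case (Suc j)
    have "exp (- s (E (m - int (Suc j)))) = \<delta> (m - 1 - int (Suc j)) / \<delta> (m - 1 - int j)"
      using es[of "m - int (Suc j)"] by (simp add: exp_minus algebra_simps)
    moreover have "exp (- (\<Sum>i=1..Suc j. s (E (m - int i))))
      = exp (- (\<Sum>i=1..j. s (E (m - int i)))) * exp (- s (E (m - int (Suc j))))"
      by (simp flip: exp_add)
    ultimately show ?case using Suc pos[of "m - 1 - int j"] by simp
  qed (use pos[of "m - 1"] in simp)
  have tele: "(\<Sum>j=0..k. \<delta> (m + int j)) = K (m + int k + 1) - K m" for k
    by (induction k) (simp_all add: \<delta>_def algebra_simps)
  have tele': "(\<Sum>j=0..k. \<delta> (m - 1 - int j)) = K m - K (m - int k - 1)" for k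
    by (induction k) (simp_all add: \<delta>_def algebra_simps)
  have exp_minus_right: "exp (x - y) = exp x * exp (- y)" for x y :: real by (simp flip: exp_add)
  have num: "(\<Sum>j=0..k. exp (s (E m) / 2 + (\<Sum>i=1..j. s (E (m + int i)))))
     = exp (s (E m) / 2) / \<delta> m * (K (m + int k + 1) - K m)"
    unfolding exp_add up tele[symmetric] sum_distrib_left by (simp add: field_simps)
  have den: "(\<Sum>j=0..k. exp (- s (E m) / 2 - (\<Sum>i=1..j. s (E (m - int i)))))
     = exp (- s (E m) / 2) / \<delta> (m - 1) * (K m - K (m - int k - 1))"
    unfolding exp_minus_right down tele'[symmetric] sum_distrib_left by (simp add: field_simps)
  have "exp (s (E m) / 2) = exp (s (E m)) * exp (- s (E m) / 2)" by (simp flip: exp_add)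
  then have e: "exp (s (E m) / 2) / \<delta> m = exp (- s (E m) / 2) / \<delta> (m - 1)"
    using es[of m] pos[of m] pos[of "m - 1"] by (simp add: field_simps)
  have nz: "exp (- s (E m) / 2) / \<delta> (m - 1) \<noteq> 0" using pos[of "m - 1"] by simp
  show ?thesis unfolding fan_ratio_def num den e using nz by (rule mult_divide_mult_cancel_left)
qed

lemma fan_ratio_eq_cr:
  assumes h: "cyc_bij h" and det: "a * d - b * c = 1"
    and E: "\<And>n. E n = imob a b c d ` {None, Some (of_int (n + n0))}"
    and f: "f = imob a (a * (m + n0) + b) c (c * (m + n0) + d)"
  shows "fan_ratio (shear_map h) E m k
    = cr (h (f (Some (real (k + 1))))) (h (f (Some 0))) (h (f (Some (- real (k + 1))))) (h (f None))"
proof -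
  let ?g = "imob a b c d"
  have g: "?g \<in> PSL2R" unfolding imob_def by (rule mob_in_PSL2R[OF det_of_int[OF det]])
  obtain A K where A: "A \<in> PSL2R" "A \<circ> h \<circ> ?g = lift K" "strict_mono K"
    using chart_exists[OF h g] by metis
  have cr: "cr (h (?g p)) (h (?g q)) (h (?g r)) (h (?g s)) = cr (lift K p) (lift K q) (lift K r) (lift K s)" for p q r s
    unfolding A(2)[symmetric] o_def cr_PSL2R[OF A(1)] ..
  define k' where "k' i = K (of_int (i + n0))" for i :: int
  have mono: "k' i < k' j" if "i < j" for i j using A(3) that by (simp add: k'_def strict_mono_less)
  have s: "shear_map h (E n) = ln ((k' (n + 1) - k' n) / (k' n - k' (n - 1)))" for n
  proof -
    have "K (of_int (n + n0 - 1)) < K (of_int (n + n0))" "K (of_int (n + n0)) < K (of_int (n + n0 + 1))"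
      using A(3) by (simp_all add: strict_mono_less)
    then show ?thesis
      unfolding E shear_map_eq[OF h det] cr by (simp add: cr_finite k'_def algebra_simps)
  qed
  have "fan_ratio (shear_map h) E m k = (k' (m + int k + 1) - k' m) / (k' m - k' (m - int k - 1))"
    by (rule fan_ratio_telescope[OF mono s]) simp
  also have "\<dots> = cr (lift K (Some (of_int (m + n0) + real (k + 1)))) (lift K (Some (of_int (m + n0))))
     (lift K (Some (of_int (m + n0) - real (k + 1)))) (lift K None)"
  proof -
    have "k' (m - int k - 1) < k' m" "k' m < k' (m + int k + 1)" by (auto intro: mono)
    then show ?thesis by (simp add: cr_finite k'_def algebra_simps)
  qed
  also have "\<dots> = cr (h (f (Some (real (k + 1))))) (h (f (Some 0))) (h (f (Some (- real (k + 1))))) (h (f None))"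
  proof -
    have "?g \<circ> imob 1 (m + n0) 0 1 = f" unfolding f using det by (simp add: imob_comp)
    then have "f p = ?g (imob 1 (m + n0) 0 1 p)" for p by auto
    moreover have "imob 1 (m + n0) 0 1 (Some x) = Some (of_int (m + n0) + x)" "imob 1 (m + n0) 0 1 None = None" for x
      by (simp_all add: imob_def moebius_def add.commute)
    ultimately show ?thesis unfolding cr[symmetric] by (simp del: of_nat_Suc of_nat_add)
  qed
  finally show ?thesis .
qed

text \<open>
  The distance of two shear maps is at most \<open>\<kappa>\<close> exactly if the maps distort the symmetric quadruples of
  all fans by at most \<open>\<kappa>\<close> with respect to each other.
\<close>

theorem shear_distortion_le_iff:
  assumes h: "cyc_bij h" and l: "cyc_bij l"
    and E: "\<And>p. p \<in> qhat \<Longrightarrow> fan_enumeration p (E p)"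
  shows "shear_distortion E (shear_map h) (shear_map l) \<le> ereal \<kappa> \<longleftrightarrow> fan_close \<kappa> h l"
proof -
  have good: "max (x / y) (y / x) \<le> \<kappa> \<longleftrightarrow> x \<le> \<kappa> * y \<and> y \<le> \<kappa> * x" if "x > 0" "y > 0" for x y
    using that by (simp add: field_simps)
  have pos: "cr (k (f (Some t))) (k (f (Some 0))) (k (f (Some (- t)))) (k (f None)) > 0"
    if "cyc_bij k" "f = imob a b c d" "a * d - b * c = 1" "t > 0" for k f a b c d t
    using that imob_inj[OF that(3)] by (intro cr_pos) (auto simp: cyc_bij_inj inj_eq)
  have ratio_iff: "max (fan_ratio (shear_map h) (E p) m k / fan_ratio (shear_map l) (E p) m k)
      (fan_ratio (shear_map l) (E p) m k / fan_ratio (shear_map h) (E p) m k) \<le> \<kappa> \<longleftrightarrow>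
      good \<kappa> h l (f (Some (real (k + 1)))) (f (Some 0)) (f (Some (- real (k + 1)))) (f None)"
    if det: "a * d - b * c = 1" and En: "\<And>n. E p n = imob a b c d ` {None, Some (of_int (n + n0))}"
      and f: "f = imob a (a * (m + n0) + b) c (c * (m + n0) + d)" for p m k f a b c d n0
  proof -
    have det': "a * (c * (m + n0) + d) - (a * (m + n0) + b) * c = 1" using det by (simp add: algebra_simps)
    show ?thesis
      unfolding fan_ratio_eq_cr[OF h det En f] fan_ratio_eq_cr[OF l det En f] good_def
      using pos[OF h f det', of "real (k + 1)"] pos[OF l f det', of "real (k + 1)"] by (intro good) auto
  qed
  have "shear_distortion E (shear_map h) (shear_map l) \<le> ereal \<kappa> \<longleftrightarrow>
    (\<forall>p\<in>qhat. \<forall>m k. max (fan_ratio (shear_map h) (E p) m k / fan_ratio (shear_map l) (E p) m k)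
      (fan_ratio (shear_map l) (E p) m k / fan_ratio (shear_map h) (E p) m k) \<le> \<kappa>)"
    unfolding shear_distortion_def fan_distortion_def SUP_le_iff by simp
  also have "\<dots> \<longleftrightarrow> fan_close \<kappa> h l"
  proof
    assume all: "\<forall>p\<in>qhat. \<forall>m k. max (fan_ratio (shear_map h) (E p) m k / fan_ratio (shear_map l) (E p) m k)
      (fan_ratio (shear_map l) (E p) m k / fan_ratio (shear_map h) (E p) m k) \<le> \<kappa>"
    show "fan_close \<kappa> h l"
      unfolding fan_close_def Let_def
    proof (intro allI impI)
      fix a b c d :: int and t :: nat
      assume det: "a * d - b * c = 1" and t: "t > 0"
      have p: "imob a b c d None \<in> qhat" using det qhat_iff_imob by blast
      obtain n0 where n0: "\<And>n. E (imob a b c d None) n = imob a b c d ` {None, Some (of_int (n + n0))}"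
        using fan_enumeration_imob[OF det E[OF p]] by blast
      show "good \<kappa> h l (imob a b c d (Some (real t))) (imob a b c d (Some 0)) (imob a b c d (Some (- real t))) (imob a b c d None)"
        using ratio_iff[OF det n0, of "imob a b c d" "- n0" "t - 1"] all p t by simp
    qed
  next
    assume fc: "fan_close \<kappa> h l"
    show "\<forall>p\<in>qhat. \<forall>m k. max (fan_ratio (shear_map h) (E p) m k / fan_ratio (shear_map l) (E p) m k)
      (fan_ratio (shear_map l) (E p) m k / fan_ratio (shear_map h) (E p) m k) \<le> \<kappa>"
    proof (intro ballI allI)
      fix p m and k :: nat assume p: "p \<in> qhat"
      then obtain a b c d where det: "a * d - b * c = 1" and pg: "p = imob a b c d None" using qhat_iff_imob by blast
      obtain n0 where n0: "\<And>n. E p n = imob a b c d ` {None, Some (of_int (n + n0))}"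
        using fan_enumeration_imob[OF det E[OF p, unfolded pg]] pg by blast
      have det': "a * (c * (m + n0) + d) - (a * (m + n0) + b) * c = 1" using det by (simp add: algebra_simps)
      show "max (fan_ratio (shear_map h) (E p) m k / fan_ratio (shear_map l) (E p) m k)
        (fan_ratio (shear_map l) (E p) m k / fan_ratio (shear_map h) (E p) m k) \<le> \<kappa>"
        unfolding ratio_iff[OF det n0 refl]
        using fan_closeD[OF fc det' _ refl, of "k + 1"] by simp
    qed
  qed
  finally show ?thesis .
qed

section \<open>Normalised maps and the convergence theorem\<close>

lemma orient_homeo_cyc_bij: "orient_homeo h \<Longrightarrow> cyc_bij h"
proof -
  assume h: "orient_homeo h"
  have top: "topspace rhat_top = UNIV" by (simp add: UNIV_option_conv)
  have "homeomorphic_map rhat_top rhat_top h" using h by (simp add: orient_homeo_def)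
  then have "bij h"
    using homeomorphic_imp_injective_map homeomorphic_imp_surjective_map top unfolding bij_def by metis
  then show ?thesis using h by (simp add: orient_homeo_def cyc_bij_def)
qed

lemma inv_strict_mono_surj:
  fixes H :: "real \<Rightarrow> real"
  assumes "strict_mono H" "surj H"
  shows "strict_mono (inv H)" "surj (inv H)" "H (inv H x) = x" "inv H (H x) = x"
proof -
  have inj: "inj H" using assms(1) by (rule strict_mono_imp_inj_on)
  show "H (inv H x) = x" for x using assms(2) by (rule surj_f_inv_f)
  show "inv H (H x) = x" for x using inj by (rule inv_f_f)
  show "surj (inv H)" using inj by (rule inj_imp_surj_inv)
  show "strict_mono (inv H)"
  proof (rule strict_monoI)
    fix x y :: real assume "x < y"
    then have "H (inv H x) < H (inv H y)" using surj_f_inv_f[OF assms(2)] by simp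
    then show "inv H x < inv H y" using assms(1) by (simp add: strict_mono_less)
  qed
qed

text \<open>
  Increasing surjections of the line are continuous, so that cyclic order preserving bijections of the circle that
  fix infinity are homeomorphisms.
\<close>

lemma strict_mono_surj_continuous:
  fixes H :: "real \<Rightarrow> real"
  assumes "strict_mono H" "surj H"
  shows "continuous_on UNIV H"
  by (rule continuous_onI_mono) (use assms in \<open>auto simp: strict_mono_less_eq\<close>)

lemma continuous_map_lift:
  assumes H: "strict_mono H" "surj H"
  shows "continuous_map rhat_top rhat_top (lift H)"
  unfolding continuous_map
proof (intro conjI allI impI)
  have cont: "continuous_on UNIV H" by (rule strict_mono_surj_continuous[OF H])
  have icont: "continuous_on UNIV (inv H)"
    by (rule strict_mono_surj_continuous) (use inv_strict_mono_surj[OF H] in auto)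
  show "lift H ` topspace rhat_top \<subseteq> topspace rhat_top"
    unfolding topspace_Alexandroff_compactification by (simp flip: UNIV_option_conv)
  fix U assume "openin rhat_top U"
  then consider V where "open V" "U = Some ` V" | C where "compact C" "U = insert None (Some ` (- C))"
    by (auto simp: openin_Alexandroff_compactification Compl_eq_Diff_UNIV)
  then show "openin rhat_top {x \<in> topspace rhat_top. lift H x \<in> U}"
  proof cases
    case 1
    have "{x \<in> topspace rhat_top. lift H x \<in> U} = Some ` (H -` V)"
    proof (rule set_eqI)
      show "x \<in> {x \<in> topspace rhat_top. lift H x \<in> U} \<longleftrightarrow> x \<in> Some ` (H -` V)" for x
        unfolding 1 by (cases x) auto
    qed
    moreover have "open (H -` V)" using 1(1) cont by (simp add: continuous_on_open_vimage)
    ultimately show ?thesis by simp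
  next
    case 2
    have "{x \<in> topspace rhat_top. lift H x \<in> U} = insert None (Some ` (- (H -` C)))"
    proof (rule set_eqI)
      show "x \<in> {x \<in> topspace rhat_top. lift H x \<in> U} \<longleftrightarrow> x \<in> insert None (Some ` (- (H -` C)))" for x
        unfolding 2 by (cases x) auto
    qed
    moreover have "H -` C = inv H ` C"
      using inv_strict_mono_surj[OF H] by (auto simp: image_iff) metis
    moreover have "compact (inv H ` C)"
      using 2(1) icont by (intro compact_continuous_image) (auto intro: continuous_on_subset)
    ultimately show ?thesis
      by (auto simp: openin_Alexandroff_compactification Compl_eq_Diff_UNIV compact_imp_closed)
  qed
qed

lemma orient_homeo_lift:
  assumes H: "strict_mono H" "surj H"
  shows "orient_homeo (lift H)"
proof -
  have "homeomorphic_maps rhat_top rhat_top (lift H) (lift (inv H))"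
    unfolding homeomorphic_maps_def
  proof (intro conjI ballI)
    show "continuous_map rhat_top rhat_top (lift H)" by (rule continuous_map_lift[OF H])
    show "continuous_map rhat_top rhat_top (lift (inv H))"
      by (rule continuous_map_lift) (use inv_strict_mono_surj[OF H] in auto)
    show "lift (inv H) (lift H x) = x" "lift H (lift (inv H) x) = x" for x
      using inv_strict_mono_surj[OF H] by (cases x; simp)+
  qed
  then have "homeomorphic_map rhat_top rhat_top (lift H)" using homeomorphic_map_maps by blast
  then show ?thesis using cyc_bij_lift[OF H] by (simp add: orient_homeo_def cyc_bij_def)
qed

text \<open>
  The constant is at least 1 automatically, since both bounds hold for the same positive quotient.
\<close>

lemma M_quasisymmetric_iff:
  "M_quasisymmetric M h \<longleftrightarrow> (\<exists>H. h = lift H \<and> line_qs M H \<and> surj H)"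
proof
  assume h: "M_quasisymmetric M h"
  then have "cyc_bij h" "h None = None" using orient_homeo_cyc_bij by (auto simp: M_quasisymmetric_def)
  then obtain H where H: "h = lift H" "strict_mono H" "surj H" by (rule cyc_bij_fixing_infinity)
  have r: "1 / M \<le> (H (x + t) - H x) / (H x - H (x - t))" "(H (x + t) - H x) / (H x - H (x - t)) \<le> M"
    if "t > 0" for x t
    using h that unfolding M_quasisymmetric_def H(1) by auto
  have inc: "H x < H (x + t)" "H (x - t) < H x" if "t > 0" for x t
    using H(2) that by (simp_all add: strict_mono_less)
  have M0: "M > 0"
  proof -
    have "(H (0 + 1) - H 0) / (H 0 - H (0 - 1)) > 0" using inc[of 1 0] by simp
    then show ?thesis using r(2)[of 1 0] by linarith
  qed
  have "1 / M \<le> M" using r[of 1 0] by linarith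
  then have "1 \<le> M * M" using M0 by (simp add: field_simps)
  then have M: "M \<ge> 1" using M0 by (metis less_1_mult' less_eq_real_def linorder_not_le mult_less_cancel_left2 not_le order_less_le_trans)
  have b: "H (x + t) - H x \<le> M * (H x - H (x - t))" "H x - H (x - t) \<le> M * (H (x + t) - H x)"
    if t: "t > 0" for x t
    using r[OF t, of x] inc[OF t, of x] M0 by (simp_all add: field_simps)
  have "line_qs M H" by (rule line_qsI[OF M H(2)]) (use b in blast)
  then show "\<exists>H. h = lift H \<and> line_qs M H \<and> surj H" using H by blast
next
  assume "\<exists>H. h = lift H \<and> line_qs M H \<and> surj H"
  then obtain H where H: "h = lift H" "line_qs M H" "surj H" by blast
  have mono: "strict_mono H" and M: "M \<ge> 1" using H by (auto simp: line_qs_def)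
  have "1 / M \<le> (H (x + t) - H x) / (H x - H (x - t)) \<and> (H (x + t) - H x) / (H x - H (x - t)) \<le> M"
    if t: "t > 0" for x t
    using line_qsD[OF H(2) t, of x] M by (simp add: field_simps)
  then show "M_quasisymmetric M h"
    unfolding M_quasisymmetric_def H(1) using orient_homeo_lift[OF mono H(3)] by simp
qed

lemma line_qs_mono: "line_qs M H \<Longrightarrow> M \<le> M' \<Longrightarrow> line_qs M' H"
  unfolding line_qs_def by (meson abs_ge_zero mult_right_mono order_trans)

lemma line_qs_affine:
  assumes "line_qs M H" "\<alpha> > 0"
  shows "line_qs M (\<lambda>x. \<alpha> * H x + \<beta>)"
proof -
  have "\<bar>(\<alpha> * H (x + t) + \<beta>) - (\<alpha> * H x + \<beta>)\<bar> \<le> M * \<bar>(\<alpha> * H (x - t) + \<beta>) - (\<alpha> * H x + \<beta>)\<bar>" for x t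
  proof -
    have "\<bar>H (x + t) - H x\<bar> \<le> M * \<bar>H (x - t) - H x\<bar>" using assms(1) by (simp add: line_qs_def)
    then have "\<alpha> * \<bar>H (x + t) - H x\<bar> \<le> \<alpha> * (M * \<bar>H (x - t) - H x\<bar>)" using assms(2) by simp
    then show ?thesis using assms(2) by (simp add: abs_mult mult.left_commute flip: right_diff_distrib)
  qed
  then show ?thesis using assms by (auto simp: line_qs_def strict_mono_def)
qed

text \<open>
  The normalised representative of a class exists and is unique, hence is not an arbitrary value of the
  definite description.
\<close>

lemma normalized_rep_line_qs:
  assumes c: "c \<in> universal_teichmueller"
  obtains H M where "normalized_rep c = lift H" "line_qs M H" "surj H"
proof -
  obtain f where f: "f \<in> QS_circle" "c = mob_equiv `` {f}"
    using c unfolding universal_teichmueller_def by (rule quotientE)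
  obtain A where A: "A \<in> PSL2R" "quasisymmetric (A \<circ> f)" using f(1) by (auto simp: QS_circle_def)
  then obtain M where "M_quasisymmetric M (A \<circ> f)" by (auto simp: quasisymmetric_def)
  then obtain K where K: "A \<circ> f = lift K" "line_qs M K" "surj K" unfolding M_quasisymmetric_iff by blast
  have "K 0 < K 1" using K(2) by (simp add: line_qs_def strict_mono_less)
  define \<alpha> \<beta> where "\<alpha> = 1 / (K 1 - K 0)" and "\<beta> = - K 0 / (K 1 - K 0)"
  have \<alpha>: "\<alpha> > 0" using \<open>K 0 < K 1\<close> by (simp add: \<alpha>_def)
  obtain B where B: "B \<in> PSL2R" "B None = None" "\<And>x. B (Some x) = Some (\<alpha> * x + \<beta>)"
    using PSL2R_affine[OF \<alpha>] by metis
  define H where "H x = \<alpha> * K x + \<beta>" for x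
  have lH: "B \<circ> A \<circ> f = lift H"
  proof
    fix p
    have "A (f p) = lift K p" using fun_cong[OF K(1), of p] by simp
    then show "(B \<circ> A \<circ> f) p = lift H p" using B by (cases p) (simp_all add: H_def)
  qed
  have H: "line_qs M H" unfolding H_def using K(2) \<alpha> by (rule line_qs_affine)
  have Hs: "surj H"
    unfolding surj_def
  proof
    fix y
    obtain x where "K x = (y - \<beta>) / \<alpha>" using K(3) by (metis surjD)
    then show "\<exists>x. y = H x" using \<alpha> by (intro exI[of _ x]) (simp add: H_def)
  qed
  have H01: "H 0 = 0" "H 1 = 1" using \<open>K 0 < K 1\<close> by (auto simp: H_def \<alpha>_def \<beta>_def divide_simps)
  have M: "M \<ge> 1" using H by (simp add: line_qs_def)
  have qsH: "quasisymmetric (lift H)" using H Hs M unfolding quasisymmetric_def M_quasisymmetric_iff by blast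
  have "lift H \<in> QS_circle"
    unfolding QS_circle_def
  proof (intro CollectI conjI bexI[OF _ PSL2R_id])
    show "orient_homeo (lift H)" using H Hs by (intro orient_homeo_lift) (simp_all add: line_qs_def)
    show "quasisymmetric (id \<circ> lift H)" using qsH by simp
  qed
  moreover have "\<exists>D\<in>PSL2R. lift H = D \<circ> f"
    by (rule bexI[OF _ PSL2R_comp[OF B(1) A(1)]]) (simp only: lH)
  ultimately have mem: "lift H \<in> c" unfolding f(2) mob_equiv_def using f(1) by simp
  have "normalized_rep c = lift H"
    unfolding normalized_rep_def
  proof (rule the_equality)
    show "lift H \<in> c \<and> lift H (Some 0) = Some 0 \<and> lift H (Some 1) = Some 1 \<and> lift H None = None"
      using mem H01 by simp
    fix k assume k: "k \<in> c \<and> k (Some 0) = Some 0 \<and> k (Some 1) = Some 1 \<and> k None = None"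
    then obtain D where D: "D \<in> PSL2R" "k = D \<circ> f" unfolding f(2) mob_equiv_def by auto
    obtain G where G: "G \<in> PSL2R" "(B \<circ> A) \<circ> G = id" "G \<circ> (B \<circ> A) = id"
      using PSL2R_inverse[OF PSL2R_comp[OF B(1) A(1)]] by blast
    have kl: "k = (D \<circ> G) \<circ> lift H"
      unfolding D(2) lH[symmetric] using G(3) by (metis comp_assoc comp_id)
    have "D \<circ> G = id"
    proof (rule PSL2R_fixing_three_points[OF PSL2R_comp[OF D(1) G(1)]])
      show "(D \<circ> G) (Some 0) = Some 0" using k H01 fun_cong[OF kl, of "Some 0"] by simp
      show "(D \<circ> G) (Some 1) = Some 1" using k H01 fun_cong[OF kl, of "Some 1"] by simp
      show "(D \<circ> G) None = None" using k fun_cong[OF kl, of None] by simp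
    qed
    then show "k = lift H" using kl by simp
  qed
  then show ?thesis using that H Hs by blast
qed

text \<open>
  The inverse of a quasisymmetric map has bounded quotients on symmetric triples.
\<close>

lemma line_qs_inverse_ratio:
  assumes H: "line_qs M H"
  obtains K where "K \<ge> 1" "\<And>a b c. a < b \<Longrightarrow> b < c \<Longrightarrow> H c - H b = H b - H a \<Longrightarrow>
    c - b \<le> K * (b - a) \<and> b - a \<le> K * (c - b)"
proof -
  have M: "M \<ge> 1" and mono: "strict_mono H" using H by (auto simp: line_qs_def)
  obtain e where e: "0 < e" "e \<le> 1"
    "\<And>H x u v. line_qs M H \<Longrightarrow> \<bar>u\<bar> \<le> e * \<bar>v\<bar> \<Longrightarrow> \<bar>H (x + u) - H x\<bar> \<le> 1 / 2 * \<bar>H (x + v) - H x\<bar>"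
    using line_qs_small[OF M, of "1 / 2"] by (metis half_gt_zero zero_less_one)
  show ?thesis
  proof (rule that[of "1 / e"])
    show "1 \<le> 1 / e" using e by simp
    fix a b c assume abc: "a < b" "b < c" "H c - H b = H b - H a"
    have inc: "H a < H b" "H b < H c" using mono abc by (auto simp: strict_mono_less)
    have "e * (c - b) \<le> b - a"
    proof (rule ccontr)
      assume "\<not> ?thesis"
      then have "\<bar>a - b\<bar> \<le> e * \<bar>c - b\<bar>" using abc by simp
      then have "\<bar>H (b + (a - b)) - H b\<bar> \<le> 1 / 2 * \<bar>H (b + (c - b)) - H b\<bar>" by (rule e(3)[OF H])
      then show False using abc inc by simp
    qed
    moreover have "e * (b - a) \<le> c - b"
    proof (rule ccontr)
      assume "\<not> ?thesis"
      then have "\<bar>c - b\<bar> \<le> e * \<bar>a - b\<bar>" using abc by simp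
      then have "\<bar>H (b + (c - b)) - H b\<bar> \<le> 1 / 2 * \<bar>H (b + (a - b)) - H b\<bar>" by (rule e(3)[OF H])
      then show False using abc inc by simp
    qed
    ultimately show "c - b \<le> 1 / e * (b - a) \<and> b - a \<le> 1 / e * (c - b)" using e by (simp add: field_simps)
  qed
qed

lemma line_qs_comp_inverse:
  assumes H: "line_qs M H" "surj H" and L: "line_qs M' L"
  shows "\<exists>K. line_qs K (L \<circ> inv H)"
proof -
  have mono: "strict_mono H" "strict_mono L" and M': "M' \<ge> 1" using H L by (auto simp: line_qs_def)
  note inv = inv_strict_mono_surj[OF mono(1) H(2)]
  obtain K where K: "K \<ge> 1" "\<And>a b c. a < b \<Longrightarrow> b < c \<Longrightarrow> H c - H b = H b - H a \<Longrightarrow>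
    c - b \<le> K * (b - a) \<and> b - a \<le> K * (c - b)" using line_qs_inverse_ratio[OF H(1)] by metis
  obtain C where C: "C \<ge> 1"
    "\<And>H x u v. line_qs M' H \<Longrightarrow> \<bar>u\<bar> \<le> K * \<bar>v\<bar> \<Longrightarrow> \<bar>H (x + u) - H x\<bar> \<le> C * \<bar>H (x + v) - H x\<bar>"
    using line_qs_growth[OF M', of K] by metis
  have "\<bar>(L \<circ> inv H) (x + t) - (L \<circ> inv H) x\<bar> \<le> C * \<bar>(L \<circ> inv H) (x - t) - (L \<circ> inv H) x\<bar>" for x t
  proof -
    define y where "y s = inv H (x + s)" for s
    have "\<bar>y t - y 0\<bar> \<le> K * \<bar>y (- t) - y 0\<bar>"
    proof -
      consider "t > 0" | "t = 0" | "t < 0" by linarith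
      then show ?thesis
      proof cases
        case 1
        then have "y (- t) < y 0" "y 0 < y t" using inv(1) by (auto simp: y_def strict_mono_less)
        then show ?thesis using K(2)[of "y (- t)" "y 0" "y t"] by (simp add: y_def inv)
      next
        case 3
        then have "y t < y 0" "y 0 < y (- t)" using inv(1) by (auto simp: y_def strict_mono_less)
        then show ?thesis using K(2)[of "y t" "y 0" "y (- t)"] by (simp add: y_def inv)
      qed simp
    qed
    then have "\<bar>L (y 0 + (y t - y 0)) - L (y 0)\<bar> \<le> C * \<bar>L (y 0 + (y (- t) - y 0)) - L (y 0)\<bar>"
      by (rule C(2)[OF L])
    then show ?thesis by (simp add: y_def)
  qed
  moreover have "strict_mono (L \<circ> inv H)" using mono inv(1) by (auto simp: strict_mono_def)
  ultimately show ?thesis using C(1) by (auto simp: line_qs_def)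
qed

lemma qs_tendsto_imp_fan_close:
  assumes H: "line_qs M H" "surj H" and F: "\<And>n. line_qs (Ms n) (F n)" and lim: "Ms \<longlonglongrightarrow> 1" and \<kappa>: "\<kappa> > 1"
  shows "\<forall>\<^sub>F n in sequentially. fan_close \<kappa> (lift H) (lift (F n \<circ> H))"
proof -
  have M: "M \<ge> 1" using H by (simp add: line_qs_def)
  obtain \<epsilon> where \<epsilon>: "\<epsilon> > 1"
    "\<And>H F g x t. \<lbrakk>line_qs M H; line_qs \<epsilon> F; surj H; g \<in> PSL2R; t > 0\<rbrakk> \<Longrightarrow>
      good \<kappa> (lift H) (lift F \<circ> lift H) (g (Some (x + t))) (g (Some x)) (g (Some (x - t))) (g None)"
    using near_identity_distorts_little[OF M \<kappa>] by metis
  have "\<forall>\<^sub>F n in sequentially. Ms n < \<epsilon>" using order_tendstoD(2)[OF lim \<epsilon>(1)] .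
  then show ?thesis
  proof (rule eventually_mono)
    fix n assume "Ms n < \<epsilon>"
    then have Fn: "line_qs \<epsilon> (F n)" using line_qs_mono[OF F] by simp
    have l: "lift (F n \<circ> H) = lift (F n) \<circ> lift H" by (simp add: lift_def option.map_comp fun_eq_iff)
    show "fan_close \<kappa> (lift H) (lift (F n \<circ> H))"
      unfolding fan_close_def Let_def
    proof (intro allI impI)
      fix a b c d :: int and t :: nat
      assume "a * d - b * c = 1" and t: "t > 0"
      then have g: "imob a b c d \<in> PSL2R" (is "?g \<in> _")
        unfolding imob_def by (intro mob_in_PSL2R det_of_int)
      show "good \<kappa> (lift H) (lift (F n \<circ> H)) (?g (Some (real t))) (?g (Some 0)) (?g (Some (- real t))) (?g None)"
        unfolding l using \<epsilon>(2)[OF H(1) Fn H(2) g, of "real t" 0] t by simp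
    qed
  qed
qed

lemma fan_close_imp_qs:
  assumes H: "line_qs M H" "surj H" and \<kappa>: "\<kappa> > 1"
  obtains \<epsilon> where "\<epsilon> > 1"
    "\<And>L. strict_mono L \<Longrightarrow> surj L \<Longrightarrow> fan_close \<epsilon> (lift H) (lift L) \<Longrightarrow> line_qs \<kappa> (L \<circ> inv H)"
proof -
  have M: "M \<ge> 1" and mono: "strict_mono H" using H by (auto simp: line_qs_def)
  note inv = inv_strict_mono_surj[OF mono H(2)]
  obtain K where K: "K \<ge> 1" "\<And>a b c. a < b \<Longrightarrow> b < c \<Longrightarrow> H c - H b = H b - H a \<Longrightarrow>
    c - b \<le> K * (b - a) \<and> b - a \<le> K * (c - b)" using line_qs_inverse_ratio[OF H(1)] by metis
  obtain \<epsilon> where \<epsilon>: "\<epsilon> > 1"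
    "\<And>H L a b c. \<lbrakk>line_qs M H; surj H; strict_mono L; surj L; fan_close \<epsilon> (lift H) (lift L); a < b; b < c;
       c - b \<le> K * (b - a); b - a \<le> K * (c - b)\<rbrakk> \<Longrightarrow>
      good \<kappa> (lift H) (lift L) (Some c) (Some b) (Some a) None"
    using fan_close_distorts_little[OF M \<kappa> K(1)] by metis
  show ?thesis
  proof (rule that[OF \<epsilon>(1)])
    fix L assume L: "strict_mono L" "surj L" "fan_close \<epsilon> (lift H) (lift L)"
    let ?F = "L \<circ> inv H"
    have Fm: "strict_mono ?F" using L(1) inv(1) by (auto simp: strict_mono_def)
    have main: "?F (x + t) - ?F x \<le> \<kappa> * (?F x - ?F (x - t)) \<and> ?F x - ?F (x - t) \<le> \<kappa> * (?F (x + t) - ?F x)"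
      if t: "t > 0" for x t
    proof -
      let ?a = "inv H (x - t)" and ?b = "inv H x" and ?c = "inv H (x + t)"
      have abc: "?a < ?b" "?b < ?c" using inv(1) t by (auto simp: strict_mono_less)
      have "?c - ?b \<le> K * (?b - ?a) \<and> ?b - ?a \<le> K * (?c - ?b)" by (rule K(2)[OF abc]) (simp add: inv)
      then have "good \<kappa> (lift H) (lift L) (Some ?c) (Some ?b) (Some ?a) None"
        using \<epsilon>(2)[OF H L abc] by blast
      then have "sim \<kappa> (H ?c - H ?b) (L ?c - L ?b) (H ?b - H ?a) (L ?b - L ?a)"
        using good_iff_sim[OF mono L(1) abc] by blast
      then have "t * (L ?b - L ?a) \<le> t * (\<kappa> * (L ?c - L ?b))" "t * (L ?c - L ?b) \<le> t * (\<kappa> * (L ?b - L ?a))"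
        by (simp_all add: sim_def inv mult.left_commute)
      then show ?thesis using t by (simp add: mult_le_cancel_left_pos)
    qed
    show "line_qs \<kappa> ?F" by (rule line_qsI[OF _ Fm main]) (use \<kappa> in simp)
  qed
qed

lemma shear_distortion_ge_1:
  assumes h: "cyc_bij h" and l: "cyc_bij l"
    and E: "\<And>p. p \<in> qhat \<Longrightarrow> fan_enumeration p (E p)"
  shows "1 \<le> shear_distortion E (shear_map h) (shear_map l)"
proof (rule ccontr)
  assume "\<not> ?thesis"
  then have "shear_distortion E (shear_map h) (shear_map l) < 1" by simp
  then obtain \<kappa> where \<kappa>: "shear_distortion E (shear_map h) (shear_map l) \<le> ereal \<kappa>" "\<kappa> < 1"
    by (metis ereal_dense2 ereal_less(3) less_ereal.simps(1) less_imp_le one_ereal_def)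
  then have fc: "fan_close \<kappa> h l" using shear_distortion_le_iff[OF h l E] by blast
  let ?g = "imob 1 0 0 1"
  have g: "?g = id" by (rule imob_id)
  have "good \<kappa> h l (?g (Some (real 1))) (?g (Some 0)) (?g (Some (- real 1))) (?g None)"
    by (rule fan_closeD[OF fc _ _ refl]) simp_all
  then have "good \<kappa> h l (Some 1) (Some 0) (Some (-1)) None" unfolding g by simp
  moreover have "cr (k (Some 1)) (k (Some 0)) (k (Some (-1))) (k None) > 0" if "cyc_bij k" for k
    using that by (intro cr_pos) (auto simp: cyc_bij_inj)
  ultimately show False using h l \<kappa>(2) unfolding good_def
    by (smt (verit) mult_less_cancel_right2)
qed

lemma tendsto_one_iff_eventually_le:
  fixes d :: "nat \<Rightarrow> ereal"
  assumes "\<And>n. 1 \<le> d n"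
  shows "d \<longlonglongrightarrow> 1 \<longleftrightarrow> (\<forall>\<kappa>>1. \<forall>\<^sub>F n in sequentially. d n \<le> ereal \<kappa>)"
proof
  assume lim: "d \<longlonglongrightarrow> 1"
  show "\<forall>\<kappa>>1. \<forall>\<^sub>F n in sequentially. d n \<le> ereal \<kappa>"
  proof (intro allI impI)
    fix \<kappa> :: real assume "\<kappa> > 1"
    then have "\<forall>\<^sub>F n in sequentially. d n < ereal \<kappa>" by (intro order_tendstoD(2)[OF lim]) simp
    then show "\<forall>\<^sub>F n in sequentially. d n \<le> ereal \<kappa>" by (rule eventually_mono) simp
  qed
next
  assume ev: "\<forall>\<kappa>>1. \<forall>\<^sub>F n in sequentially. d n \<le> ereal \<kappa>"
  show "d \<longlonglongrightarrow> 1"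
  proof (rule order_tendstoI)
    fix a :: ereal assume "a < 1"
    then show "\<forall>\<^sub>F n in sequentially. a < d n" using assms by (intro always_eventually) (metis less_le_trans)
  next
    fix a :: ereal assume "1 < a"
    then obtain \<kappa> where \<kappa>: "1 < ereal \<kappa>" "ereal \<kappa> < a" using ereal_dense2 by blast
    then have "\<forall>\<^sub>F n in sequentially. d n \<le> ereal \<kappa>" using ev by simp
    then show "\<forall>\<^sub>F n in sequentially. d n < a" by (rule eventually_mono) (use \<kappa> in \<open>auto intro: le_less_trans\<close>)
  qed
qed

lemma tendsto_id_iff:
  assumes F: "\<And>n. \<exists>K. line_qs K (F n)" "\<And>n. surj (F n)"
  shows "tendsto_id (\<lambda>n. lift (F n)) \<longleftrightarrow> (\<forall>\<kappa>>1. \<forall>\<^sub>F n in sequentially. line_qs \<kappa> (F n))"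
proof
  have lift_inj: "lift A = lift B \<Longrightarrow> A = B" for A B by (metis ext lift_simps(2) option.inject)
  assume "tendsto_id (\<lambda>n. lift (F n))"
  then obtain Ms where Ms: "\<And>n. M_quasisymmetric (Ms n) (lift (F n))" "Ms \<longlonglongrightarrow> 1" unfolding tendsto_id_def by blast
  then have qs: "line_qs (Ms n) (F n)" for n unfolding M_quasisymmetric_iff using lift_inj by metis
  show "\<forall>\<kappa>>1. \<forall>\<^sub>F n in sequentially. line_qs \<kappa> (F n)"
  proof (intro allI impI)
    fix \<kappa> :: real assume "\<kappa> > 1"
    then have "\<forall>\<^sub>F n in sequentially. Ms n < \<kappa>" by (rule order_tendstoD(2)[OF Ms(2)])
    then show "\<forall>\<^sub>F n in sequentially. line_qs \<kappa> (F n)"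
      by (rule eventually_mono) (use qs line_qs_mono in \<open>metis less_imp_le\<close>)
  qed
next
  assume ev: "\<forall>\<kappa>>1. \<forall>\<^sub>F n in sequentially. line_qs \<kappa> (F n)"
  \<comment> \<open>The best constants converge to 1; a summand tending to 0 makes them admissible without showing that the infimum is attained.\<close>
  define I where "I n = Inf {M. line_qs M (F n)}" for n
  have bdd: "bdd_below {M. line_qs M (F n)}" for n by (rule bdd_belowI[of _ 1]) (simp add: line_qs_def)
  have ne: "{M. line_qs M (F n)} \<noteq> {}" for n using F(1) by auto
  have I1: "I n \<ge> 1" for n unfolding I_def by (rule cInf_greatest[OF ne]) (simp add: line_qs_def)
  have lim: "I \<longlonglongrightarrow> 1"
  proof (rule order_tendstoI)
    fix a :: real assume "a < 1"
    then show "\<forall>\<^sub>F n in sequentially. a < I n" using I1 by (intro always_eventually) (metis less_le_trans)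
  next
    fix a :: real assume "1 < a"
    then obtain \<kappa> where \<kappa>: "1 < \<kappa>" "\<kappa> < a" using dense by blast
    then have "\<forall>\<^sub>F n in sequentially. line_qs \<kappa> (F n)" using ev by blast
    then show "\<forall>\<^sub>F n in sequentially. I n < a"
    proof (rule eventually_mono)
      fix n assume "line_qs \<kappa> (F n)"
      then have "I n \<le> \<kappa>" unfolding I_def by (intro cInf_lower bdd) simp
      then show "I n < a" using \<kappa> by simp
    qed
  qed
  have "line_qs (I n + 1 / real (Suc n)) (F n)" for n
  proof -
    have "I n < I n + 1 / real (Suc n)" by simp
    then obtain M where "line_qs M (F n)" "M < I n + 1 / real (Suc n)"
      unfolding I_def using cInf_lessD[OF ne] by blast
    then show ?thesis using line_qs_mono less_imp_le by blast
  qed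
  then have "M_quasisymmetric (I n + 1 / real (Suc n)) (lift (F n))" for n
    unfolding M_quasisymmetric_iff using F(2) by blast
  moreover have "(\<lambda>n. I n + 1 / real (Suc n)) \<longlonglongrightarrow> 1"
    using tendsto_add[OF lim LIMSEQ_inverse_real_of_nat] by (simp add: inverse_eq_divide)
  ultimately show "tendsto_id (\<lambda>n. lift (F n))"
    unfolding tendsto_id_def by (intro exI[of _ "\<lambda>n. I n + 1 / real (Suc n)"] conjI allI)
qed

theorem theoremB:
  fixes h :: "(rhat \<Rightarrow> rhat) set"
    and hs :: "nat \<Rightarrow> (rhat \<Rightarrow> rhat) set"
    and E :: "rhat \<Rightarrow> int \<Rightarrow> rhat set"
    and s :: "rhat set \<Rightarrow> real"
    and ss :: "nat \<Rightarrow> rhat set \<Rightarrow> real"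
  assumes "h \<in> universal_teichmueller"
    and "\<And>n. hs n \<in> universal_teichmueller"
    and "\<And>p. p \<in> qhat \<Longrightarrow> fan_enumeration p (E p)"
    and "s = shear_map (normalized_rep h)"
    and "\<And>n. ss n = shear_map (normalized_rep (hs n))"
  shows "teichmueller_tendsto hs h \<longleftrightarrow> (\<lambda>n. shear_distortion E s (ss n)) \<longlonglongrightarrow> 1"
proof -
  obtain H M where H: "normalized_rep h = lift H" "line_qs M H" "surj H"
    using normalized_rep_line_qs[OF assms(1)] by blast
  have "\<exists>L M. normalized_rep (hs n) = lift L \<and> line_qs M L \<and> surj L" for n
    using normalized_rep_line_qs[OF assms(2)] by metis
  then obtain L Ms where L: "\<And>n. normalized_rep (hs n) = lift (L n)" "\<And>n. line_qs (Ms n) (L n)" "\<And>n. surj (L n)"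
    by metis
  have mono: "strict_mono H" "\<And>n. strict_mono (L n)" using H(2) L(2) by (auto simp: line_qs_def)
  note inv = inv_strict_mono_surj[OF mono(1) H(3)]
  define F where "F n = L n \<circ> inv H" for n
  have FH: "F n \<circ> H = L n" for n by (simp add: F_def fun_eq_iff inv)
  have Fsurj: "surj (F n)" for n unfolding F_def using L(3) inv(2) by (rule comp_surj[rotated])
  have Fqs: "\<exists>K. line_qs K (F n)" for n unfolding F_def by (rule line_qs_comp_inverse[OF H(2,3) L(2)])
  have "inv (lift H) = lift (inv H)"
  proof (rule inv_equality)
    show "lift (inv H) (lift H p) = p" "lift H (lift (inv H) p) = p" for p using inv by (cases p; simp)+
  qed
  then have comp: "normalized_rep (hs n) \<circ> inv (normalized_rep h) = lift (F n)" for n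
    unfolding H(1) L(1) F_def by (simp add: lift_def option.map_comp fun_eq_iff)
  have cyc: "cyc_bij (lift H)" "cyc_bij (lift (L n))" for n
    using cyc_bij_lift mono H(3) L(3) by blast+
  let ?d = "\<lambda>n. shear_distortion E s (ss n)"
  have d_le: "?d n \<le> ereal \<kappa> \<longleftrightarrow> fan_close \<kappa> (lift H) (lift (L n))" for n \<kappa>
    unfolding assms(4,5) H(1) L(1) by (rule shear_distortion_le_iff[OF cyc assms(3)])
  have d_ge: "1 \<le> ?d n" for n
    unfolding assms(4,5) H(1) L(1) by (rule shear_distortion_ge_1[OF cyc assms(3)])
  have "teichmueller_tendsto hs h \<longleftrightarrow> (\<forall>\<kappa>>1. \<forall>\<^sub>F n in sequentially. line_qs \<kappa> (F n))"
    unfolding teichmueller_tendsto_def comp by (rule tendsto_id_iff[OF Fqs Fsurj])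
  also have "\<dots> \<longleftrightarrow> (\<forall>\<kappa>>1. \<forall>\<^sub>F n in sequentially. fan_close \<kappa> (lift H) (lift (L n)))"
  proof
    assume "\<forall>\<kappa>>1. \<forall>\<^sub>F n in sequentially. line_qs \<kappa> (F n)"
    then have "tendsto_id (\<lambda>n. lift (F n))" using tendsto_id_iff[of F, OF Fqs Fsurj] by blast
    then obtain Ms where "\<And>n. M_quasisymmetric (Ms n) (lift (F n))" and lim: "Ms \<longlonglongrightarrow> 1"
      unfolding tendsto_id_def by blast
    then have "line_qs (Ms n) (F n)" for n
      unfolding M_quasisymmetric_iff by (metis ext lift_simps(2) option.inject)
    then show "\<forall>\<kappa>>1. \<forall>\<^sub>F n in sequentially. fan_close \<kappa> (lift H) (lift (L n))"
      using qs_tendsto_imp_fan_close[OF H(2,3) _ lim, of F] unfolding FH by blast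
  next
    assume ev: "\<forall>\<kappa>>1. \<forall>\<^sub>F n in sequentially. fan_close \<kappa> (lift H) (lift (L n))"
    show "\<forall>\<kappa>>1. \<forall>\<^sub>F n in sequentially. line_qs \<kappa> (F n)"
    proof (intro allI impI)
      fix \<kappa> :: real assume "\<kappa> > 1"
      then obtain \<epsilon> where \<epsilon>: "\<epsilon> > 1"
        "\<And>L. strict_mono L \<Longrightarrow> surj L \<Longrightarrow> fan_close \<epsilon> (lift H) (lift L) \<Longrightarrow> line_qs \<kappa> (L \<circ> inv H)"
        using fan_close_imp_qs[OF H(2,3)] by metis
      have "\<forall>\<^sub>F n in sequentially. fan_close \<epsilon> (lift H) (lift (L n))" using ev \<epsilon>(1) by blast
      then show "\<forall>\<^sub>F n in sequentially. line_qs \<kappa> (F n)"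
        unfolding F_def by (rule eventually_mono) (rule \<epsilon>(2)[OF mono(2) L(3)])
    qed
  qed
  also have "\<dots> \<longleftrightarrow> ?d \<longlonglongrightarrow> 1"
    unfolding tendsto_one_iff_eventually_le[OF d_ge] d_le ..
  finally show ?thesis .
qed

end
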